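(* Let $\mathrm S$ be a dependent type theory admitting all the rules of two-dimensional type theory $\mathrm{ML}_2$. For each context $\Gamma$ and type $\Gamma\vdash A\ \mathsf{type}$ of $\mathrm S$, the weakening $2$-functor $\Delta_A\colon\mathfrak T_{\mathrm S}(\Gamma)\to\mathfrak T_{\mathrm S}(\Gamma.A)$ has a right retract biadjoint $\Pi_A$.
   Context: **Type theory.** $\mathrm S$ has judgement forms $A\ \mathsf{type}$, $a:A$, $A=B\ \mathsf{type}$, $a=b:A$ (definitional equality), relative to contexts $\Gamma=(x_1:A_1,\dots,x_n:A_n)$ with $A_i$ a type in context $(x_1:A_1,\dots,x_{i-1}:A_{i-1})$; equality rules (definitional equality is a congruence) and structural rules (weakening, contraction, exchange, substitution). All rules are relative to an arbitrary ambient context, and all operations are stable under substitution in it. Rules of $\mathrm{ML}_2$: - $\Sigma$: from $A$ and $x:A\vdash B(x)$ form $\Sigma(A,B)$; from $a:A$, $b:B(a)$ get $\langle a,b\rangle:\Sigma(A,B)$; from $z:\Sigma(A,B)\vdash C(z)\ \mathsf{type}$ and $x:A,y:B(x)\vdash d(x,y):C(\langle x,y\rangle)$ get $z:\Sigma(A,B)\vdash \mathrm E_d(z):C(z)$ with $\mathrm E_d(\langle x,y\rangle)=d(x,y)$. - Unit: $\mathbf 1\ \mathsf{type}$; $\star:\mathbf 1$; from $z:\mathbf 1\vdash C(z)\ \mathsf{type}$ and $d:C(\star)$ get $z:\mathbf 1\vdash\mathrm U_d(z):C(z)$ with $\mathrm U_d(\star)=d$. - Identity: from $a,b:A$ form $\mathrm{Id}_A(a,b)$;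 $\mathrm r(a):\mathrm{Id}_A(a,a)$; from $x,y:A,p:\mathrm{Id}_A(x,y)\vdash C(x,y,p)\ \mathsf{type}$ and $x:A\vdash d(x):C(x,x,\mathrm r(x))$ get $x,y:A,p:\mathrm{Id}_A(x,y)\vdash\mathrm J_d(x,y,p):C(x,y,p)$ with $\mathrm J_d(x,x,\mathrm r(x))=d(x)$. - $\Pi$: form $\Pi(A,B)$; from $x:A\vdash f(x):B(x)$ get $\lambda f:\Pi(A,B)$; from $m:\Pi(A,B)$ get $y:A\vdash m\cdot y:B(y)$; $(\lambda f)\cdot y=f(y)$. - Discrete identity types: if $p,q:\mathrm{Id}_A(a,b)$ and $\alpha:\mathrm{Id}(p,q)$ then $p=q$ and $\alpha=\mathrm r(p)$. - Function extensionality: from $m,n:\Pi(A,B)$ and $x:A\vdash p(x):\mathrm{Id}(m\cdot x,n\cdot x)$ get $\mathsf{ext}(m,n,p):\mathrm{Id}(m,n)$; $\mathsf{ext}(m,m,[x]\mathrm r(m\cdot x))=\mathrm r(m)$; $\mathsf{ext}(m,n,p)\ast x=p(x)$, where $p\ast a:=\mathrm J_{[x]\mathrm r(x\cdot a)}(m,n,p)$. By $\Pi$-abstracting over a telescope $\Delta$ one derives extended identity elimination/computation, in which $C$ and the conclusion live in context $x,y:A,p:\mathrm{Id}_A(x,y),\Delta$ and $d$ in context $x:A,\Delta[x,x,\mathrm r(x)/x,y,p]$. Vector notation is used: $x:\Gamma$ stands for a list of variables of the successive types of $\Gamma$. **The 2-category $\mathfrak T_{\mathrm S}(\Gamma)$.**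 (Modulo $\alpha$-conversion and definitional equality.) Objects: types $A$ in context $\Gamma$. 1-cells $A\to B$: judgements $x:\Gamma,y:A(x)\vdash f(x,y):B(x)$, composed by substitution. 2-cells $f\Rightarrow g$: judgements $x:\Gamma,y:A(x)\vdash\alpha(x,y):\mathrm{Id}_{B(x)}(f(x,y),g(x,y))$. For $p:\mathrm{Id}_A(y,y')$, $q:\mathrm{Id}_A(y',y'')$, the composite $q\circ p:\mathrm{Id}_A(y,y'')$ is defined by elimination on $q$ with $\mathrm r(y')\circ p=p$; for $h\colon A\to B$, $h^\bullet(p):\mathrm{Id}_B(hy,hy')$ is defined by elimination on $p$ with $h^\bullet(\mathrm r(y))=\mathrm r(hy)$. Vertical composition of 2-cells is pointwise $\circ$, identities are $\mathrm r(f(x,y))$, whiskering on the right is substitution and on the left is application of $h^\bullet$. $\Gamma.A$ is the context $(x:\Gamma,y:A(x))$, and $\Delta_A$ sends a type, term or identity proof in context $\Gamma$ to the same one weakened to context $\Gamma.A$. **Retract biadjoints.** A functor $P$ is a *surjective equivalence* if there are a functor $I$ with $PI=\mathrm{id}$ and an isomorphism $\theta\colon\mathrm{id}\Rightarrow IP$ with $\theta I=\mathrm{id}_I$, $P\theta=\mathrm{id}_P$. For a 2-functor $U\colon\mathbf K\to\mathbf L$ and $x\in\mathbf L$, a *retract bicoreflection* of $x$ along $U$ is an object $Gx\in\mathbf K$ with a morphism $\epsilon_x\colon UGx\to x$ such that for each $y\in\mathbf K$ the functor $\mathbf K(y,Gx)\to\mathbf L(Uy,x)$, $h\mapsto\epsilon_x\circ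 Uh$, is a surjective equivalence of categories. A *right retract biadjoint* for $U$ is a choice, for each $x\in\mathbf L$, of a retract bicoreflection of $x$ along $U$. *)

theory Defs
  imports Main
begin

section \<open>Raw syntax\<close>

text \<open>
  Raw types and terms, with de Bruijn indices, so that alpha-equivalent expressions are equal.
  The last argument of \<open>SigE\<close>, \<open>UnitE\<close> is the eliminated term; \<open>d\<close> binds two variables in
  \<open>SigE d z\<close> (index 1 is the first component, index 0 the second), none in \<open>UnitE d z\<close>, and one in
  \<open>J d x y p\<close>. In \<open>Ext m n p\<close> the argument \<open>p\<close> binds one variable.
  \<open>Op c ts\<close> are the further operators of an arbitrary extension of the theory: an argument \<open>(n, t)\<close>
  is an expression \<open>t\<close> with \<open>n\<close> bound variables.
\<close>

datatype 'c exp =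
    Var nat
  | Sig "'c exp" "'c exp"
  | Pr "'c exp" "'c exp"
  | SigE "'c exp" "'c exp"
  | Unt
  | Star
  | UnitE "'c exp" "'c exp"
  | Idt "'c exp" "'c exp" "'c exp"
  | Refl "'c exp"
  | J "'c exp" "'c exp" "'c exp" "'c exp"
  | Pi "'c exp" "'c exp"
  | Lam "'c exp"
  | App "'c exp" "'c exp"
  | Ext "'c exp" "'c exp" "'c exp"
  | Op 'c "(nat \<times> 'c exp) list"

definition up :: "(nat \<Rightarrow> nat) \<Rightarrow> nat \<Rightarrow> nat" where
  "up \<rho> = (\<lambda>i. case i of 0 \<Rightarrow> 0 | Suc j \<Rightarrow> Suc (\<rho> j))"

primrec ren :: "'c exp \<Rightarrow> (nat \<Rightarrow> nat) \<Rightarrow> 'c exp" where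
  "ren (Var i) = (\<lambda>\<rho>. Var (\<rho> i))"
| "ren (Sig A B) = (\<lambda>\<rho>. Sig (ren A \<rho>) (ren B (up \<rho>)))"
| "ren (Pr a b) = (\<lambda>\<rho>. Pr (ren a \<rho>) (ren b \<rho>))"
| "ren (SigE d z) = (\<lambda>\<rho>. SigE (ren d (up (up \<rho>))) (ren z \<rho>))"
| "ren Unt = (\<lambda>\<rho>. Unt)"
| "ren Star = (\<lambda>\<rho>. Star)"
| "ren (UnitE d z) = (\<lambda>\<rho>. UnitE (ren d \<rho>) (ren z \<rho>))"
| "ren (Idt A a b) = (\<lambda>\<rho>. Idt (ren A \<rho>) (ren a \<rho>) (ren b \<rho>))"
| "ren (Refl a) = (\<lambda>\<rho>. Refl (ren a \<rho>))"
| "ren (J d x y p) = (\<lambda>\<rho>. J (ren d (up \<rho>)) (ren x \<rho>) (ren y \<rho>) (ren p \<rho>))"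
| "ren (Pi A B) = (\<lambda>\<rho>. Pi (ren A \<rho>) (ren B (up \<rho>)))"
| "ren (Lam f) = (\<lambda>\<rho>. Lam (ren f (up \<rho>)))"
| "ren (App m a) = (\<lambda>\<rho>. App (ren m \<rho>) (ren a \<rho>))"
| "ren (Ext m n p) = (\<lambda>\<rho>. Ext (ren m \<rho>) (ren n \<rho>) (ren p (up \<rho>)))"
| "ren (Op c ts) = (\<lambda>\<rho>. Op c (map (\<lambda>(n, r). (n, r ((up ^^ n) \<rho>))) (map (map_prod id ren) ts)))"

abbreviation wk :: "'c exp \<Rightarrow> 'c exp" where
  "wk t \<equiv> ren t Suc"

type_synonym 'c sub = "nat \<Rightarrow> 'c exp"

definition scons :: "'c exp \<Rightarrow> 'c sub \<Rightarrow> 'c sub"  (infixr "\<rhd>" 65) where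
  "t \<rhd> \<sigma> = (\<lambda>i. case i of 0 \<Rightarrow> t | Suc j \<Rightarrow> \<sigma> j)"

definition lift :: "'c sub \<Rightarrow> 'c sub" where
  "lift \<sigma> = Var 0 \<rhd> (\<lambda>i. wk (\<sigma> i))"

primrec subst :: "'c exp \<Rightarrow> 'c sub \<Rightarrow> 'c exp"  ("_\<langle>_\<rangle>" [1000, 0] 1000) where
  "subst (Var i) = (\<lambda>\<sigma>. \<sigma> i)"
| "subst (Sig A B) = (\<lambda>\<sigma>. Sig (subst A \<sigma>) (subst B (lift \<sigma>)))"
| "subst (Pr a b) = (\<lambda>\<sigma>. Pr (subst a \<sigma>) (subst b \<sigma>))"
| "subst (SigE d z) = (\<lambda>\<sigma>. SigE (subst d (lift (lift \<sigma>))) (subst z \<sigma>))"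
| "subst Unt = (\<lambda>\<sigma>. Unt)"
| "subst Star = (\<lambda>\<sigma>. Star)"
| "subst (UnitE d z) = (\<lambda>\<sigma>. UnitE (subst d \<sigma>) (subst z \<sigma>))"
| "subst (Idt A a b) = (\<lambda>\<sigma>. Idt (subst A \<sigma>) (subst a \<sigma>) (subst b \<sigma>))"
| "subst (Refl a) = (\<lambda>\<sigma>. Refl (subst a \<sigma>))"
| "subst (J d x y p) = (\<lambda>\<sigma>. J (subst d (lift \<sigma>)) (subst x \<sigma>) (subst y \<sigma>) (subst p \<sigma>))"
| "subst (Pi A B) = (\<lambda>\<sigma>. Pi (subst A \<sigma>) (subst B (lift \<sigma>)))"
| "subst (Lam f) = (\<lambda>\<sigma>. Lam (subst f (lift \<sigma>)))"
| "subst (App m a) = (\<lambda>\<sigma>. App (subst m \<sigma>) (subst a \<sigma>))"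
| "subst (Ext m n p) = (\<lambda>\<sigma>. Ext (subst m \<sigma>) (subst n \<sigma>) (subst p (lift \<sigma>)))"
| "subst (Op c ts) =
    (\<lambda>\<sigma>. Op c (map (\<lambda>(n, s). (n, s ((lift ^^ n) \<sigma>))) (map (map_prod id subst) ts)))"

datatype 'c judgement =
    isTy "'c exp"                      \<comment> \<open>\<open>A type\<close>\<close>
  | isTm "'c exp" "'c exp"             \<comment> \<open>\<open>a : A\<close>\<close>
  | eqTy "'c exp" "'c exp"             \<comment> \<open>\<open>A = B type\<close>\<close>
  | eqTm "'c exp" "'c exp" "'c exp"    \<comment> \<open>\<open>a = b : A\<close>\<close>

primrec substJ :: "'c judgement \<Rightarrow> 'c sub \<Rightarrow> 'c judgement" where
  "substJ (isTy A) \<sigma> = isTy (A\<langle>\<sigma>\<rangle>)"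
| "substJ (isTm a A) \<sigma> = isTm (a\<langle>\<sigma>\<rangle>) (A\<langle>\<sigma>\<rangle>)"
| "substJ (eqTy A B) \<sigma> = eqTy (A\<langle>\<sigma>\<rangle>) (B\<langle>\<sigma>\<rangle>)"
| "substJ (eqTm a b A) \<sigma> = eqTm (a\<langle>\<sigma>\<rangle>) (b\<langle>\<sigma>\<rangle>) (A\<langle>\<sigma>\<rangle>)"

section \<open>Dependent type theories\<close>

text \<open>
  Contexts are lists with the most recently declared type at the head; \<open>\<Gamma> ! i\<close> is a type in context
  \<open>drop (Suc i) \<Gamma>\<close>. A theory is identified with its set of derivable judgements in context.
\<close>

type_synonym 'c ctx = "'c exp list"
type_synonym 'c type_theory = "'c ctx \<Rightarrow> 'c judgement \<Rightarrow> bool"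

primrec wf_ctx :: "'c type_theory \<Rightarrow> 'c ctx \<Rightarrow> bool" where
  "wf_ctx S [] \<longleftrightarrow> True"
| "wf_ctx S (A # \<Gamma>) \<longleftrightarrow> wf_ctx S \<Gamma> \<and> S \<Gamma> (isTy A)"

text \<open>Context morphisms: one term in context \<open>\<Gamma>\<close> for each variable of \<open>\<Delta>\<close>.\<close>

definition ctx_mor :: "'c type_theory \<Rightarrow> 'c ctx \<Rightarrow> 'c sub \<Rightarrow> 'c ctx \<Rightarrow> bool" where
  "ctx_mor S \<Gamma> \<sigma> \<Delta> \<longleftrightarrow> wf_ctx S \<Gamma> \<and> wf_ctx S \<Delta> \<and>
    (\<forall>i < length \<Delta>. S \<Gamma> (isTm (\<sigma> i) ((\<Delta> ! i)\<langle>\<lambda>j. \<sigma> (Suc (i + j))\<rangle>)))"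

definition ctx_mor_eq :: "'c type_theory \<Rightarrow> 'c ctx \<Rightarrow> 'c sub \<Rightarrow> 'c sub \<Rightarrow> 'c ctx \<Rightarrow> bool" where
  "ctx_mor_eq S \<Gamma> \<sigma> \<tau> \<Delta> \<longleftrightarrow> ctx_mor S \<Gamma> \<sigma> \<Delta> \<and> ctx_mor S \<Gamma> \<tau> \<Delta> \<and>
    (\<forall>i < length \<Delta>. S \<Gamma> (eqTm (\<sigma> i) (\<tau> i) ((\<Delta> ! i)\<langle>\<lambda>j. \<sigma> (Suc (i + j))\<rangle>)))"

text \<open>
  The structural rules are given by closure under simultaneous substitution along context morphisms.
  Weakening, contraction and exchange are the instances where \<open>\<sigma>\<close> consists of variables, and
  the usual substitution rule is the instance where one variable is replaced by a term
  and the others are kept.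
\<close>

locale dependent_type_theory =
  fixes S :: "'c type_theory"  (infix "\<turnstile>" 50)
  assumes ctx_valid: "\<Gamma> \<turnstile> \<J> \<Longrightarrow> wf_ctx S \<Gamma>"
    and tm_valid: "\<Gamma> \<turnstile> isTm a A \<Longrightarrow> \<Gamma> \<turnstile> isTy A"
    and eqTy_valid: "\<Gamma> \<turnstile> eqTy A B \<Longrightarrow> \<Gamma> \<turnstile> isTy A \<and> \<Gamma> \<turnstile> isTy B"
    and eqTm_valid: "\<Gamma> \<turnstile> eqTm a b A \<Longrightarrow> \<Gamma> \<turnstile> isTm a A \<and> \<Gamma> \<turnstile> isTm b A"
    and var: "\<lbrakk>wf_ctx S \<Gamma>; i < length \<Gamma>\<rbrakk> \<Longrightarrow>
      \<Gamma> \<turnstile> isTm (Var i) (ren (\<Gamma> ! i) (\<lambda>j. Suc (i + j)))"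
    and substitution: "\<lbrakk>ctx_mor S \<Gamma> \<sigma> \<Delta>; \<Delta> \<turnstile> \<J>\<rbrakk> \<Longrightarrow> \<Gamma> \<turnstile> substJ \<J> \<sigma>"
    and substitution_eqTy: "\<lbrakk>ctx_mor_eq S \<Gamma> \<sigma> \<tau> \<Delta>; \<Delta> \<turnstile> isTy A\<rbrakk> \<Longrightarrow> \<Gamma> \<turnstile> eqTy (A\<langle>\<sigma>\<rangle>) (A\<langle>\<tau>\<rangle>)"
    and substitution_eqTm: "\<lbrakk>ctx_mor_eq S \<Gamma> \<sigma> \<tau> \<Delta>; \<Delta> \<turnstile> isTm a A\<rbrakk> \<Longrightarrow>
      \<Gamma> \<turnstile> eqTm (a\<langle>\<sigma>\<rangle>) (a\<langle>\<tau>\<rangle>) (A\<langle>\<sigma>\<rangle>)"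
    and eqTy_refl: "\<Gamma> \<turnstile> isTy A \<Longrightarrow> \<Gamma> \<turnstile> eqTy A A"
    and eqTy_sym: "\<Gamma> \<turnstile> eqTy A B \<Longrightarrow> \<Gamma> \<turnstile> eqTy B A"
    and eqTy_trans: "\<lbrakk>\<Gamma> \<turnstile> eqTy A B; \<Gamma> \<turnstile> eqTy B C\<rbrakk> \<Longrightarrow> \<Gamma> \<turnstile> eqTy A C"
    and eqTm_refl: "\<Gamma> \<turnstile> isTm a A \<Longrightarrow> \<Gamma> \<turnstile> eqTm a a A"
    and eqTm_sym: "\<Gamma> \<turnstile> eqTm a b A \<Longrightarrow> \<Gamma> \<turnstile> eqTm b a A"
    and eqTm_trans: "\<lbrakk>\<Gamma> \<turnstile> eqTm a b A; \<Gamma> \<turnstile> eqTm b c A\<rbrakk> \<Longrightarrow> \<Gamma> \<turnstile> eqTm a c A"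
    and conv: "\<lbrakk>\<Gamma> \<turnstile> isTm a A; \<Gamma> \<turnstile> eqTy A B\<rbrakk> \<Longrightarrow> \<Gamma> \<turnstile> isTm a B"
    and conv_eq: "\<lbrakk>\<Gamma> \<turnstile> eqTm a b A; \<Gamma> \<turnstile> eqTy A B\<rbrakk> \<Longrightarrow> \<Gamma> \<turnstile> eqTm a b B"

section \<open>Two-dimensional type theory\<close>

text \<open>
  In an elimination rule the motive \<open>C\<close> lives in the context extended by the eliminated
  variables; the rules conclude directly with an arbitrary instance of it.

  \<open>ctx_Id A \<Gamma>\<close> is the context \<open>\<Gamma>, x : A, y : A, p : Id_A(x, y)\<close>; the substitution
  \<open>p \<rhd> b \<rhd> a \<rhd> Var\<close> instantiates \<open>x, y, p\<close> by \<open>a, b, p\<close>, and \<open>diag\<close>, from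
  \<open>\<Gamma>, x : A\<close>, instantiates them by \<open>x, x, r(x)\<close>.
\<close>

definition ctx_Id :: "'c exp \<Rightarrow> 'c ctx \<Rightarrow> 'c ctx" where
  "ctx_Id A \<Gamma> = Idt (wk (wk A)) (Var 1) (Var 0) # wk A # A # \<Gamma>"

definition diag :: "'c sub" where
  "diag = Refl (Var 0) \<rhd> Var 0 \<rhd> Var"

text \<open>From \<open>\<Gamma>, x : A, y : B(x)\<close>, instantiate \<open>z : Sig A B\<close> by the pair of \<open>x\<close> and \<open>y\<close>.\<close>

definition pair_sub :: "'c sub" where
  "pair_sub = Pr (Var 1) (Var 0) \<rhd> (\<lambda>i. Var (i + 2))"

text \<open>\<open>p \<ast> a\<close>, for \<open>p : Id(m, n)\<close> with \<open>m, n\<close> in a \<open>\<Pi>\<close>-type.\<close>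

definition happly :: "'c exp \<Rightarrow> 'c exp \<Rightarrow> 'c exp \<Rightarrow> 'c exp \<Rightarrow> 'c exp" where
  "happly m n p a = J (Refl (App (Var 0) (wk a))) m n p"

text \<open>
  Nothing is required of the further operators \<open>Op\<close>: they may have arbitrary rules of their own.
\<close>

locale ml2 = dependent_type_theory S for S :: "'c type_theory"  (infix "\<turnstile>" 50) +
  assumes
    Sig_form: "\<lbrakk>\<Gamma> \<turnstile> isTy A; A # \<Gamma> \<turnstile> isTy B\<rbrakk> \<Longrightarrow> \<Gamma> \<turnstile> isTy (Sig A B)"
    and Sig_cong: "\<lbrakk>\<Gamma> \<turnstile> eqTy A A'; A # \<Gamma> \<turnstile> eqTy B B'\<rbrakk> \<Longrightarrow> \<Gamma> \<turnstile> eqTy (Sig A B) (Sig A' B')"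
    and Pr_intro: "\<lbrakk>A # \<Gamma> \<turnstile> isTy B; \<Gamma> \<turnstile> isTm a A; \<Gamma> \<turnstile> isTm b (B\<langle>a \<rhd> Var\<rangle>)\<rbrakk> \<Longrightarrow>
      \<Gamma> \<turnstile> isTm (Pr a b) (Sig A B)"
    and Pr_cong: "\<lbrakk>A # \<Gamma> \<turnstile> isTy B; \<Gamma> \<turnstile> eqTm a a' A; \<Gamma> \<turnstile> eqTm b b' (B\<langle>a \<rhd> Var\<rangle>)\<rbrakk> \<Longrightarrow>
      \<Gamma> \<turnstile> eqTm (Pr a b) (Pr a' b') (Sig A B)"
    and Sig_elim: "\<lbrakk>A # \<Gamma> \<turnstile> isTy B; Sig A B # \<Gamma> \<turnstile> isTy C; B # A # \<Gamma> \<turnstile> isTm d (C\<langle>pair_sub\<rangle>);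
      \<Gamma> \<turnstile> isTm z (Sig A B)\<rbrakk> \<Longrightarrow> \<Gamma> \<turnstile> isTm (SigE d z) (C\<langle>z \<rhd> Var\<rangle>)"
    and SigE_cong: "\<lbrakk>A # \<Gamma> \<turnstile> isTy B; Sig A B # \<Gamma> \<turnstile> isTy C; B # A # \<Gamma> \<turnstile> eqTm d d' (C\<langle>pair_sub\<rangle>);
      \<Gamma> \<turnstile> eqTm z z' (Sig A B)\<rbrakk> \<Longrightarrow> \<Gamma> \<turnstile> eqTm (SigE d z) (SigE d' z') (C\<langle>z \<rhd> Var\<rangle>)"
    and Sig_comp: "\<lbrakk>A # \<Gamma> \<turnstile> isTy B; Sig A B # \<Gamma> \<turnstile> isTy C; B # A # \<Gamma> \<turnstile> isTm d (C\<langle>pair_sub\<rangle>);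
      \<Gamma> \<turnstile> isTm a A; \<Gamma> \<turnstile> isTm b (B\<langle>a \<rhd> Var\<rangle>)\<rbrakk> \<Longrightarrow>
      \<Gamma> \<turnstile> eqTm (SigE d (Pr a b)) (d\<langle>b \<rhd> a \<rhd> Var\<rangle>) (C\<langle>Pr a b \<rhd> Var\<rangle>)"
    and Unt_form: "wf_ctx S \<Gamma> \<Longrightarrow> \<Gamma> \<turnstile> isTy Unt"
    and Star_intro: "wf_ctx S \<Gamma> \<Longrightarrow> \<Gamma> \<turnstile> isTm Star Unt"
    and Unt_elim: "\<lbrakk>Unt # \<Gamma> \<turnstile> isTy C; \<Gamma> \<turnstile> isTm d (C\<langle>Star \<rhd> Var\<rangle>); \<Gamma> \<turnstile> isTm z Unt\<rbrakk> \<Longrightarrow>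
      \<Gamma> \<turnstile> isTm (UnitE d z) (C\<langle>z \<rhd> Var\<rangle>)"
    and UnitE_cong: "\<lbrakk>Unt # \<Gamma> \<turnstile> isTy C; \<Gamma> \<turnstile> eqTm d d' (C\<langle>Star \<rhd> Var\<rangle>); \<Gamma> \<turnstile> eqTm z z' Unt\<rbrakk> \<Longrightarrow>
      \<Gamma> \<turnstile> eqTm (UnitE d z) (UnitE d' z') (C\<langle>z \<rhd> Var\<rangle>)"
    and Unt_comp: "\<lbrakk>Unt # \<Gamma> \<turnstile> isTy C; \<Gamma> \<turnstile> isTm d (C\<langle>Star \<rhd> Var\<rangle>)\<rbrakk> \<Longrightarrow>
      \<Gamma> \<turnstile> eqTm (UnitE d Star) d (C\<langle>Star \<rhd> Var\<rangle>)"
    and Idt_form: "\<lbrakk>\<Gamma> \<turnstile> isTm a A; \<Gamma> \<turnstile> isTm b A\<rbrakk> \<Longrightarrow> \<Gamma> \<turnstile> isTy (Idt A a b)"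
    and Idt_cong: "\<lbrakk>\<Gamma> \<turnstile> eqTy A A'; \<Gamma> \<turnstile> eqTm a a' A; \<Gamma> \<turnstile> eqTm b b' A\<rbrakk> \<Longrightarrow>
      \<Gamma> \<turnstile> eqTy (Idt A a b) (Idt A' a' b')"
    and Refl_intro: "\<Gamma> \<turnstile> isTm a A \<Longrightarrow> \<Gamma> \<turnstile> isTm (Refl a) (Idt A a a)"
    and Refl_cong: "\<Gamma> \<turnstile> eqTm a a' A \<Longrightarrow> \<Gamma> \<turnstile> eqTm (Refl a) (Refl a') (Idt A a a)"
    and Idt_elim: "\<lbrakk>ctx_Id A \<Gamma> \<turnstile> isTy C; A # \<Gamma> \<turnstile> isTm d (C\<langle>diag\<rangle>);
      \<Gamma> \<turnstile> isTm a A; \<Gamma> \<turnstile> isTm b A; \<Gamma> \<turnstile> isTm p (Idt A a b)\<rbrakk> \<Longrightarrow>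
      \<Gamma> \<turnstile> isTm (J d a b p) (C\<langle>p \<rhd> b \<rhd> a \<rhd> Var\<rangle>)"
    and J_cong: "\<lbrakk>ctx_Id A \<Gamma> \<turnstile> isTy C; A # \<Gamma> \<turnstile> eqTm d d' (C\<langle>diag\<rangle>);
      \<Gamma> \<turnstile> eqTm a a' A; \<Gamma> \<turnstile> eqTm b b' A; \<Gamma> \<turnstile> eqTm p p' (Idt A a b)\<rbrakk> \<Longrightarrow>
      \<Gamma> \<turnstile> eqTm (J d a b p) (J d' a' b' p') (C\<langle>p \<rhd> b \<rhd> a \<rhd> Var\<rangle>)"
    and Idt_comp: "\<lbrakk>ctx_Id A \<Gamma> \<turnstile> isTy C; A # \<Gamma> \<turnstile> isTm d (C\<langle>diag\<rangle>); \<Gamma> \<turnstile> isTm a A\<rbrakk> \<Longrightarrow>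
      \<Gamma> \<turnstile> eqTm (J d a a (Refl a)) (d\<langle>a \<rhd> Var\<rangle>) (C\<langle>Refl a \<rhd> a \<rhd> a \<rhd> Var\<rangle>)"
    and Pi_form: "\<lbrakk>\<Gamma> \<turnstile> isTy A; A # \<Gamma> \<turnstile> isTy B\<rbrakk> \<Longrightarrow> \<Gamma> \<turnstile> isTy (Pi A B)"
    and Pi_cong: "\<lbrakk>\<Gamma> \<turnstile> eqTy A A'; A # \<Gamma> \<turnstile> eqTy B B'\<rbrakk> \<Longrightarrow> \<Gamma> \<turnstile> eqTy (Pi A B) (Pi A' B')"
    and Lam_intro: "A # \<Gamma> \<turnstile> isTm f B \<Longrightarrow> \<Gamma> \<turnstile> isTm (Lam f) (Pi A B)"
    and Lam_cong: "A # \<Gamma> \<turnstile> eqTm f f' B \<Longrightarrow> \<Gamma> \<turnstile> eqTm (Lam f) (Lam f') (Pi A B)"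
    and App_elim: "\<lbrakk>A # \<Gamma> \<turnstile> isTy B; \<Gamma> \<turnstile> isTm m (Pi A B); \<Gamma> \<turnstile> isTm a A\<rbrakk> \<Longrightarrow>
      \<Gamma> \<turnstile> isTm (App m a) (B\<langle>a \<rhd> Var\<rangle>)"
    and App_cong: "\<lbrakk>A # \<Gamma> \<turnstile> isTy B; \<Gamma> \<turnstile> eqTm m m' (Pi A B); \<Gamma> \<turnstile> eqTm a a' A\<rbrakk> \<Longrightarrow>
      \<Gamma> \<turnstile> eqTm (App m a) (App m' a') (B\<langle>a \<rhd> Var\<rangle>)"
    and Pi_comp: "\<lbrakk>A # \<Gamma> \<turnstile> isTm f B; \<Gamma> \<turnstile> isTm a A\<rbrakk> \<Longrightarrow>
      \<Gamma> \<turnstile> eqTm (App (Lam f) a) (f\<langle>a \<rhd> Var\<rangle>) (B\<langle>a \<rhd> Var\<rangle>)"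
    and Idt_discrete: "\<lbrakk>\<Gamma> \<turnstile> isTm a A; \<Gamma> \<turnstile> isTm b A; \<Gamma> \<turnstile> isTm p (Idt A a b); \<Gamma> \<turnstile> isTm q (Idt A a b);
      \<Gamma> \<turnstile> isTm \<alpha> (Idt (Idt A a b) p q)\<rbrakk> \<Longrightarrow> \<Gamma> \<turnstile> eqTm p q (Idt A a b)"
    and Idt_discrete_refl: "\<lbrakk>\<Gamma> \<turnstile> isTm a A; \<Gamma> \<turnstile> isTm b A; \<Gamma> \<turnstile> isTm p (Idt A a b); \<Gamma> \<turnstile> isTm q (Idt A a b);
      \<Gamma> \<turnstile> isTm \<alpha> (Idt (Idt A a b) p q)\<rbrakk> \<Longrightarrow> \<Gamma> \<turnstile> eqTm \<alpha> (Refl p) (Idt (Idt A a b) p q)"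
    and Ext_intro: "\<lbrakk>A # \<Gamma> \<turnstile> isTy B; \<Gamma> \<turnstile> isTm m (Pi A B); \<Gamma> \<turnstile> isTm n (Pi A B);
      A # \<Gamma> \<turnstile> isTm p (Idt B (App (wk m) (Var 0)) (App (wk n) (Var 0)))\<rbrakk> \<Longrightarrow>
      \<Gamma> \<turnstile> isTm (Ext m n p) (Idt (Pi A B) m n)"
    and Ext_cong: "\<lbrakk>A # \<Gamma> \<turnstile> isTy B; \<Gamma> \<turnstile> eqTm m m' (Pi A B); \<Gamma> \<turnstile> eqTm n n' (Pi A B);
      A # \<Gamma> \<turnstile> eqTm p p' (Idt B (App (wk m) (Var 0)) (App (wk n) (Var 0)))\<rbrakk> \<Longrightarrow>
      \<Gamma> \<turnstile> eqTm (Ext m n p) (Ext m' n' p') (Idt (Pi A B) m n)"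
    and Ext_refl: "\<lbrakk>A # \<Gamma> \<turnstile> isTy B; \<Gamma> \<turnstile> isTm m (Pi A B)\<rbrakk> \<Longrightarrow>
      \<Gamma> \<turnstile> eqTm (Ext m m (Refl (App (wk m) (Var 0)))) (Refl m) (Idt (Pi A B) m m)"
    and Ext_app: "\<lbrakk>A # \<Gamma> \<turnstile> isTy B; \<Gamma> \<turnstile> isTm m (Pi A B); \<Gamma> \<turnstile> isTm n (Pi A B);
      A # \<Gamma> \<turnstile> isTm p (Idt B (App (wk m) (Var 0)) (App (wk n) (Var 0)))\<rbrakk> \<Longrightarrow>
      A # \<Gamma> \<turnstile> eqTm (happly (wk m) (wk n) (wk (Ext m n p)) (Var 0)) p
        (Idt B (App (wk m) (Var 0)) (App (wk n) (Var 0)))"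

section \<open>Categories and 2-categories\<close>

text \<open>
  Hom-sets need not be disjoint, so operations on arrows take the objects involved as arguments.
  All compositions are written in applicative order.
\<close>

record ('o, 'm) cat =
  Obj :: "'o set"
  Hom :: "'o \<Rightarrow> 'o \<Rightarrow> 'm set"
  Idn :: "'o \<Rightarrow> 'm"
  Cmp :: "'o \<Rightarrow> 'o \<Rightarrow> 'o \<Rightarrow> 'm \<Rightarrow> 'm \<Rightarrow> 'm"  \<comment> \<open>\<open>Cmp C a b c v u\<close>, for \<open>u : a \<rightarrow> b\<close>, \<open>v : b \<rightarrow> c\<close>\<close>

definition category :: "('o, 'm) cat \<Rightarrow> bool" where
  "category C \<longleftrightarrow>
    (\<forall>a \<in> Obj C. Idn C a \<in> Hom C a a) \<and>
    (\<forall>a \<in> Obj C. \<forall>b \<in> Obj C. \<forall>c \<in> Obj C. \<forall>u \<in> Hom C a b. \<forall>v \<in> Hom C b c.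
      Cmp C a b c v u \<in> Hom C a c) \<and>
    (\<forall>a \<in> Obj C. \<forall>b \<in> Obj C. \<forall>u \<in> Hom C a b.
      Cmp C a a b u (Idn C a) = u \<and> Cmp C a b b (Idn C b) u = u) \<and>
    (\<forall>a \<in> Obj C. \<forall>b \<in> Obj C. \<forall>c \<in> Obj C. \<forall>d \<in> Obj C.
      \<forall>u \<in> Hom C a b. \<forall>v \<in> Hom C b c. \<forall>w \<in> Hom C c d.
      Cmp C a b d (Cmp C b c d w v) u = Cmp C a c d w (Cmp C a b c v u))"

text \<open>A functor is given by \<open>F\<close> on objects and \<open>Fa a b\<close> on arrows \<open>a \<rightarrow> b\<close>.\<close>

definition is_functor ::
  "('o, 'm) cat \<Rightarrow> ('p, 'n) cat \<Rightarrow> ('o \<Rightarrow> 'p) \<Rightarrow> ('o \<Rightarrow> 'o \<Rightarrow> 'm \<Rightarrow> 'n) \<Rightarrow> bool" where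
  "is_functor C D F Fa \<longleftrightarrow> category C \<and> category D \<and>
    (\<forall>a \<in> Obj C. F a \<in> Obj D) \<and>
    (\<forall>a \<in> Obj C. \<forall>b \<in> Obj C. \<forall>u \<in> Hom C a b. Fa a b u \<in> Hom D (F a) (F b)) \<and>
    (\<forall>a \<in> Obj C. Fa a a (Idn C a) = Idn D (F a)) \<and>
    (\<forall>a \<in> Obj C. \<forall>b \<in> Obj C. \<forall>c \<in> Obj C. \<forall>u \<in> Hom C a b. \<forall>v \<in> Hom C b c.
      Fa a c (Cmp C a b c v u) = Cmp D (F a) (F b) (F c) (Fa b c v) (Fa a b u))"

definition is_iso :: "('o, 'm) cat \<Rightarrow> 'o \<Rightarrow> 'o \<Rightarrow> 'm \<Rightarrow> bool" where
  "is_iso C a b u \<longleftrightarrow> u \<in> Hom C a b \<and>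
    (\<exists>v \<in> Hom C b a. Cmp C a b a v u = Idn C a \<and> Cmp C b a b u v = Idn C b)"

definition natural_iso ::
  "('o, 'm) cat \<Rightarrow> ('p, 'n) cat \<Rightarrow> ('o \<Rightarrow> 'p) \<Rightarrow> ('o \<Rightarrow> 'o \<Rightarrow> 'm \<Rightarrow> 'n) \<Rightarrow>
   ('o \<Rightarrow> 'p) \<Rightarrow> ('o \<Rightarrow> 'o \<Rightarrow> 'm \<Rightarrow> 'n) \<Rightarrow> ('o \<Rightarrow> 'n) \<Rightarrow> bool" where
  "natural_iso C D F Fa G Ga \<theta> \<longleftrightarrow>
    (\<forall>a \<in> Obj C. is_iso D (F a) (G a) (\<theta> a)) \<and>
    (\<forall>a \<in> Obj C. \<forall>b \<in> Obj C. \<forall>u \<in> Hom C a b.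
      Cmp D (F a) (F b) (G b) (\<theta> b) (Fa a b u) = Cmp D (F a) (G a) (G b) (Ga a b u) (\<theta> a))"

text \<open>The last four clauses are \<open>P I = id\<close> (on objects and arrows), \<open>\<theta> I = id\<close> and \<open>P \<theta> = id\<close>.\<close>

definition surjective_equivalence ::
  "('o, 'm) cat \<Rightarrow> ('p, 'n) cat \<Rightarrow> ('o \<Rightarrow> 'p) \<Rightarrow> ('o \<Rightarrow> 'o \<Rightarrow> 'm \<Rightarrow> 'n) \<Rightarrow> bool" where
  "surjective_equivalence C D P Pa \<longleftrightarrow> is_functor C D P Pa \<and>
    (\<exists>I Ia \<theta>. is_functor D C I Ia \<and>
      natural_iso C C (\<lambda>a. a) (\<lambda>a b u. u) (\<lambda>a. I (P a)) (\<lambda>a b u. Ia (P a) (P b) (Pa a b u)) \<theta> \<and>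
      (\<forall>d \<in> Obj D. P (I d) = d) \<and>
      (\<forall>d \<in> Obj D. \<forall>e \<in> Obj D. \<forall>v \<in> Hom D d e. Pa (I d) (I e) (Ia d e v) = v) \<and>
      (\<forall>d \<in> Obj D. \<theta> (I d) = Idn C (I d)) \<and>
      (\<forall>a \<in> Obj C. Pa a (I (P a)) (\<theta> a) = Idn D (P a)))"

text \<open>
  A 2-category has 0-cells \<open>Obj2\<close> and for any two of them a category \<open>HomC\<close> of 1-cells and 2-cells.
  \<open>WhL K x y z h f f' \<alpha>\<close> is \<open>h \<circ> \<alpha> : h \<circ> f \<Rightarrow> h \<circ> f'\<close>, for \<open>\<alpha> : f \<Rightarrow> f' : x \<rightarrow> y\<close> and
  \<open>h : y \<rightarrow> z\<close>; \<open>WhR K x y z g g' \<beta> f\<close> is \<open>\<beta> \<circ> f : g \<circ> f \<Rightarrow> g' \<circ> f\<close>, for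
  \<open>\<beta> : g \<Rightarrow> g' : y \<rightarrow> z\<close> and \<open>f : x \<rightarrow> y\<close>.
\<close>

record ('o, 'm, 'c) two_cat =
  Obj2 :: "'o set"
  HomC :: "'o \<Rightarrow> 'o \<Rightarrow> ('m, 'c) cat"
  Id1 :: "'o \<Rightarrow> 'm"
  Cmp1 :: "'o \<Rightarrow> 'o \<Rightarrow> 'o \<Rightarrow> 'm \<Rightarrow> 'm \<Rightarrow> 'm"
  WhL :: "'o \<Rightarrow> 'o \<Rightarrow> 'o \<Rightarrow> 'm \<Rightarrow> 'm \<Rightarrow> 'm \<Rightarrow> 'c \<Rightarrow> 'c"
  WhR :: "'o \<Rightarrow> 'o \<Rightarrow> 'o \<Rightarrow> 'm \<Rightarrow> 'm \<Rightarrow> 'c \<Rightarrow> 'm \<Rightarrow> 'c"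

abbreviation Arr :: "('o, 'm, 'c) two_cat \<Rightarrow> 'o \<Rightarrow> 'o \<Rightarrow> 'm set" where
  "Arr K x y \<equiv> Obj (HomC K x y)"

abbreviation Cell :: "('o, 'm, 'c) two_cat \<Rightarrow> 'o \<Rightarrow> 'o \<Rightarrow> 'm \<Rightarrow> 'm \<Rightarrow> 'c set" where
  "Cell K x y \<equiv> Hom (HomC K x y)"

abbreviation VCmp :: "('o, 'm, 'c) two_cat \<Rightarrow> 'o \<Rightarrow> 'o \<Rightarrow> 'm \<Rightarrow> 'm \<Rightarrow> 'm \<Rightarrow> 'c \<Rightarrow> 'c \<Rightarrow> 'c" where
  "VCmp K x y \<equiv> Cmp (HomC K x y)"

definition two_category :: "('o, 'm, 'c) two_cat \<Rightarrow> bool" where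
  "two_category K \<longleftrightarrow>
    \<comment> \<open>the underlying category\<close>
    category \<lparr>Obj = Obj2 K, Hom = Arr K, Idn = Id1 K, Cmp = Cmp1 K\<rparr> \<and>
    \<comment> \<open>whiskering is functorial in the 2-cell\<close>
    (\<forall>x \<in> Obj2 K. \<forall>y \<in> Obj2 K. category (HomC K x y)) \<and>
    (\<forall>x \<in> Obj2 K. \<forall>y \<in> Obj2 K. \<forall>z \<in> Obj2 K. \<forall>h \<in> Arr K y z.
      is_functor (HomC K x y) (HomC K x z) (Cmp1 K x y z h) (WhL K x y z h)) \<and>
    (\<forall>x \<in> Obj2 K. \<forall>y \<in> Obj2 K. \<forall>z \<in> Obj2 K. \<forall>f \<in> Arr K x y.
      is_functor (HomC K y z) (HomC K x z) (\<lambda>g. Cmp1 K x y z g f) (\<lambda>g g' \<beta>. WhR K x y z g g' \<beta> f)) \<and>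
    \<comment> \<open>whiskering is functorial in the 1-cell\<close>
    (\<forall>x \<in> Obj2 K. \<forall>y \<in> Obj2 K. \<forall>f \<in> Arr K x y. \<forall>f' \<in> Arr K x y. \<forall>\<alpha> \<in> Cell K x y f f'.
      WhL K x y y (Id1 K y) f f' \<alpha> = \<alpha> \<and> WhR K x x y f f' \<alpha> (Id1 K x) = \<alpha>) \<and>
    (\<forall>x \<in> Obj2 K. \<forall>y \<in> Obj2 K. \<forall>z \<in> Obj2 K. \<forall>w \<in> Obj2 K.
      (\<forall>f \<in> Arr K x y. \<forall>f' \<in> Arr K x y. \<forall>\<alpha> \<in> Cell K x y f f'. \<forall>h \<in> Arr K y z. \<forall>k \<in> Arr K z w.
        WhL K x y w (Cmp1 K y z w k h) f f' \<alpha>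
          = WhL K x z w k (Cmp1 K x y z h f) (Cmp1 K x y z h f') (WhL K x y z h f f' \<alpha>)) \<and>
      (\<forall>g \<in> Arr K z w. \<forall>g' \<in> Arr K z w. \<forall>\<beta> \<in> Cell K z w g g'. \<forall>e \<in> Arr K x y. \<forall>f \<in> Arr K y z.
        WhR K x z w g g' \<beta> (Cmp1 K x y z f e)
          = WhR K x y w (Cmp1 K y z w g f) (Cmp1 K y z w g' f) (WhR K y z w g g' \<beta> f) e) \<and>
      (\<forall>f \<in> Arr K y z. \<forall>f' \<in> Arr K y z. \<forall>\<alpha> \<in> Cell K y z f f'. \<forall>e \<in> Arr K x y. \<forall>h \<in> Arr K z w.
        WhL K x z w h (Cmp1 K x y z f e) (Cmp1 K x y z f' e) (WhR K x y z f f' \<alpha> e)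
          = WhR K x y w (Cmp1 K y z w h f) (Cmp1 K y z w h f') (WhL K y z w h f f' \<alpha>) e)) \<and>
    \<comment> \<open>interchange\<close>
    (\<forall>x \<in> Obj2 K. \<forall>y \<in> Obj2 K. \<forall>z \<in> Obj2 K.
      \<forall>f \<in> Arr K x y. \<forall>f' \<in> Arr K x y. \<forall>g \<in> Arr K y z. \<forall>g' \<in> Arr K y z.
      \<forall>\<alpha> \<in> Cell K x y f f'. \<forall>\<beta> \<in> Cell K y z g g'.
      VCmp K x z (Cmp1 K x y z g f) (Cmp1 K x y z g f') (Cmp1 K x y z g' f')
          (WhR K x y z g g' \<beta> f') (WhL K x y z g f f' \<alpha>)
        = VCmp K x z (Cmp1 K x y z g f) (Cmp1 K x y z g' f) (Cmp1 K x y z g' f')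
          (WhL K x y z g' f f' \<alpha>) (WhR K x y z g g' \<beta> f))"

record ('o, 'm, 'c, 'p, 'n, 'd) two_map =
  F0 :: "'o \<Rightarrow> 'p"
  F1 :: "'o \<Rightarrow> 'o \<Rightarrow> 'm \<Rightarrow> 'n"
  F2 :: "'o \<Rightarrow> 'o \<Rightarrow> 'm \<Rightarrow> 'm \<Rightarrow> 'c \<Rightarrow> 'd"

definition two_functor ::
  "('o, 'm, 'c) two_cat \<Rightarrow> ('p, 'n, 'd) two_cat \<Rightarrow> ('o, 'm, 'c, 'p, 'n, 'd) two_map \<Rightarrow> bool" where
  "two_functor K L U \<longleftrightarrow> two_category K \<and> two_category L \<and>
    is_functor \<lparr>Obj = Obj2 K, Hom = Arr K, Idn = Id1 K, Cmp = Cmp1 K\<rparr>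
      \<lparr>Obj = Obj2 L, Hom = Arr L, Idn = Id1 L, Cmp = Cmp1 L\<rparr> (F0 U) (F1 U) \<and>
    (\<forall>x \<in> Obj2 K. \<forall>y \<in> Obj2 K.
      is_functor (HomC K x y) (HomC L (F0 U x) (F0 U y)) (F1 U x y) (F2 U x y)) \<and>
    (\<forall>x \<in> Obj2 K. \<forall>y \<in> Obj2 K. \<forall>z \<in> Obj2 K.
      (\<forall>f \<in> Arr K x y. \<forall>f' \<in> Arr K x y. \<forall>\<alpha> \<in> Cell K x y f f'. \<forall>h \<in> Arr K y z.
        F2 U x z (Cmp1 K x y z h f) (Cmp1 K x y z h f') (WhL K x y z h f f' \<alpha>)
          = WhL L (F0 U x) (F0 U y) (F0 U z) (F1 U y z h) (F1 U x y f) (F1 U x y f')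
              (F2 U x y f f' \<alpha>)) \<and>
      (\<forall>g \<in> Arr K y z. \<forall>g' \<in> Arr K y z. \<forall>\<beta> \<in> Cell K y z g g'. \<forall>f \<in> Arr K x y.
        F2 U x z (Cmp1 K x y z g f) (Cmp1 K x y z g' f) (WhR K x y z g g' \<beta> f)
          = WhR L (F0 U x) (F0 U y) (F0 U z) (F1 U y z g) (F1 U y z g') (F2 U y z g g' \<beta>)
              (F1 U x y f)))"

definition retract_bicoreflection ::
  "('o, 'm, 'c) two_cat \<Rightarrow> ('p, 'n, 'd) two_cat \<Rightarrow> ('o, 'm, 'c, 'p, 'n, 'd) two_map \<Rightarrow>
   'p \<Rightarrow> 'o \<Rightarrow> 'n \<Rightarrow> bool" where
  "retract_bicoreflection K L U x Gx \<epsilon> \<longleftrightarrow>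
    Gx \<in> Obj2 K \<and> \<epsilon> \<in> Arr L (F0 U Gx) x \<and>
    (\<forall>y \<in> Obj2 K. surjective_equivalence (HomC K y Gx) (HomC L (F0 U y) x)
      (\<lambda>h. Cmp1 L (F0 U y) (F0 U Gx) x \<epsilon> (F1 U y Gx h))
      (\<lambda>h h' \<alpha>. WhL L (F0 U y) (F0 U Gx) x \<epsilon> (F1 U y Gx h) (F1 U y Gx h') (F2 U y Gx h h' \<alpha>)))"

definition right_retract_biadjoint ::
  "('o, 'm, 'c) two_cat \<Rightarrow> ('p, 'n, 'd) two_cat \<Rightarrow> ('o, 'm, 'c, 'p, 'n, 'd) two_map \<Rightarrow>
   ('p \<Rightarrow> 'o) \<Rightarrow> ('p \<Rightarrow> 'n) \<Rightarrow> bool" where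
  "right_retract_biadjoint K L U G \<epsilon> \<longleftrightarrow> two_functor K L U \<and>
    (\<forall>x \<in> Obj2 L. retract_bicoreflection K L U x (G x) (\<epsilon> x))"

section \<open>The 2-category of types in a context\<close>

text \<open>
  Cells are equivalence classes of types and terms modulo definitional equality. In the operations
  on classes below, \<open>\<Union>\<close> ranges over all representatives; for a theory as above all the classes
  in such a union are equal. \<open>ty_cls S \<Gamma> A\<close> and \<open>tm_cls S \<Gamma> A a\<close> are the classes of \<open>A\<close> and \<open>a : A\<close>.
\<close>

definition ty_cls :: "'c type_theory \<Rightarrow> 'c ctx \<Rightarrow> 'c exp \<Rightarrow> 'c exp set" where
  "ty_cls S \<Gamma> A = {A'. S \<Gamma> (eqTy A A')}"

definition tm_cls :: "'c type_theory \<Rightarrow> 'c ctx \<Rightarrow> 'c exp \<Rightarrow> 'c exp \<Rightarrow> 'c exp set" where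
  "tm_cls S \<Gamma> A a = {a'. S \<Gamma> (eqTm a a' A)}"

definition tys :: "'c type_theory \<Rightarrow> 'c ctx \<Rightarrow> 'c exp set set" where
  "tys S \<Gamma> = {ty_cls S \<Gamma> A | A. S \<Gamma> (isTy A)}"

definition tms :: "'c type_theory \<Rightarrow> 'c ctx \<Rightarrow> 'c exp \<Rightarrow> 'c exp set set" where
  "tms S \<Gamma> A = {tm_cls S \<Gamma> A a | a. S \<Gamma> (isTm a A)}"

text \<open>
  \<open>id_trans y' y'' q p\<close> is \<open>q \<circ> p : Id(y, y'')\<close>, for \<open>p : Id(y, y')\<close> and \<open>q : Id(y', y'')\<close>, by
  elimination on \<open>q\<close> extended over the telescope \<open>p : Id(y, y')\<close>, that is, with motive
  \<open>\<Pi> (p : Id(y, y')). Id(y, y'')\<close>. \<open>ap h y y' p\<close> is the action on \<open>p : Id(y, y')\<close> of \<open>h\<close>, an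
  expression with one bound variable.
\<close>

definition id_trans :: "'c exp \<Rightarrow> 'c exp \<Rightarrow> 'c exp \<Rightarrow> 'c exp \<Rightarrow> 'c exp" where
  "id_trans y' y'' q p = App (J (Lam (Var 0)) y' y'' q) p"

definition ap :: "'c exp \<Rightarrow> 'c exp \<Rightarrow> 'c exp \<Rightarrow> 'c exp \<Rightarrow> 'c exp" where
  "ap h y y' p = J (Refl h) y y' p"

text \<open>
  A 1-cell from \<open>A\<close> to \<open>B\<close> is a term of type \<open>wk B\<close> in context \<open>A # \<Gamma>\<close>. Composition with
  \<open>f\<close> is substitution of \<open>f\<close> for the last variable, the variables of \<open>\<Gamma>\<close> being weakened.
  \<open>ren t (up Suc)\<close> weakens a term by a type inserted just before the last one in the context.
\<close>

definition cmp_sub :: "'c exp \<Rightarrow> 'c sub" where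
  "cmp_sub f = f \<rhd> (\<lambda>i. Var (Suc i))"

definition T_hom ::
  "'c type_theory \<Rightarrow> 'c ctx \<Rightarrow> 'c exp set \<Rightarrow> 'c exp set \<Rightarrow> ('c exp set, 'c exp set) cat" where
  "T_hom S \<Gamma> X Y =
    \<lparr>Obj = (\<Union>A \<in> X. \<Union>B \<in> Y. tms S (A # \<Gamma>) (wk B)),
     Hom = (\<lambda>F G. \<Union>A \<in> X. \<Union>B \<in> Y. \<Union>f \<in> F. \<Union>g \<in> G. tms S (A # \<Gamma>) (Idt (wk B) f g)),
     Idn = (\<lambda>F. \<Union>A \<in> X. \<Union>B \<in> Y. \<Union>f \<in> F. tm_cls S (A # \<Gamma>) (Idt (wk B) f f) (Refl f)),
     Cmp = (\<lambda>F G H \<beta> \<alpha>. \<Union>A \<in> X. \<Union>B \<in> Y. \<Union>f \<in> F. \<Union>g \<in> G. \<Union>h \<in> H. \<Union>q \<in> \<beta>. \<Union>p \<in> \<alpha>.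
       tm_cls S (A # \<Gamma>) (Idt (wk B) f h) (id_trans g h q p))\<rparr>"

definition T :: "'c type_theory \<Rightarrow> 'c ctx \<Rightarrow> ('c exp set, 'c exp set, 'c exp set) two_cat" where
  "T S \<Gamma> =
    \<lparr>Obj2 = tys S \<Gamma>,
     HomC = T_hom S \<Gamma>,
     Id1 = (\<lambda>X. \<Union>A \<in> X. tm_cls S (A # \<Gamma>) (wk A) (Var 0)),
     Cmp1 = (\<lambda>X Y Z G F. \<Union>A \<in> X. \<Union>C \<in> Z. \<Union>g \<in> G. \<Union>f \<in> F.
       tm_cls S (A # \<Gamma>) (wk C) (g\<langle>cmp_sub f\<rangle>)),
     WhL = (\<lambda>X Y Z H F G \<alpha>. \<Union>A \<in> X. \<Union>C \<in> Z. \<Union>h \<in> H. \<Union>f \<in> F. \<Union>g \<in> G. \<Union>p \<in> \<alpha>.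
       tm_cls S (A # \<Gamma>) (Idt (wk C) (h\<langle>cmp_sub f\<rangle>) (h\<langle>cmp_sub g\<rangle>)) (ap (ren h (up Suc)) f g p)),
     WhR = (\<lambda>X Y Z G H \<beta> F. \<Union>A \<in> X. \<Union>C \<in> Z. \<Union>g \<in> G. \<Union>h \<in> H. \<Union>q \<in> \<beta>. \<Union>f \<in> F.
       tm_cls S (A # \<Gamma>) (Idt (wk C) (g\<langle>cmp_sub f\<rangle>) (h\<langle>cmp_sub f\<rangle>)) (q\<langle>cmp_sub f\<rangle>))\<rparr>"

text \<open>Weakening from context \<open>\<Gamma>\<close> to context \<open>A # \<Gamma>\<close>.\<close>

definition weakening ::
  "'c type_theory \<Rightarrow> 'c ctx \<Rightarrow> 'c exp \<Rightarrow>
   ('c exp set, 'c exp set, 'c exp set, 'c exp set, 'c exp set, 'c exp set) two_map" where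
  "weakening S \<Gamma> A =
    \<lparr>F0 = (\<lambda>X. \<Union>B \<in> X. ty_cls S (A # \<Gamma>) (wk B)),
     F1 = (\<lambda>X Y F. \<Union>B \<in> X. \<Union>C \<in> Y. \<Union>f \<in> F.
       tm_cls S (wk B # A # \<Gamma>) (wk (wk C)) (ren f (up Suc))),
     F2 = (\<lambda>X Y F G \<alpha>. \<Union>B \<in> X. \<Union>C \<in> Y. \<Union>f \<in> F. \<Union>g \<in> G. \<Union>p \<in> \<alpha>.
       tm_cls S (wk B # A # \<Gamma>) (Idt (wk (wk C)) (ren f (up Suc)) (ren g (up Suc))) (ren p (up Suc)))\<rparr>"

end

theory Submission
  imports Defs
begin

text \<open>
  The biadjoint sends \<open>B\<close> over \<open>\<Gamma>.A\<close> to \<open>\<Pi>(A, B)\<close>, with counit \<open>m, x \<mapsto> m \<cdot> x\<close>. A functor that is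
  fully faithful and strictly surjective on objects is a surjective equivalence: choose preimages of
  objects and lift identities to obtain \<open>\<theta>\<close>. Postcomposition with the counit is surjective on
  objects by abstraction and \<open>\<beta>\<close>. On 2-cells it is \<open>p \<mapsto> p \<ast> x\<close>, which is full by
  \<open>ext(m, n, p) \<ast> x = p(x)\<close>, and faithful because \<open>ext(m, n, [x] p \<ast> x) = p\<close>.

  This last equation and the laws of the 2-categories are all equations between elements of an identity
  type. Identity types being discrete, such an equation may be proved by \<open>J\<close>: it is enough to
  check it on reflexivity proofs.
\<close>

section \<open>Substitutions\<close>

text \<open>The rules give \<beta> but no \<eta> for \<Pi>-types: two maps into
  \<open>Pi A B\<close> with the same values are connected by an identity proof, and need not be
  definitionally equal. Hence composition with the counit is an equivalence that need not be
  injective on objects, and the preimages there are a genuine choice.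

  Reflection of identity proofs into definitional equality is available only between elements of
  identity types. Equations between 1-cells therefore have to come from substitution and \<beta>
  alone, while equations between 2-cells may use \<open>J\<close>.

  Two obstacles shape the rest. Cells are classes modulo definitional equality, and the types and
  contexts over which they live vary in classes too, so each operation has to be computed on
  representatives and shown independent of them. Moreover the two sides of the biadjunction order
  the variables differently: a map out of a weakened type lives over \<Gamma>, A, Y, whereas
  abstraction over A needs \<Gamma>, Y, A. An exchange of the two last variables mediates.\<close>

lemma scons_simps [simp]:
  "(t \<rhd> \<sigma>) 0 = t" "(t \<rhd> \<sigma>) (Suc i) = \<sigma> i"
  by (simp_all add: scons_def)

lemma scons_Var [simp]:
  "Var 0 \<rhd> (\<lambda>i. Var (Suc i)) = Var"
  "Var (Suc 0) \<rhd> (\<lambda>i. Var (Suc (Suc i))) = (\<lambda>i. Var (Suc i))"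
  by (auto simp: fun_eq_iff scons_def split: nat.split)

lemma up_simps [simp]: "up \<rho> 0 = 0" "up \<rho> (Suc i) = Suc (\<rho> i)"
  by (simp_all add: up_def)

lemma lift_Var [simp]: "lift Var = Var"
  by (simp add: lift_def)

text \<open>The iterated versions of the lifting lemmas serve the operators \<open>Op\<close>, whose
  arguments bind arbitrarily many variables.\<close>

lemma lift_funpow_Var: "(lift ^^ n) Var = Var"
  by (induction n) simp_all

lemma subst_Var [simp]: "t\<langle>Var\<rangle> = t"
  by (induction t) (auto simp: lift_funpow_Var intro!: map_idI)

lemma lift_Var_comp: "lift (\<lambda>i. Var (\<rho> i)) = (\<lambda>i. Var (up \<rho> i))"
  by (auto simp: fun_eq_iff lift_def scons_def up_def split: nat.split)

lemma lift_funpow_Var_comp: "(lift ^^ n) (\<lambda>i. Var (\<rho> i)) = (\<lambda>i. Var ((up ^^ n) \<rho> i))"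
  by (induction n) (simp_all add: lift_Var_comp)

lemma ren_eq_subst: "ren t \<rho> = t\<langle>\<lambda>i. Var (\<rho> i)\<rangle>"
  by (induction t arbitrary: \<rho>)
    (auto simp: lift_Var_comp lift_funpow_Var_comp split: prod.split)

lemma lift_comp_up: "(\<lambda>i. lift \<sigma> (up \<rho> i)) = lift (\<lambda>i. \<sigma> (\<rho> i))"
  by (auto simp: fun_eq_iff lift_def scons_def up_def split: nat.split)

lemma lift_funpow_comp_up:
  "(\<lambda>i. (lift ^^ n) \<sigma> ((up ^^ n) \<rho> i)) = (lift ^^ n) (\<lambda>i. \<sigma> (\<rho> i))"
  by (induction n) (simp_all add: lift_comp_up)

lemma subst_ren: "(ren t \<rho>)\<langle>\<sigma>\<rangle> = t\<langle>\<lambda>i. \<sigma> (\<rho> i)\<rangle>"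
  by (induction t arbitrary: \<rho> \<sigma>)
    (auto simp: lift_comp_up lift_funpow_comp_up split: prod.split)

lemma ren_ren: "ren (ren t \<rho>) \<rho>' = ren t (\<lambda>i. \<rho>' (\<rho> i))"
  by (subst (1 3) ren_eq_subst) (rule subst_ren)

lemma lift_ren: "(\<lambda>i. ren (lift \<sigma> i) (up \<rho>)) = lift (\<lambda>i. ren (\<sigma> i) \<rho>)"
proof
  fix i show "ren (lift \<sigma> i) (up \<rho>) = lift (\<lambda>i. ren (\<sigma> i) \<rho>) i"
    by (cases i) (auto simp: lift_def ren_ren)
qed

lemma lift_funpow_ren: "(\<lambda>i. ren ((lift ^^ n) \<sigma> i) ((up ^^ n) \<rho>)) = (lift ^^ n) (\<lambda>i. ren (\<sigma> i) \<rho>)"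
  by (induction n) (simp_all add: lift_ren)

lemma ren_subst: "ren (t\<langle>\<sigma>\<rangle>) \<rho> = t\<langle>\<lambda>i. ren (\<sigma> i) \<rho>\<rangle>"
  by (induction t arbitrary: \<rho> \<sigma>)
    (auto simp: lift_ren lift_funpow_ren split: prod.split)

lemma lift_subst: "(\<lambda>i. (lift \<sigma> i)\<langle>lift \<tau>\<rangle>) = lift (\<lambda>i. (\<sigma> i)\<langle>\<tau>\<rangle>)"
proof
  fix i show "(lift \<sigma> i)\<langle>lift \<tau>\<rangle> = lift (\<lambda>i. (\<sigma> i)\<langle>\<tau>\<rangle>) i"
    by (cases i) (auto simp: lift_def subst_ren ren_subst)
qed

lemma lift_funpow_subst:
  "(\<lambda>i. ((lift ^^ n) \<sigma> i)\<langle>(lift ^^ n) \<tau>\<rangle>) = (lift ^^ n) (\<lambda>i. (\<sigma> i)\<langle>\<tau>\<rangle>)"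
  by (induction n) (simp_all add: lift_subst)

text \<open>Passing under a binder weakens the substituted terms, so the induction needs the
  commutation of substitution with renaming in both orders; \<open>lift_subst\<close> packages
  \<open>subst_ren\<close> and \<open>ren_subst\<close> for this.\<close>

lemma subst_subst: "t\<langle>\<sigma>\<rangle>\<langle>\<tau>\<rangle> = t\<langle>\<lambda>i. (\<sigma> i)\<langle>\<tau>\<rangle>\<rangle>"
  by (induction t arbitrary: \<sigma> \<tau>)
    (auto simp: lift_subst lift_funpow_subst split: prod.split)

text \<open>This pushes a substitution into the tail of a \<open>scons\<close> also under a \<open>\<lambda>\<close>.\<close>

lemma scons_subst: "((t \<rhd> \<sigma>) i)\<langle>\<tau>\<rangle> = (t\<langle>\<tau>\<rangle> \<rhd> (\<lambda>i. (\<sigma> i)\<langle>\<tau>\<rangle>)) i"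
  by (cases i) simp_all

lemma Var_up: "Var (up \<rho> i) = (Var 0 \<rhd> (\<lambda>i. Var (Suc (\<rho> i)))) i"
  by (cases i) simp_all

lemma lift_eq: "lift \<sigma> = Var 0 \<rhd> (\<lambda>i. (\<sigma> i)\<langle>\<lambda>j. Var (Suc j)\<rangle>)"
  by (simp add: lift_def ren_eq_subst)

text \<open>These rules express renamings and liftings through \<open>subst\<close> and
  \<open>scons\<close> and fuse successive substitutions. Most typing arguments below hold up to
  this normalisation of de Bruijn indices.\<close>

lemmas subst_calculus = ren_eq_subst subst_subst scons_subst Var_up lift_eq
  diag_def cmp_sub_def

section \<open>Context morphisms\<close>

context dependent_type_theory
begin

lemma wf_ctx_Cons: "wf_ctx S (A # \<Gamma>) \<Longrightarrow> \<Gamma> \<turnstile> isTy A"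
  by simp

lemma ctx_valid_Cons: "A # \<Gamma> \<turnstile> \<J> \<Longrightarrow> \<Gamma> \<turnstile> isTy A"
  using ctx_valid wf_ctx_Cons by blast

lemma var0: "\<Gamma> \<turnstile> isTy A \<Longrightarrow> A # \<Gamma> \<turnstile> isTm (Var 0) (A\<langle>\<lambda>i. Var (Suc i)\<rangle>)"
  using var[of "A # \<Gamma>" 0] ctx_valid by (auto simp: ren_eq_subst)

lemma ctx_mor_wk:
  assumes "wf_ctx S \<Gamma>" "\<Gamma> \<turnstile> isTy A"
  shows "ctx_mor S (A # \<Gamma>) (\<lambda>i. Var (Suc i)) \<Gamma>"
  unfolding ctx_mor_def using assms var[of "A # \<Gamma>" "Suc i" for i] by (auto simp: ren_eq_subst)

lemma subst_isTy: "\<lbrakk>\<Delta> \<turnstile> isTy A; ctx_mor S \<Gamma> \<sigma> \<Delta>\<rbrakk> \<Longrightarrow> \<Gamma> \<turnstile> isTy (A\<langle>\<sigma>\<rangle>)"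
  and subst_isTm: "\<lbrakk>\<Delta> \<turnstile> isTm a A; ctx_mor S \<Gamma> \<sigma> \<Delta>\<rbrakk> \<Longrightarrow> \<Gamma> \<turnstile> isTm (a\<langle>\<sigma>\<rangle>) (A\<langle>\<sigma>\<rangle>)"
  and subst_eqTy: "\<lbrakk>\<Delta> \<turnstile> eqTy A B; ctx_mor S \<Gamma> \<sigma> \<Delta>\<rbrakk> \<Longrightarrow> \<Gamma> \<turnstile> eqTy (A\<langle>\<sigma>\<rangle>) (B\<langle>\<sigma>\<rangle>)"
  and subst_eqTm: "\<lbrakk>\<Delta> \<turnstile> eqTm a b A; ctx_mor S \<Gamma> \<sigma> \<Delta>\<rbrakk> \<Longrightarrow> \<Gamma> \<turnstile> eqTm (a\<langle>\<sigma>\<rangle>) (b\<langle>\<sigma>\<rangle>) (A\<langle>\<sigma>\<rangle>)"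
  using substitution[of \<Gamma> \<sigma> \<Delta> "isTy A"] substitution[of \<Gamma> \<sigma> \<Delta> "isTm a A"]
    substitution[of \<Gamma> \<sigma> \<Delta> "eqTy A B"] substitution[of \<Gamma> \<sigma> \<Delta> "eqTm a b A"]
  by simp_all

lemma ctx_mor_scons:
  assumes "ctx_mor S \<Gamma> \<sigma> \<Delta>" "\<Delta> \<turnstile> isTy A" "\<Gamma> \<turnstile> isTm a (A\<langle>\<sigma>\<rangle>)"
  shows "ctx_mor S \<Gamma> (a \<rhd> \<sigma>) (A # \<Delta>)"
  using assms unfolding ctx_mor_def by (auto simp: less_Suc_eq_0_disj)

lemma ctx_mor_wk_comp:
  assumes "ctx_mor S \<Gamma> \<sigma> \<Delta>" "\<Gamma> \<turnstile> isTy A"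
  shows "ctx_mor S (A # \<Gamma>) (\<lambda>i. (\<sigma> i)\<langle>\<lambda>i. Var (Suc i)\<rangle>) \<Delta>"
proof -
  have "ctx_mor S (A # \<Gamma>) (\<lambda>i. Var (Suc i)) \<Gamma>"
    using assms ctx_mor_wk by (auto simp: ctx_mor_def)
  then show ?thesis
    using assms(1) subst_isTm[OF _ \<open>ctx_mor S (A # \<Gamma>) (\<lambda>i. Var (Suc i)) \<Gamma>\<close>]
    by (force simp: ctx_mor_def subst_subst)
qed

lemma ctx_mor_Var: "wf_ctx S \<Gamma> \<Longrightarrow> ctx_mor S \<Gamma> Var \<Gamma>"
  unfolding ctx_mor_def using var[of \<Gamma>] by (auto simp: ren_eq_subst)

lemma ctx_mor_lift:
  assumes "ctx_mor S \<Gamma> \<sigma> \<Delta>" "\<Delta> \<turnstile> isTy A" "A' = A\<langle>\<sigma>\<rangle>"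
  shows "ctx_mor S (A' # \<Gamma>) (Var 0 \<rhd> (\<lambda>i. (\<sigma> i)\<langle>\<lambda>i. Var (Suc i)\<rangle>)) (A # \<Delta>)"
proof -
  have A': "\<Gamma> \<turnstile> isTy A'"
    using assms subst_isTy by simp
  show ?thesis
    using var0[OF A'] assms
    by (intro ctx_mor_scons ctx_mor_wk_comp A') (simp_all add: subst_subst)
qed

lemma ctx_mor_eq_refl: "ctx_mor S \<Gamma> \<sigma> \<Delta> \<Longrightarrow> ctx_mor_eq S \<Gamma> \<sigma> \<sigma> \<Delta>"
  unfolding ctx_mor_eq_def ctx_mor_def using eqTm_refl by blast

lemma ctx_mor_eq_scons:
  assumes "ctx_mor_eq S \<Gamma> \<sigma> \<tau> \<Delta>" "\<Delta> \<turnstile> isTy A" "\<Gamma> \<turnstile> eqTm a b (A\<langle>\<sigma>\<rangle>)"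
  shows "ctx_mor_eq S \<Gamma> (a \<rhd> \<sigma>) (b \<rhd> \<tau>) (A # \<Delta>)"
proof -
  \<comment> \<open>The given equation types \<open>b\<close> over \<sigma>, while the second
    morphism needs it typed over \<tau>; the two instances of \<open>A\<close> are definitionally
    equal by \<open>substitution_eqTy\<close>.\<close>
  have "\<Gamma> \<turnstile> isTm b (A\<langle>\<tau>\<rangle>)"
    using assms eqTm_valid substitution_eqTy conv by blast
  moreover have "\<Gamma> \<turnstile> isTm a (A\<langle>\<sigma>\<rangle>)"
    using assms eqTm_valid by blast
  ultimately have "ctx_mor S \<Gamma> (a \<rhd> \<sigma>) (A # \<Delta>)" "ctx_mor S \<Gamma> (b \<rhd> \<tau>) (A # \<Delta>)"
    using assms(1,2) by (auto intro!: ctx_mor_scons simp: ctx_mor_eq_def)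
  then show ?thesis
    using assms(1,3) unfolding ctx_mor_eq_def by (auto simp: less_Suc_eq_0_disj)
qed

text \<open>Conversion of contexts is not among the structural rules. It is substitution along the
  identity, which the conversion rule for terms makes a context morphism between contexts with equal
  last types; \<open>ctx_conv\<close> is the result.\<close>

lemma ctx_mor_conv:
  assumes "\<Gamma> \<turnstile> eqTy A A'"
  shows "ctx_mor S (A' # \<Gamma>) Var (A # \<Gamma>)"
proof -
  have valid: "wf_ctx S \<Gamma>" "\<Gamma> \<turnstile> isTy A" "\<Gamma> \<turnstile> isTy A'"
    using assms ctx_valid eqTy_valid by blast+
  have "A' # \<Gamma> \<turnstile> eqTy (A'\<langle>\<lambda>i. Var (Suc i)\<rangle>) (A\<langle>\<lambda>i. Var (Suc i)\<rangle>)"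
    using subst_eqTy[OF eqTy_sym[OF assms] ctx_mor_wk] valid by blast
  then have "ctx_mor S (A' # \<Gamma>) (Var 0 \<rhd> (\<lambda>i. Var (Suc i))) (A # \<Gamma>)"
    using valid by (intro ctx_mor_scons ctx_mor_wk conv[OF var0]) auto
  then show ?thesis by simp
qed

lemma substJ_Var: "substJ \<J> Var = \<J>"
  by (cases \<J>) simp_all

lemma ctx_conv:
  assumes "\<Gamma> \<turnstile> eqTy A A'"
  shows "A # \<Gamma> \<turnstile> \<J> \<longleftrightarrow> A' # \<Gamma> \<turnstile> \<J>"
  using substitution[OF ctx_mor_conv[OF assms]] substitution[OF ctx_mor_conv[OF eqTy_sym[OF assms]]]
  by (auto simp: substJ_Var)

end

section \<open>Induction on identity proofs\<close>

context ml2
begin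

lemma ctx_mor_wk2:
  "\<lbrakk>\<Gamma> \<turnstile> isTy A; A # \<Gamma> \<turnstile> isTy B\<rbrakk> \<Longrightarrow> ctx_mor S (B # A # \<Gamma>) (\<lambda>i. Var (Suc (Suc i))) \<Gamma>"
  using ctx_mor_wk_comp[OF ctx_mor_wk] ctx_valid by force

lemma ctx_mor_wk3:
  "\<lbrakk>\<Gamma> \<turnstile> isTy A; A # \<Gamma> \<turnstile> isTy B; B # A # \<Gamma> \<turnstile> isTy C\<rbrakk> \<Longrightarrow>
    ctx_mor S (C # B # A # \<Gamma>) (\<lambda>i. Var (Suc (Suc (Suc i)))) \<Gamma>"
  using ctx_mor_wk_comp[OF ctx_mor_wk2] by force

lemma ctx_Id_eq:
  "ctx_Id A \<Gamma> = Idt (A\<langle>\<lambda>i. Var (Suc (Suc i))\<rangle>) (Var (Suc 0)) (Var 0) # A\<langle>\<lambda>i. Var (Suc i)\<rangle> # A # \<Gamma>"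
  by (simp add: ctx_Id_def subst_calculus)

lemma ctx_Id_isTy:
  assumes "\<Gamma> \<turnstile> isTy A"
  shows "A # \<Gamma> \<turnstile> isTy (A\<langle>\<lambda>i. Var (Suc i)\<rangle>)"
    and "A\<langle>\<lambda>i. Var (Suc i)\<rangle> # A # \<Gamma> \<turnstile> isTy (Idt (A\<langle>\<lambda>i. Var (Suc (Suc i))\<rangle>) (Var (Suc 0)) (Var 0))"
proof -
  show A: "A # \<Gamma> \<turnstile> isTy (A\<langle>\<lambda>i. Var (Suc i)\<rangle>)"
    using assms ctx_valid by (blast intro: subst_isTy ctx_mor_wk)
  have "wf_ctx S (A # \<Gamma>)" using A ctx_valid by blast
  from subst_isTm[OF var0[OF assms] ctx_mor_wk[OF this A]] var0[OF A]
  show "A\<langle>\<lambda>i. Var (Suc i)\<rangle> # A # \<Gamma> \<turnstile> isTy (Idt (A\<langle>\<lambda>i. Var (Suc (Suc i))\<rangle>) (Var (Suc 0)) (Var 0))"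
    by (intro Idt_form) (simp_all add: subst_subst)
qed

lemma ctx_mor_wk_Id:
  "\<Gamma> \<turnstile> isTy A \<Longrightarrow> ctx_mor S (ctx_Id A \<Gamma>) (\<lambda>i. Var (Suc (Suc (Suc i)))) \<Gamma>"
  unfolding ctx_Id_eq using ctx_Id_isTy by (intro ctx_mor_wk3) auto

lemma ctx_Id_vars:
  assumes "\<Gamma> \<turnstile> isTy A"
  shows "ctx_Id A \<Gamma> \<turnstile> isTm (Var (Suc (Suc 0))) (A\<langle>\<lambda>i. Var (Suc (Suc (Suc i)))\<rangle>)"
    and "ctx_Id A \<Gamma> \<turnstile> isTm (Var (Suc 0)) (A\<langle>\<lambda>i. Var (Suc (Suc (Suc i)))\<rangle>)"
    and "ctx_Id A \<Gamma> \<turnstile> isTm (Var 0)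
      (Idt (A\<langle>\<lambda>i. Var (Suc (Suc (Suc i)))\<rangle>) (Var (Suc (Suc 0))) (Var (Suc 0)))"
proof -
  have "wf_ctx S (ctx_Id A \<Gamma>)"
    using ctx_mor_wk_Id[OF assms] by (simp add: ctx_mor_def)
  from var[OF this, of 2] var[OF this, of 1] var[OF this, of 0] show
    "ctx_Id A \<Gamma> \<turnstile> isTm (Var (Suc (Suc 0))) (A\<langle>\<lambda>i. Var (Suc (Suc (Suc i)))\<rangle>)"
    "ctx_Id A \<Gamma> \<turnstile> isTm (Var (Suc 0)) (A\<langle>\<lambda>i. Var (Suc (Suc (Suc i)))\<rangle>)"
    "ctx_Id A \<Gamma> \<turnstile> isTm (Var 0)
      (Idt (A\<langle>\<lambda>i. Var (Suc (Suc (Suc i)))\<rangle>) (Var (Suc (Suc 0))) (Var (Suc 0)))"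
    by (simp_all add: ctx_Id_eq subst_calculus numeral_2_eq_2)
qed

lemma ctx_mor_Id:
  assumes "\<Gamma> \<turnstile> isTm a A" "\<Gamma> \<turnstile> isTm b A" "\<Gamma> \<turnstile> isTm p (Idt A a b)"
  shows "ctx_mor S \<Gamma> (p \<rhd> b \<rhd> a \<rhd> Var) (ctx_Id A \<Gamma>)"
proof -
  have A: "\<Gamma> \<turnstile> isTy A"
    using assms(1) tm_valid by blast
  show ?thesis
    unfolding ctx_Id_eq
    using assms A ctx_Id_isTy[OF A] ctx_mor_Var[OF ctx_valid[OF A]]
    by (intro ctx_mor_scons) (simp_all add: subst_calculus)
qed

lemma ctx_mor_diag:
  assumes A: "\<Gamma> \<turnstile> isTy A"
  shows "ctx_mor S (A # \<Gamma>) diag (ctx_Id A \<Gamma>)"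
  unfolding ctx_Id_eq diag_def
  using ctx_Id_isTy[OF A] var0[OF A] ctx_mor_Var[of "A # \<Gamma>"] ctx_valid[OF var0[OF A]] Refl_intro
  by (intro ctx_mor_scons) (simp_all add: subst_calculus)

text \<open>The motive is \<open>Idt (Idt D u v) s t\<close>. Discreteness turns its elements into
  definitional equations because \<open>s\<close> and \<open>t\<close> are themselves identity
  proofs, whence the restriction to terms of type \<open>Idt D u v\<close>.\<close>

lemma Id_eq_ind:
  assumes D: "ctx_Id A \<Gamma> \<turnstile> isTm u D" "ctx_Id A \<Gamma> \<turnstile> isTm v D"
    and st: "ctx_Id A \<Gamma> \<turnstile> isTm s (Idt D u v)" "ctx_Id A \<Gamma> \<turnstile> isTm t (Idt D u v)"
    and diag: "A # \<Gamma> \<turnstile> eqTm (s\<langle>diag\<rangle>) (t\<langle>diag\<rangle>) ((Idt D u v)\<langle>diag\<rangle>)"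
    and p: "\<Gamma> \<turnstile> isTm a A" "\<Gamma> \<turnstile> isTm b A" "\<Gamma> \<turnstile> isTm p (Idt A a b)"
  shows "\<Gamma> \<turnstile> eqTm (s\<langle>p \<rhd> b \<rhd> a \<rhd> Var\<rangle>) (t\<langle>p \<rhd> b \<rhd> a \<rhd> Var\<rangle>) ((Idt D u v)\<langle>p \<rhd> b \<rhd> a \<rhd> Var\<rangle>)"
proof -
  note mor = ctx_mor_Id[OF p]
  have "A # \<Gamma> \<turnstile> isTm (s\<langle>diag\<rangle>) ((Idt D u v)\<langle>diag\<rangle>)"
    using diag eqTm_valid by blast
  \<comment> \<open>Over the diagonal \<open>s\<close> and \<open>t\<close> are definitionally
    equal, so by conversion a reflexivity proof inhabits the motive there.\<close>
  then have "A # \<Gamma> \<turnstile> isTm (Refl (s\<langle>diag\<rangle>)) ((Idt (Idt D u v) s t)\<langle>diag\<rangle>)"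
    using diag by (auto intro: conv[OF Refl_intro] Idt_cong eqTy_refl eqTm_refl tm_valid)
  from Idt_elim[OF Idt_form[OF st] this p] show ?thesis
    using subst_isTm[OF D(1) mor] subst_isTm[OF D(2) mor] subst_isTm[OF st(1) mor]
      subst_isTm[OF st(2) mor] by (auto intro: Idt_discrete)
qed

text \<open>The telescope \<open>E\<close> may depend on the eliminated variables, so the motive is a \<open>\<Pi>\<close>-type over it.\<close>

lemma Id_eq_ind_ext:
  assumes D: "E # ctx_Id A \<Gamma> \<turnstile> isTm u D" "E # ctx_Id A \<Gamma> \<turnstile> isTm v D"
    and st: "E # ctx_Id A \<Gamma> \<turnstile> isTm s (Idt D u v)" "E # ctx_Id A \<Gamma> \<turnstile> isTm t (Idt D u v)"
    and diag: "E\<langle>diag\<rangle> # A # \<Gamma> \<turnstile> eqTm (s\<langle>lift diag\<rangle>) (t\<langle>lift diag\<rangle>) ((Idt D u v)\<langle>lift diag\<rangle>)"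
    and p: "\<Gamma> \<turnstile> isTm a A" "\<Gamma> \<turnstile> isTm b A" "\<Gamma> \<turnstile> isTm p (Idt A a b)"
    and e: "\<Gamma> \<turnstile> isTm e (E\<langle>p \<rhd> b \<rhd> a \<rhd> Var\<rangle>)"
  shows "\<Gamma> \<turnstile> eqTm (s\<langle>e \<rhd> p \<rhd> b \<rhd> a \<rhd> Var\<rangle>) (t\<langle>e \<rhd> p \<rhd> b \<rhd> a \<rhd> Var\<rangle>)
    ((Idt D u v)\<langle>e \<rhd> p \<rhd> b \<rhd> a \<rhd> Var\<rangle>)"
proof -
  let ?\<sigma> = "p \<rhd> b \<rhd> a \<rhd> Var"
  let ?C = "Idt (Idt D u v) s t"
  note mor = ctx_mor_Id[OF p]
  have E: "ctx_Id A \<Gamma> \<turnstile> isTy E"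
    using D(1) ctx_valid_Cons by blast
  have mor_e: "ctx_mor S \<Gamma> (e \<rhd> ?\<sigma>) (E # ctx_Id A \<Gamma>)"
    using mor E e by (rule ctx_mor_scons)
  have "E\<langle>diag\<rangle> # A # \<Gamma> \<turnstile> isTm (s\<langle>lift diag\<rangle>) ((Idt D u v)\<langle>lift diag\<rangle>)"
    using diag eqTm_valid by blast
  then have "E\<langle>diag\<rangle> # A # \<Gamma> \<turnstile> isTm (Refl (s\<langle>lift diag\<rangle>)) (?C\<langle>lift diag\<rangle>)"
    using diag by (auto intro: conv[OF Refl_intro] Idt_cong eqTy_refl eqTm_refl tm_valid)
  then have d: "A # \<Gamma> \<turnstile> isTm (Lam (Refl (s\<langle>lift diag\<rangle>))) ((Pi E ?C)\<langle>diag\<rangle>)"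
    using Lam_intro by simp
  have C: "E # ctx_Id A \<Gamma> \<turnstile> isTy ?C"
    using st by (rule Idt_form)
  \<comment> \<open>Any element of the \<Pi>-type will do: applied to \<open>e\<close> it inhabits
    the identity type between the two instances, and discreteness needs only that.\<close>
  obtain j where j: "\<Gamma> \<turnstile> isTm j ((Pi E ?C)\<langle>?\<sigma>\<rangle>)"
    using Idt_elim[OF Pi_form[OF E C] d p] by blast
  have "E\<langle>?\<sigma>\<rangle> # \<Gamma> \<turnstile> isTy (?C\<langle>lift ?\<sigma>\<rangle>)"
    unfolding lift_eq using ctx_mor_lift[OF mor E] by (intro subst_isTy[OF C]) simp
  from App_elim[OF this _ e] j
  have "\<Gamma> \<turnstile> isTm (App j e) (?C\<langle>lift ?\<sigma>\<rangle>\<langle>e \<rhd> Var\<rangle>)"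
    by simp
  then have "\<Gamma> \<turnstile> isTm (App j e) (?C\<langle>e \<rhd> ?\<sigma>\<rangle>)"
    by (simp add: subst_calculus)
  then show ?thesis
    using subst_isTm[OF D(1) mor_e] subst_isTm[OF D(2) mor_e] subst_isTm[OF st(1) mor_e]
      subst_isTm[OF st(2) mor_e] by (auto intro: Idt_discrete)
qed

end

section \<open>Composition of identity proofs\<close>

lemma id_trans_subst: "(id_trans b c q p)\<langle>\<sigma>\<rangle> = id_trans (b\<langle>\<sigma>\<rangle>) (c\<langle>\<sigma>\<rangle>) (q\<langle>\<sigma>\<rangle>) (p\<langle>\<sigma>\<rangle>)"
  by (simp add: id_trans_def lift_eq)

lemma ap_subst: "(ap h x y p)\<langle>\<sigma>\<rangle> = ap (h\<langle>lift \<sigma>\<rangle>) (x\<langle>\<sigma>\<rangle>) (y\<langle>\<sigma>\<rangle>) (p\<langle>\<sigma>\<rangle>)"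
  by (simp add: ap_def)

lemma happly_eq_ap: "happly m n p a = ap (App (Var 0) (wk a)) m n p"
  by (simp add: happly_def ap_def)

context ml2
begin

text \<open>Both rules rest on the motive that types \<open>id_trans\<close>: over x, y and z :
  Id(x, y) it is the type of functions from Id(a, x) to Id(a, y). The raw term mentions neither
  \<open>A\<close> nor \<open>a\<close>, so both are fixed by the typing.\<close>

lemma
  assumes a: "\<Gamma> \<turnstile> isTm a A"
  shows id_trans_cong: "\<lbrakk>\<Gamma> \<turnstile> eqTm b b' A; \<Gamma> \<turnstile> eqTm c c' A; \<Gamma> \<turnstile> eqTm q q' (Idt A b c);
      \<Gamma> \<turnstile> eqTm p p' (Idt A a b)\<rbrakk> \<Longrightarrow> \<Gamma> \<turnstile> eqTm (id_trans b c q p) (id_trans b' c' q' p') (Idt A a c)"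
    and id_trans_Refl_left: "\<lbrakk>\<Gamma> \<turnstile> isTm b A; \<Gamma> \<turnstile> isTm p (Idt A a b)\<rbrakk> \<Longrightarrow>
      \<Gamma> \<turnstile> eqTm (id_trans b b (Refl b) p) p (Idt A a b)"
proof -
  have A: "\<Gamma> \<turnstile> isTy A"
    using a tm_valid by blast
  note vars = ctx_Id_vars[OF A]
  let ?s1 = "\<lambda>i. Var (Suc i)" and ?s2 = "\<lambda>i. Var (Suc (Suc i))" and ?s3 = "\<lambda>i. Var (Suc (Suc (Suc i)))"
    and ?s4 = "\<lambda>i. Var (Suc (Suc (Suc (Suc i))))"
  let ?E = "Idt (A\<langle>?s3\<rangle>) (a\<langle>?s3\<rangle>) (Var (Suc (Suc 0)))"
  let ?F = "Idt (A\<langle>?s4\<rangle>) (a\<langle>?s4\<rangle>) (Var (Suc (Suc 0)))"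
  let ?C = "Pi ?E ?F"
  note a3 = subst_isTm[OF a ctx_mor_wk_Id[OF A]]
  have E: "ctx_Id A \<Gamma> \<turnstile> isTy ?E"
    using a3 vars by (auto intro: Idt_form)
  have F: "?E # ctx_Id A \<Gamma> \<turnstile> isTy ?F"
    using subst_isTy[OF Idt_form[OF a3 vars(2)] ctx_mor_wk[OF ctx_valid[OF E] E]]
    by (simp add: subst_calculus)
  have C: "ctx_Id A \<Gamma> \<turnstile> isTy ?C"
    using E F by (rule Pi_form)
  \<comment> \<open>Over the diagonal the domain and codomain of the motive coincide, so the
    identity function is a base case.\<close>
  have "A # \<Gamma> \<turnstile> isTy (?E\<langle>diag\<rangle>)"
    using subst_isTy[OF E ctx_mor_diag[OF A]] .
  from Lam_intro[OF var0[OF this]]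
  have d: "A # \<Gamma> \<turnstile> isTm (Lam (Var 0)) (?C\<langle>diag\<rangle>)"
    by (simp add: subst_calculus)
  have fun_type: "Idt A a b # \<Gamma> \<turnstile> isTy (Idt (A\<langle>?s1\<rangle>) (a\<langle>?s1\<rangle>) (c\<langle>?s1\<rangle>))"
    if b: "\<Gamma> \<turnstile> isTm b A" and c: "\<Gamma> \<turnstile> isTm c A" for b c
    using subst_isTy[OF Idt_form[OF a c] ctx_mor_wk[OF ctx_valid[OF A] Idt_form[OF a b]]] by simp
  show "\<Gamma> \<turnstile> eqTm (id_trans b c q p) (id_trans b' c' q' p') (Idt A a c)"
    if "\<Gamma> \<turnstile> eqTm b b' A" "\<Gamma> \<turnstile> eqTm c c' A" "\<Gamma> \<turnstile> eqTm q q' (Idt A b c)"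
      "\<Gamma> \<turnstile> eqTm p p' (Idt A a b)" for b b' c c' q q' p p'
  proof -
    have "\<Gamma> \<turnstile> eqTm (J (Lam (Var 0)) b c q) (J (Lam (Var 0)) b' c' q') (?C\<langle>q \<rhd> c \<rhd> b \<rhd> Var\<rangle>)"
      using C eqTm_refl[OF d] that by (intro J_cong)
    then have "\<Gamma> \<turnstile> eqTm (J (Lam (Var 0)) b c q) (J (Lam (Var 0)) b' c' q')
      (Pi (Idt A a b) (Idt (A\<langle>?s1\<rangle>) (a\<langle>?s1\<rangle>) (c\<langle>?s1\<rangle>)))"
      by (simp add: subst_calculus)
    from App_cong[OF fun_type this] that show ?thesis
      using eqTm_valid by (fastforce simp: id_trans_def subst_calculus)
  qed
  show "\<Gamma> \<turnstile> eqTm (id_trans b b (Refl b) p) p (Idt A a b)"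
    if b: "\<Gamma> \<turnstile> isTm b A" and p: "\<Gamma> \<turnstile> isTm p (Idt A a b)" for b p
  proof -
    have "\<Gamma> \<turnstile> eqTm (J (Lam (Var 0)) b b (Refl b)) ((Lam (Var 0))\<langle>b \<rhd> Var\<rangle>)
      (?C\<langle>Refl b \<rhd> b \<rhd> b \<rhd> Var\<rangle>)"
      using C d b by (rule Idt_comp)
    then have "\<Gamma> \<turnstile> eqTm (J (Lam (Var 0)) b b (Refl b)) (Lam (Var 0))
      (Pi (Idt A a b) (Idt (A\<langle>?s1\<rangle>) (a\<langle>?s1\<rangle>) (b\<langle>?s1\<rangle>)))"
      by (simp add: subst_calculus)
    from App_cong[OF fun_type[OF b b] this eqTm_refl[OF p]]
    have "\<Gamma> \<turnstile> eqTm (id_trans b b (Refl b) p) (App (Lam (Var 0)) p) (Idt A a b)"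
      by (simp add: id_trans_def subst_calculus)
    moreover have "\<Gamma> \<turnstile> eqTm (App (Lam (Var 0)) p) p (Idt A a b)"
      using Pi_comp[OF var0[OF Idt_form[OF a b]] p] by (simp add: subst_calculus)
    ultimately show ?thesis
      by (rule eqTm_trans)
  qed
qed

text \<open>Typing is congruence applied to reflexive equations, since an equation presupposes that
  both of its sides are well typed. \<open>ap_isTm\<close> is obtained in the same way.\<close>

lemma id_trans_isTm:
  "\<lbrakk>\<Gamma> \<turnstile> isTm a A; \<Gamma> \<turnstile> isTm b A; \<Gamma> \<turnstile> isTm c A; \<Gamma> \<turnstile> isTm q (Idt A b c); \<Gamma> \<turnstile> isTm p (Idt A a b)\<rbrakk> \<Longrightarrow>
    \<Gamma> \<turnstile> isTm (id_trans b c q p) (Idt A a c)"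
  using id_trans_cong eqTm_refl eqTm_valid by meson

text \<open>Composition eliminates the factor applied last, so only the other unit law is a
  computation. This one needs induction on \<open>q\<close>, whose base case is
  \<open>id_trans_Refl_left\<close>.\<close>

lemma id_trans_Refl_right:
  assumes a: "\<Gamma> \<turnstile> isTm a A" and b: "\<Gamma> \<turnstile> isTm b A" and q: "\<Gamma> \<turnstile> isTm q (Idt A a b)"
  shows "\<Gamma> \<turnstile> eqTm (id_trans a b q (Refl a)) q (Idt A a b)"
proof -
  have A: "\<Gamma> \<turnstile> isTy A"
    using a tm_valid by blast
  note vars = ctx_Id_vars[OF A]
  let ?s = "id_trans (Var (Suc (Suc 0))) (Var (Suc 0)) (Var 0) (Refl (Var (Suc (Suc 0))))"
  have "\<Gamma> \<turnstile> eqTm (?s\<langle>q \<rhd> b \<rhd> a \<rhd> Var\<rangle>) ((Var 0)\<langle>q \<rhd> b \<rhd> a \<rhd> Var\<rangle>)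
    ((Idt (A\<langle>\<lambda>i. Var (Suc (Suc (Suc i)))\<rangle>) (Var (Suc (Suc 0))) (Var (Suc 0)))\<langle>q \<rhd> b \<rhd> a \<rhd> Var\<rangle>)"
    using vars a b q id_trans_Refl_left[OF var0[OF A] var0[OF A] Refl_intro[OF var0[OF A]]]
    by (intro Id_eq_ind id_trans_isTm Refl_intro) (auto simp: id_trans_subst subst_calculus)
  then show ?thesis
    by (simp add: id_trans_subst subst_calculus)
qed

end

text \<open>The context \<open>\<Gamma>, x : A, y : A, z : Id(x, y), w : Id(b, x)\<close>, for induction on \<open>z\<close> in a composite \<open>z \<circ> w\<close>.\<close>

definition ctx_comp :: "'c exp \<Rightarrow> 'c exp \<Rightarrow> 'c ctx \<Rightarrow> 'c ctx" where
  "ctx_comp A b \<Gamma> = Idt (A\<langle>\<lambda>i. Var (Suc (Suc (Suc i)))\<rangle>) (b\<langle>\<lambda>i. Var (Suc (Suc (Suc i)))\<rangle>)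
    (Var (Suc (Suc 0))) # ctx_Id A \<Gamma>"

text \<open>The context \<Gamma>, x : A, w : Id(b, x), which is what remains of
  \<open>ctx_comp\<close> when y and z are contracted to x and r(x).\<close>

definition ctx_comp_diag :: "'c exp \<Rightarrow> 'c exp \<Rightarrow> 'c ctx \<Rightarrow> 'c ctx" where
  "ctx_comp_diag A b \<Gamma> = Idt (A\<langle>\<lambda>i. Var (Suc i)\<rangle>) (b\<langle>\<lambda>i. Var (Suc i)\<rangle>) (Var 0) # A # \<Gamma>"

context ml2
begin

lemma
  assumes b: "\<Gamma> \<turnstile> isTm b A"
  shows ctx_mor_wk_comp_ctx: "ctx_mor S (ctx_comp A b \<Gamma>) (\<lambda>i. Var (Suc (Suc (Suc (Suc i))))) \<Gamma>"
    and ctx_comp_vars: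
      "ctx_comp A b \<Gamma> \<turnstile> isTm (Var (Suc (Suc (Suc 0)))) (A\<langle>\<lambda>i. Var (Suc (Suc (Suc (Suc i))))\<rangle>)"
      "ctx_comp A b \<Gamma> \<turnstile> isTm (Var (Suc (Suc 0))) (A\<langle>\<lambda>i. Var (Suc (Suc (Suc (Suc i))))\<rangle>)"
      "ctx_comp A b \<Gamma> \<turnstile> isTm (Var (Suc 0)) (Idt (A\<langle>\<lambda>i. Var (Suc (Suc (Suc (Suc i))))\<rangle>)
        (Var (Suc (Suc (Suc 0)))) (Var (Suc (Suc 0))))"
      "ctx_comp A b \<Gamma> \<turnstile> isTm (Var 0) (Idt (A\<langle>\<lambda>i. Var (Suc (Suc (Suc (Suc i))))\<rangle>)
        (b\<langle>\<lambda>i. Var (Suc (Suc (Suc (Suc i))))\<rangle>) (Var (Suc (Suc (Suc 0)))))"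
    and ctx_mor_wk_comp_diag: "ctx_mor S (ctx_comp_diag A b \<Gamma>) (\<lambda>i. Var (Suc (Suc i))) \<Gamma>"
    and ctx_comp_diag_vars:
      "ctx_comp_diag A b \<Gamma> \<turnstile> isTm (Var (Suc 0)) (A\<langle>\<lambda>i. Var (Suc (Suc i))\<rangle>)"
      "ctx_comp_diag A b \<Gamma> \<turnstile> isTm (Var 0)
        (Idt (A\<langle>\<lambda>i. Var (Suc (Suc i))\<rangle>) (b\<langle>\<lambda>i. Var (Suc (Suc i))\<rangle>) (Var (Suc 0)))"
proof -
  have A: "\<Gamma> \<turnstile> isTy A"
    using b tm_valid by blast
  let ?s3 = "\<lambda>i. Var (Suc (Suc (Suc i)))"
  let ?E = "Idt (A\<langle>?s3\<rangle>) (b\<langle>?s3\<rangle>) (Var (Suc (Suc 0)))"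
  have E: "ctx_Id A \<Gamma> \<turnstile> isTy ?E"
    using ctx_Id_vars[OF A] subst_isTm[OF b ctx_mor_wk_Id[OF A]] by (intro Idt_form)
  have Ed: "A # \<Gamma> \<turnstile> isTy (?E\<langle>diag\<rangle>)"
    using subst_isTy[OF E ctx_mor_diag[OF A]] .
  note wk = ctx_mor_wk[OF ctx_valid[OF E] E]
  show "ctx_mor S (ctx_comp A b \<Gamma>) (\<lambda>i. Var (Suc (Suc (Suc (Suc i))))) \<Gamma>"
    using ctx_mor_wk_comp[OF ctx_mor_wk_Id[OF A] E] by (simp add: ctx_comp_def)
  show "ctx_comp A b \<Gamma> \<turnstile> isTm (Var (Suc (Suc (Suc 0)))) (A\<langle>\<lambda>i. Var (Suc (Suc (Suc (Suc i))))\<rangle>)"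
      "ctx_comp A b \<Gamma> \<turnstile> isTm (Var (Suc (Suc 0))) (A\<langle>\<lambda>i. Var (Suc (Suc (Suc (Suc i))))\<rangle>)"
      "ctx_comp A b \<Gamma> \<turnstile> isTm (Var (Suc 0)) (Idt (A\<langle>\<lambda>i. Var (Suc (Suc (Suc (Suc i))))\<rangle>)
        (Var (Suc (Suc (Suc 0)))) (Var (Suc (Suc 0))))"
      "ctx_comp A b \<Gamma> \<turnstile> isTm (Var 0) (Idt (A\<langle>\<lambda>i. Var (Suc (Suc (Suc (Suc i))))\<rangle>)
        (b\<langle>\<lambda>i. Var (Suc (Suc (Suc (Suc i))))\<rangle>) (Var (Suc (Suc (Suc 0)))))"
    using ctx_Id_vars[OF A, THEN subst_isTm, OF wk] var0[OF E]
    by (simp_all add: ctx_comp_def subst_calculus)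
  show "ctx_mor S (ctx_comp_diag A b \<Gamma>) (\<lambda>i. Var (Suc (Suc i))) \<Gamma>"
    using ctx_mor_wk2[OF A Ed] by (simp add: ctx_comp_diag_def subst_calculus)
  show "ctx_comp_diag A b \<Gamma> \<turnstile> isTm (Var (Suc 0)) (A\<langle>\<lambda>i. Var (Suc (Suc i))\<rangle>)"
      "ctx_comp_diag A b \<Gamma> \<turnstile> isTm (Var 0)
        (Idt (A\<langle>\<lambda>i. Var (Suc (Suc i))\<rangle>) (b\<langle>\<lambda>i. Var (Suc (Suc i))\<rangle>) (Var (Suc 0)))"
    using subst_isTm[OF var0[OF A] ctx_mor_wk[OF ctx_valid[OF Ed] Ed]] var0[OF Ed]
    by (simp_all add: ctx_comp_diag_def subst_calculus)
qed

text \<open>\<open>diag_comp\<close> sets \<open>y := x\<close> and \<open>z := r(x)\<close> and keeps \<open>w\<close>.\<close>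

abbreviation diag_comp :: "'c sub" where
  "diag_comp \<equiv> Var 0 \<rhd> Refl (Var (Suc 0)) \<rhd> Var (Suc 0) \<rhd> (\<lambda>i. Var (Suc i))"

text \<open>The type of w mentions x, one of the variables that the induction on z : Id(x, y)
  generalises; so w is carried along as the telescope of \<open>Id_eq_ind_ext\<close>.\<close>

lemma comp_eq_ind:
  assumes D: "ctx_comp A b \<Gamma> \<turnstile> isTm u D" "ctx_comp A b \<Gamma> \<turnstile> isTm v D"
    and st: "ctx_comp A b \<Gamma> \<turnstile> isTm s (Idt D u v)" "ctx_comp A b \<Gamma> \<turnstile> isTm t (Idt D u v)"
    and diag: "ctx_comp_diag A b \<Gamma> \<turnstile> eqTm (s\<langle>diag_comp\<rangle>) (t\<langle>diag_comp\<rangle>) ((Idt D u v)\<langle>diag_comp\<rangle>)"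
    and q: "\<Gamma> \<turnstile> isTm c A" "\<Gamma> \<turnstile> isTm d A" "\<Gamma> \<turnstile> isTm q (Idt A c d)"
    and p: "\<Gamma> \<turnstile> isTm p (Idt A b c)"
  shows "\<Gamma> \<turnstile> eqTm (s\<langle>p \<rhd> q \<rhd> d \<rhd> c \<rhd> Var\<rangle>) (t\<langle>p \<rhd> q \<rhd> d \<rhd> c \<rhd> Var\<rangle>)
    ((Idt D u v)\<langle>p \<rhd> q \<rhd> d \<rhd> c \<rhd> Var\<rangle>)"
proof (rule Id_eq_ind_ext[OF D[unfolded ctx_comp_def] st[unfolded ctx_comp_def] _ q])
qed (use diag p in \<open>simp_all add: ctx_comp_diag_def subst_calculus\<close>)

text \<open>Induction on \<open>r\<close>, the factor that is eliminated first on both sides, with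
  \<open>q\<close> as the telescope variable and \<open>p\<close> fixed. At reflexivity both sides
  reduce to the composite of \<open>q\<close> and \<open>p\<close> by the left unit law.\<close>

lemma id_trans_assoc:
  assumes a: "\<Gamma> \<turnstile> isTm a A" and b: "\<Gamma> \<turnstile> isTm b A" and c: "\<Gamma> \<turnstile> isTm c A" and d: "\<Gamma> \<turnstile> isTm d A"
    and p: "\<Gamma> \<turnstile> isTm p (Idt A a b)" and q: "\<Gamma> \<turnstile> isTm q (Idt A b c)" and r: "\<Gamma> \<turnstile> isTm r (Idt A c d)"
  shows "\<Gamma> \<turnstile> eqTm (id_trans b d (id_trans c d r q) p) (id_trans c d r (id_trans b c q p)) (Idt A a d)"
proof -
  let ?s2 = "\<lambda>i. Var (Suc (Suc i))" and ?s4 = "\<lambda>i. Var (Suc (Suc (Suc (Suc i))))"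
  let ?x = "Var (Suc (Suc (Suc 0)))" and ?y = "Var (Suc (Suc 0))" and ?z = "Var (Suc 0)"
  note vars = ctx_comp_vars[OF b] and wk = ctx_mor_wk_comp_ctx[OF b]
  have a4: "ctx_comp A b \<Gamma> \<turnstile> isTm (a\<langle>?s4\<rangle>) (A\<langle>?s4\<rangle>)"
    and b4: "ctx_comp A b \<Gamma> \<turnstile> isTm (b\<langle>?s4\<rangle>) (A\<langle>?s4\<rangle>)"
    and p4: "ctx_comp A b \<Gamma> \<turnstile> isTm (p\<langle>?s4\<rangle>) (Idt (A\<langle>?s4\<rangle>) (a\<langle>?s4\<rangle>) (b\<langle>?s4\<rangle>))"
    using a b p wk subst_isTm by fastforce+
  let ?s = "id_trans (b\<langle>?s4\<rangle>) ?y (id_trans ?x ?y ?z (Var 0)) (p\<langle>?s4\<rangle>)"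
  let ?t = "id_trans ?x ?y ?z (id_trans (b\<langle>?s4\<rangle>) ?x (Var 0) (p\<langle>?s4\<rangle>))"
  note vars' = ctx_comp_diag_vars[OF b] and wk' = ctx_mor_wk_comp_diag[OF b]
  have a': "ctx_comp_diag A b \<Gamma> \<turnstile> isTm (a\<langle>?s2\<rangle>) (A\<langle>?s2\<rangle>)"
    and b': "ctx_comp_diag A b \<Gamma> \<turnstile> isTm (b\<langle>?s2\<rangle>) (A\<langle>?s2\<rangle>)"
    and p': "ctx_comp_diag A b \<Gamma> \<turnstile> isTm (p\<langle>?s2\<rangle>) (Idt (A\<langle>?s2\<rangle>) (a\<langle>?s2\<rangle>) (b\<langle>?s2\<rangle>))"
    using a b p wk' subst_isTm by fastforce+
  have "ctx_comp_diag A b \<Gamma> \<turnstile> eqTm (id_trans (b\<langle>?s2\<rangle>) ?z (id_trans ?z ?z (Refl ?z) (Var 0)) (p\<langle>?s2\<rangle>))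
    (id_trans (b\<langle>?s2\<rangle>) ?z (Var 0) (p\<langle>?s2\<rangle>)) (Idt (A\<langle>?s2\<rangle>) (a\<langle>?s2\<rangle>) ?z)"
    using a' b' p' vars' by (intro id_trans_cong id_trans_Refl_left eqTm_refl)
  moreover have "ctx_comp_diag A b \<Gamma> \<turnstile> eqTm (id_trans ?z ?z (Refl ?z) (id_trans (b\<langle>?s2\<rangle>) ?z (Var 0) (p\<langle>?s2\<rangle>)))
    (id_trans (b\<langle>?s2\<rangle>) ?z (Var 0) (p\<langle>?s2\<rangle>)) (Idt (A\<langle>?s2\<rangle>) (a\<langle>?s2\<rangle>) ?z)"
    using a' b' p' vars' by (intro id_trans_Refl_left id_trans_isTm)
  ultimately have diag: "ctx_comp_diag A b \<Gamma> \<turnstile> eqTm (?s\<langle>diag_comp\<rangle>) (?t\<langle>diag_comp\<rangle>)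
      ((Idt (A\<langle>?s4\<rangle>) (a\<langle>?s4\<rangle>) ?y)\<langle>diag_comp\<rangle>)"
    by (auto simp: id_trans_subst subst_calculus intro: eqTm_trans eqTm_sym)
  have s: "ctx_comp A b \<Gamma> \<turnstile> isTm ?s (Idt (A\<langle>?s4\<rangle>) (a\<langle>?s4\<rangle>) ?y)"
    using a4 b4 p4 vars by (intro id_trans_isTm)
  have t: "ctx_comp A b \<Gamma> \<turnstile> isTm ?t (Idt (A\<langle>?s4\<rangle>) (a\<langle>?s4\<rangle>) ?y)"
    using a4 b4 p4 vars by (intro id_trans_isTm)
  from comp_eq_ind[OF a4 vars(2) s t diag c d r q] show ?thesis
    by (simp add: id_trans_subst subst_calculus)
qed

section \<open>Action of terms on identity proofs\<close>

lemma
  assumes C: "\<Gamma> \<turnstile> isTy C"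
  shows ap_cong: "\<lbrakk>B # \<Gamma> \<turnstile> eqTm h h' (wk C); \<Gamma> \<turnstile> eqTm x x' B; \<Gamma> \<turnstile> eqTm y y' B;
      \<Gamma> \<turnstile> eqTm p p' (Idt B x y)\<rbrakk> \<Longrightarrow>
      \<Gamma> \<turnstile> eqTm (ap h x y p) (ap h' x' y' p') (Idt C (h\<langle>x \<rhd> Var\<rangle>) (h\<langle>y \<rhd> Var\<rangle>))"
    and ap_Refl: "\<lbrakk>B # \<Gamma> \<turnstile> isTm h (wk C); \<Gamma> \<turnstile> isTm x B\<rbrakk> \<Longrightarrow>
      \<Gamma> \<turnstile> eqTm (ap h x x (Refl x)) (Refl (h\<langle>x \<rhd> Var\<rangle>)) (Idt C (h\<langle>x \<rhd> Var\<rangle>) (h\<langle>x \<rhd> Var\<rangle>))"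
proof -
  let ?s3 = "\<lambda>i. Var (Suc (Suc (Suc i)))"
  let ?M = "\<lambda>h. Idt (C\<langle>?s3\<rangle>) (h\<langle>Var (Suc (Suc 0)) \<rhd> ?s3\<rangle>) (h\<langle>Var (Suc 0) \<rhd> ?s3\<rangle>)"
  have M: "ctx_Id B \<Gamma> \<turnstile> isTy (?M h)" if h: "B # \<Gamma> \<turnstile> isTm h (wk C)" for h
  proof -
    have B: "\<Gamma> \<turnstile> isTy B"
      using h ctx_valid_Cons by blast
    note vars = ctx_Id_vars[OF B] and s3 = ctx_mor_wk_Id[OF B]
    show ?thesis
      using subst_isTm[OF h ctx_mor_scons[OF s3 B vars(1)]] subst_isTm[OF h ctx_mor_scons[OF s3 B vars(2)]]
      by (intro Idt_form) (simp_all add: subst_calculus)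
  qed
  show "\<Gamma> \<turnstile> eqTm (ap h x y p) (ap h' x' y' p') (Idt C (h\<langle>x \<rhd> Var\<rangle>) (h\<langle>y \<rhd> Var\<rangle>))"
    if h: "B # \<Gamma> \<turnstile> eqTm h h' (wk C)" and p: "\<Gamma> \<turnstile> eqTm x x' B" "\<Gamma> \<turnstile> eqTm y y' B"
      "\<Gamma> \<turnstile> eqTm p p' (Idt B x y)"
  proof -
    have "B # \<Gamma> \<turnstile> eqTm (Refl h) (Refl h') ((?M h)\<langle>diag\<rangle>)"
      using Refl_cong[OF h] by (simp add: subst_calculus)
    from J_cong[OF M this p] show ?thesis
      using h eqTm_valid by (simp add: ap_def subst_calculus)
  qed
  show "\<Gamma> \<turnstile> eqTm (ap h x x (Refl x)) (Refl (h\<langle>x \<rhd> Var\<rangle>)) (Idt C (h\<langle>x \<rhd> Var\<rangle>) (h\<langle>x \<rhd> Var\<rangle>))"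
    if h: "B # \<Gamma> \<turnstile> isTm h (wk C)" and x: "\<Gamma> \<turnstile> isTm x B"
  proof -
    have "B # \<Gamma> \<turnstile> isTm (Refl h) ((?M h)\<langle>diag\<rangle>)"
      using Refl_intro[OF h] by (simp add: subst_calculus)
    from Idt_comp[OF M[OF h] this x] show ?thesis
      by (simp add: ap_def subst_calculus)
  qed
qed

lemma ap_isTm:
  "\<lbrakk>\<Gamma> \<turnstile> isTy C; B # \<Gamma> \<turnstile> isTm h (wk C); \<Gamma> \<turnstile> isTm x B; \<Gamma> \<turnstile> isTm y B; \<Gamma> \<turnstile> isTm p (Idt B x y)\<rbrakk> \<Longrightarrow>
    \<Gamma> \<turnstile> isTm (ap h x y p) (Idt C (h\<langle>x \<rhd> Var\<rangle>) (h\<langle>y \<rhd> Var\<rangle>))"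
  using ap_cong eqTm_refl eqTm_valid by meson

text \<open>In the inductions below \<open>h\<close> lives over \<Gamma>, while its arguments are
  variables of the context of the induction. These are the rules for \<open>ap\<close> with
  \<open>h\<close> pulled back along the weakening \<sigma>, in the form to which the substitution
  calculus reduces them.\<close>

lemma
  assumes \<sigma>: "ctx_mor S \<Delta> \<sigma> \<Gamma>" and C: "\<Gamma> \<turnstile> isTy C" and h: "B # \<Gamma> \<turnstile> isTm h (wk C)"
    and x: "\<Delta> \<turnstile> isTm x (B\<langle>\<sigma>\<rangle>)"
  shows subst_inst_isTm: "\<Delta> \<turnstile> isTm (h\<langle>x \<rhd> \<sigma>\<rangle>) (C\<langle>\<sigma>\<rangle>)"
    and ap_lift_isTm: "\<lbrakk>\<Delta> \<turnstile> isTm y (B\<langle>\<sigma>\<rangle>); \<Delta> \<turnstile> isTm p (Idt (B\<langle>\<sigma>\<rangle>) x y)\<rbrakk> \<Longrightarrow>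
      \<Delta> \<turnstile> isTm (ap (h\<langle>lift \<sigma>\<rangle>) x y p) (Idt (C\<langle>\<sigma>\<rangle>) (h\<langle>x \<rhd> \<sigma>\<rangle>) (h\<langle>y \<rhd> \<sigma>\<rangle>))"
    and ap_lift_Refl: "\<Delta> \<turnstile> eqTm (ap (h\<langle>lift \<sigma>\<rangle>) x x (Refl x)) (Refl (h\<langle>x \<rhd> \<sigma>\<rangle>))
      (Idt (C\<langle>\<sigma>\<rangle>) (h\<langle>x \<rhd> \<sigma>\<rangle>) (h\<langle>x \<rhd> \<sigma>\<rangle>))"
proof -
  have B: "\<Gamma> \<turnstile> isTy B"
    using h ctx_valid_Cons by blast
  have hl: "B\<langle>\<sigma>\<rangle> # \<Delta> \<turnstile> isTm (h\<langle>lift \<sigma>\<rangle>) (wk (C\<langle>\<sigma>\<rangle>))"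
    using subst_isTm[OF h ctx_mor_lift[OF \<sigma> B refl]] by (simp add: subst_calculus)
  note C' = subst_isTy[OF C \<sigma>]
  show "\<Delta> \<turnstile> isTm (h\<langle>x \<rhd> \<sigma>\<rangle>) (C\<langle>\<sigma>\<rangle>)"
    using subst_isTm[OF h ctx_mor_scons[OF \<sigma> B x]] by (simp add: subst_calculus)
  show "\<Delta> \<turnstile> eqTm (ap (h\<langle>lift \<sigma>\<rangle>) x x (Refl x)) (Refl (h\<langle>x \<rhd> \<sigma>\<rangle>))
      (Idt (C\<langle>\<sigma>\<rangle>) (h\<langle>x \<rhd> \<sigma>\<rangle>) (h\<langle>x \<rhd> \<sigma>\<rangle>))"
    using ap_Refl[OF C' hl x] by (simp add: subst_calculus)
  show "\<Delta> \<turnstile> isTm (ap (h\<langle>lift \<sigma>\<rangle>) x y p) (Idt (C\<langle>\<sigma>\<rangle>) (h\<langle>x \<rhd> \<sigma>\<rangle>) (h\<langle>y \<rhd> \<sigma>\<rangle>))"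
    if y: "\<Delta> \<turnstile> isTm y (B\<langle>\<sigma>\<rangle>)" and p: "\<Delta> \<turnstile> isTm p (Idt (B\<langle>\<sigma>\<rangle>) x y)"
    using ap_isTm[OF C' hl x y p] by (simp add: subst_calculus)
qed

lemma ap_Var:
  assumes a: "\<Gamma> \<turnstile> isTm a A" and b: "\<Gamma> \<turnstile> isTm b A" and p: "\<Gamma> \<turnstile> isTm p (Idt A a b)"
  shows "\<Gamma> \<turnstile> eqTm (ap (Var 0) a b p) p (Idt A a b)"
proof -
  have A: "\<Gamma> \<turnstile> isTy A"
    using a tm_valid by blast
  note vars = ctx_Id_vars[OF A] and s3 = ctx_mor_wk_Id[OF A]
  have h: "A # \<Gamma> \<turnstile> isTm (Var 0) (wk A)"
    using var0[OF A] by (simp add: ren_eq_subst)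
  let ?s = "ap (Var 0) (Var (Suc (Suc 0))) (Var (Suc 0)) (Var 0)"
  let ?D = "A\<langle>\<lambda>i. Var (Suc (Suc (Suc i)))\<rangle>"
  have s: "ctx_Id A \<Gamma> \<turnstile> isTm ?s (Idt ?D (Var (Suc (Suc 0))) (Var (Suc 0)))"
    using ap_lift_isTm[OF s3 A h vars] by (simp add: subst_calculus)
  have diag: "A # \<Gamma> \<turnstile> eqTm (?s\<langle>diag\<rangle>) ((Var 0)\<langle>diag\<rangle>) ((Idt ?D (Var (Suc (Suc 0))) (Var (Suc 0)))\<langle>diag\<rangle>)"
    using ap_lift_Refl[OF ctx_mor_wk[OF ctx_valid[OF A] A] A h var0[OF A]]
    by (simp add: ap_subst subst_calculus)
  from Id_eq_ind[OF vars(1,2) s vars(3) diag a b p] show ?thesis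
    by (simp add: ap_subst subst_calculus)
qed

lemma ap_comp:
  assumes C: "\<Gamma> \<turnstile> isTy C" and D: "\<Gamma> \<turnstile> isTy D"
    and h: "A # \<Gamma> \<turnstile> isTm h (wk C)" and k: "C # \<Gamma> \<turnstile> isTm k (wk D)"
    and a: "\<Gamma> \<turnstile> isTm a A" and b: "\<Gamma> \<turnstile> isTm b A" and p: "\<Gamma> \<turnstile> isTm p (Idt A a b)"
  shows "\<Gamma> \<turnstile> eqTm (ap (k\<langle>cmp_sub h\<rangle>) a b p) (ap k (h\<langle>a \<rhd> Var\<rangle>) (h\<langle>b \<rhd> Var\<rangle>) (ap h a b p))
    (Idt D (k\<langle>h\<langle>a \<rhd> Var\<rangle> \<rhd> Var\<rangle>) (k\<langle>h\<langle>b \<rhd> Var\<rangle> \<rhd> Var\<rangle>))"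
proof -
  have A: "\<Gamma> \<turnstile> isTy A"
    using a tm_valid by blast
  note vars = ctx_Id_vars[OF A] and s3 = ctx_mor_wk_Id[OF A]
  have wk: "ctx_mor S (A # \<Gamma>) (\<lambda>i. Var (Suc i)) \<Gamma>"
    using ctx_mor_wk[OF ctx_valid[OF A] A] .
  have kh: "A # \<Gamma> \<turnstile> isTm (k\<langle>cmp_sub h\<rangle>) (wk D)"
    using subst_inst_isTm[OF wk D k] h by (simp add: subst_calculus)
  let ?s3 = "\<lambda>i. Var (Suc (Suc (Suc i)))"
  let ?x = "Var (Suc (Suc 0))" and ?y = "Var (Suc 0)"
  let ?s = "ap (k\<langle>cmp_sub h\<rangle>\<langle>lift ?s3\<rangle>) ?x ?y (Var 0)"
  let ?t = "ap (k\<langle>lift ?s3\<rangle>) (h\<langle>?x \<rhd> ?s3\<rangle>) (h\<langle>?y \<rhd> ?s3\<rangle>) (ap (h\<langle>lift ?s3\<rangle>) ?x ?y (Var 0))"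
  let ?u = "k\<langle>cmp_sub h\<rangle>\<langle>?x \<rhd> ?s3\<rangle>" and ?v = "k\<langle>cmp_sub h\<rangle>\<langle>?y \<rhd> ?s3\<rangle>"
  note hx = subst_inst_isTm[OF s3 C h vars(1)] and hy = subst_inst_isTm[OF s3 C h vars(2)]
    and u = subst_inst_isTm[OF s3 D kh vars(1)] and v = subst_inst_isTm[OF s3 D kh vars(2)]
    and s = ap_lift_isTm[OF s3 D kh vars]
  have t: "ctx_Id A \<Gamma> \<turnstile> isTm ?t (Idt (D\<langle>?s3\<rangle>) ?u ?v)"
    using ap_lift_isTm[OF s3 D k hx hy ap_lift_isTm[OF s3 C h vars]]
    by (simp add: subst_calculus)
  have h': "A # \<Gamma> \<turnstile> isTm h (C\<langle>\<lambda>i. Var (Suc i)\<rangle>)"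
    using h by (simp add: ren_eq_subst)
  have kl: "C\<langle>\<lambda>i. Var (Suc i)\<rangle> # A # \<Gamma> \<turnstile> isTm (k\<langle>lift (\<lambda>i. Var (Suc i))\<rangle>) (wk (D\<langle>\<lambda>i. Var (Suc i)\<rangle>))"
    using subst_isTm[OF k ctx_mor_lift[OF wk C refl]] by (simp add: subst_calculus)
  have eq1: "A # \<Gamma> \<turnstile> eqTm (ap h\<langle>Var 0 \<rhd> (\<lambda>i. Var (Suc (Suc i)))\<rangle> (Var 0) (Var 0) (Refl (Var 0))) (Refl h) (Idt (C\<langle>\<lambda>i. Var (Suc i)\<rangle>) h h)"
    using ap_lift_Refl[OF wk C h var0[OF A]] by (simp add: subst_calculus)
  \<comment> \<open>On the right the inner \<open>ap\<close> has to compute inside the outer one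
    before the outer one can, so congruence comes first.\<close>
  have "A # \<Gamma> \<turnstile> eqTm (ap (k\<langle>lift (\<lambda>i. Var (Suc i))\<rangle>) h h
      (ap h\<langle>Var 0 \<rhd> (\<lambda>i. Var (Suc (Suc i)))\<rangle> (Var 0) (Var 0) (Refl (Var 0))))
     (ap (k\<langle>lift (\<lambda>i. Var (Suc i))\<rangle>) h h (Refl h))
    (Idt (D\<langle>\<lambda>i. Var (Suc i)\<rangle>) (k\<langle>lift (\<lambda>i. Var (Suc i))\<rangle>\<langle>h \<rhd> Var\<rangle>) (k\<langle>lift (\<lambda>i. Var (Suc i))\<rangle>\<langle>h \<rhd> Var\<rangle>))"
    using subst_isTy[OF D wk] kl h' eq1 by (intro ap_cong eqTm_refl)
  then have "A # \<Gamma> \<turnstile> eqTm (ap (k\<langle>lift (\<lambda>i. Var (Suc i))\<rangle>) h h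
      (ap h\<langle>Var 0 \<rhd> (\<lambda>i. Var (Suc (Suc i)))\<rangle> (Var 0) (Var 0) (Refl (Var 0))))
     (Refl (k\<langle>cmp_sub h\<rangle>))
    (Idt (D\<langle>\<lambda>i. Var (Suc i)\<rangle>) (k\<langle>cmp_sub h\<rangle>) (k\<langle>cmp_sub h\<rangle>))"
    using ap_lift_Refl[OF wk D k h'] by (auto simp: subst_calculus intro: eqTm_trans)
  moreover have "A # \<Gamma> \<turnstile> eqTm (ap ((k\<langle>cmp_sub h\<rangle>)\<langle>lift (\<lambda>i. Var (Suc i))\<rangle>) (Var 0) (Var 0) (Refl (Var 0)))
     (Refl (k\<langle>cmp_sub h\<rangle>))
    (Idt (D\<langle>\<lambda>i. Var (Suc i)\<rangle>) (k\<langle>cmp_sub h\<rangle>) (k\<langle>cmp_sub h\<rangle>))"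
    using ap_lift_Refl[OF wk D kh var0[OF A]] by (simp add: subst_calculus)
  ultimately have diag: "A # \<Gamma> \<turnstile> eqTm (?s\<langle>diag\<rangle>) (?t\<langle>diag\<rangle>) ((Idt (D\<langle>?s3\<rangle>) ?u ?v)\<langle>diag\<rangle>)"
    by (auto simp: ap_subst subst_calculus intro: eqTm_trans eqTm_sym)
  from Id_eq_ind[OF u v s t diag a b p] show ?thesis
    by (simp add: ap_subst subst_calculus)
qed

text \<open>The naturality square of the family of identity proofs \<open>q\<close>, and the source
  of the interchange law. At reflexivity both sides reduce to \<open>q\<close>, one by the right and
  the other by the left unit law.\<close>

lemma ap_natural:
  assumes C: "\<Gamma> \<turnstile> isTy C" and g: "A # \<Gamma> \<turnstile> isTm g (wk C)" and h: "A # \<Gamma> \<turnstile> isTm h (wk C)"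
    and q: "A # \<Gamma> \<turnstile> isTm q (Idt (wk C) g h)"
    and a: "\<Gamma> \<turnstile> isTm a A" and b: "\<Gamma> \<turnstile> isTm b A" and p: "\<Gamma> \<turnstile> isTm p (Idt A a b)"
  shows "\<Gamma> \<turnstile> eqTm
    (id_trans (g\<langle>b \<rhd> Var\<rangle>) (h\<langle>b \<rhd> Var\<rangle>) (q\<langle>b \<rhd> Var\<rangle>) (ap g a b p))
    (id_trans (h\<langle>a \<rhd> Var\<rangle>) (h\<langle>b \<rhd> Var\<rangle>) (ap h a b p) (q\<langle>a \<rhd> Var\<rangle>))
    (Idt C (g\<langle>a \<rhd> Var\<rangle>) (h\<langle>b \<rhd> Var\<rangle>))"
proof -
  have A: "\<Gamma> \<turnstile> isTy A"
    using a tm_valid by blast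
  note vars = ctx_Id_vars[OF A] and s3 = ctx_mor_wk_Id[OF A]
  have wk: "ctx_mor S (A # \<Gamma>) (\<lambda>i. Var (Suc i)) \<Gamma>"
    using ctx_mor_wk[OF ctx_valid[OF A] A] .
  let ?s3 = "\<lambda>i. Var (Suc (Suc (Suc i)))"
  let ?x = "Var (Suc (Suc 0))" and ?y = "Var (Suc 0)"
  let ?s = "id_trans (g\<langle>?y \<rhd> ?s3\<rangle>) (h\<langle>?y \<rhd> ?s3\<rangle>) (q\<langle>?y \<rhd> ?s3\<rangle>) (ap (g\<langle>lift ?s3\<rangle>) ?x ?y (Var 0))"
  let ?t = "id_trans (h\<langle>?x \<rhd> ?s3\<rangle>) (h\<langle>?y \<rhd> ?s3\<rangle>) (ap (h\<langle>lift ?s3\<rangle>) ?x ?y (Var 0)) (q\<langle>?x \<rhd> ?s3\<rangle>)"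
  note gx = subst_inst_isTm[OF s3 C g vars(1)] and gy = subst_inst_isTm[OF s3 C g vars(2)]
    and hx = subst_inst_isTm[OF s3 C h vars(1)] and hy = subst_inst_isTm[OF s3 C h vars(2)]
  have qx: "ctx_Id A \<Gamma> \<turnstile> isTm (q\<langle>?x \<rhd> ?s3\<rangle>) (Idt (C\<langle>?s3\<rangle>) (g\<langle>?x \<rhd> ?s3\<rangle>) (h\<langle>?x \<rhd> ?s3\<rangle>))"
    and qy: "ctx_Id A \<Gamma> \<turnstile> isTm (q\<langle>?y \<rhd> ?s3\<rangle>) (Idt (C\<langle>?s3\<rangle>) (g\<langle>?y \<rhd> ?s3\<rangle>) (h\<langle>?y \<rhd> ?s3\<rangle>))"
    using subst_isTm[OF q ctx_mor_scons[OF s3 A vars(1)]] subst_isTm[OF q ctx_mor_scons[OF s3 A vars(2)]]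
    by (simp_all add: subst_calculus)
  have s: "ctx_Id A \<Gamma> \<turnstile> isTm ?s (Idt (C\<langle>?s3\<rangle>) (g\<langle>?x \<rhd> ?s3\<rangle>) (h\<langle>?y \<rhd> ?s3\<rangle>))"
    using gx gy hy qy ap_lift_isTm[OF s3 C g vars] by (intro id_trans_isTm)
  have t: "ctx_Id A \<Gamma> \<turnstile> isTm ?t (Idt (C\<langle>?s3\<rangle>) (g\<langle>?x \<rhd> ?s3\<rangle>) (h\<langle>?y \<rhd> ?s3\<rangle>))"
    using gx hx hy qx ap_lift_isTm[OF s3 C h vars] by (intro id_trans_isTm)
  let ?s1 = "\<lambda>i. Var (Suc i)" and ?s2 = "\<lambda>i. Var (Suc (Suc i))"
  have g': "A # \<Gamma> \<turnstile> isTm g (C\<langle>?s1\<rangle>)" and h': "A # \<Gamma> \<turnstile> isTm h (C\<langle>?s1\<rangle>)"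
    and q': "A # \<Gamma> \<turnstile> isTm q (Idt (C\<langle>?s1\<rangle>) g h)"
    using g h q by (simp_all add: ren_eq_subst)
  have apR: "A # \<Gamma> \<turnstile> eqTm (ap (g\<langle>lift ?s1\<rangle>) (Var 0) (Var 0) (Refl (Var 0))) (Refl g) (Idt (C\<langle>?s1\<rangle>) g g)"
    "A # \<Gamma> \<turnstile> eqTm (ap (h\<langle>lift ?s1\<rangle>) (Var 0) (Var 0) (Refl (Var 0))) (Refl h) (Idt (C\<langle>?s1\<rangle>) h h)"
    using ap_lift_Refl[OF wk C g var0[OF A]] ap_lift_Refl[OF wk C h var0[OF A]]
    by (simp_all add: subst_calculus)
  have "A # \<Gamma> \<turnstile> eqTm (id_trans g h q (ap (g\<langle>lift ?s1\<rangle>) (Var 0) (Var 0) (Refl (Var 0))))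
    (id_trans g h q (Refl g)) (Idt (C\<langle>?s1\<rangle>) g h)"
    using g' h' q' apR by (intro id_trans_cong eqTm_refl)
  then have 1: "A # \<Gamma> \<turnstile> eqTm (id_trans g h q (ap (g\<langle>lift ?s1\<rangle>) (Var 0) (Var 0) (Refl (Var 0)))) q
      (Idt (C\<langle>?s1\<rangle>) g h)"
    using id_trans_Refl_right[OF g' h' q'] by (rule eqTm_trans)
  have "A # \<Gamma> \<turnstile> eqTm (id_trans h h (ap (h\<langle>lift ?s1\<rangle>) (Var 0) (Var 0) (Refl (Var 0))) q)
    (id_trans h h (Refl h) q) (Idt (C\<langle>?s1\<rangle>) g h)"
    using g' h' q' apR by (intro id_trans_cong eqTm_refl)
  then have "A # \<Gamma> \<turnstile> eqTm (id_trans h h (ap (h\<langle>lift ?s1\<rangle>) (Var 0) (Var 0) (Refl (Var 0))) q) q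
      (Idt (C\<langle>?s1\<rangle>) g h)"
    using id_trans_Refl_left[OF g' h' q'] by (rule eqTm_trans)
  from eqTm_trans[OF 1 eqTm_sym[OF this]]
  have diag: "A # \<Gamma> \<turnstile> eqTm (?s\<langle>diag\<rangle>) (?t\<langle>diag\<rangle>)
      ((Idt (C\<langle>?s3\<rangle>) (g\<langle>?x \<rhd> ?s3\<rangle>) (h\<langle>?y \<rhd> ?s3\<rangle>))\<langle>diag\<rangle>)"
    by (simp add: id_trans_subst ap_subst subst_calculus)
  from Id_eq_ind[OF gx hy s t diag a b p] show ?thesis
    by (simp add: id_trans_subst ap_subst subst_calculus)
qed

text \<open>Induction on \<open>q\<close>, where the composite computes, with \<open>p\<close> as
  the telescope variable. At reflexivity both sides become \<open>ap h\<close> of that variable,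
  named \<open>?e\<close> in the proof.\<close>

lemma ap_id_trans:
  assumes C: "\<Gamma> \<turnstile> isTy C" and h: "A # \<Gamma> \<turnstile> isTm h (wk C)"
    and a: "\<Gamma> \<turnstile> isTm a A" and b: "\<Gamma> \<turnstile> isTm b A" and c: "\<Gamma> \<turnstile> isTm c A"
    and p: "\<Gamma> \<turnstile> isTm p (Idt A a b)" and q: "\<Gamma> \<turnstile> isTm q (Idt A b c)"
  shows "\<Gamma> \<turnstile> eqTm (ap h a c (id_trans b c q p))
    (id_trans (h\<langle>b \<rhd> Var\<rangle>) (h\<langle>c \<rhd> Var\<rangle>) (ap h b c q) (ap h a b p))
    (Idt C (h\<langle>a \<rhd> Var\<rangle>) (h\<langle>c \<rhd> Var\<rangle>))"
proof -
  let ?s2 = "\<lambda>i. Var (Suc (Suc i))" and ?s4 = "\<lambda>i. Var (Suc (Suc (Suc (Suc i))))"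
  let ?x = "Var (Suc (Suc (Suc 0)))" and ?y = "Var (Suc (Suc 0))" and ?z = "Var (Suc 0)"
  note vars = ctx_comp_vars[OF a] and wk = ctx_mor_wk_comp_ctx[OF a]
  note a4 = subst_isTm[OF a wk]
  let ?s = "ap (h\<langle>lift ?s4\<rangle>) (a\<langle>?s4\<rangle>) ?y (id_trans ?x ?y ?z (Var 0))"
  let ?t = "id_trans (h\<langle>?x \<rhd> ?s4\<rangle>) (h\<langle>?y \<rhd> ?s4\<rangle>) (ap (h\<langle>lift ?s4\<rangle>) ?x ?y ?z)
    (ap (h\<langle>lift ?s4\<rangle>) (a\<langle>?s4\<rangle>) ?x (Var 0))"
  note ha = subst_inst_isTm[OF wk C h a4] and hx = subst_inst_isTm[OF wk C h vars(1)]
    and hy = subst_inst_isTm[OF wk C h vars(2)]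
  have s: "ctx_comp A a \<Gamma> \<turnstile> isTm ?s (Idt (C\<langle>?s4\<rangle>) (h\<langle>a\<langle>?s4\<rangle> \<rhd> ?s4\<rangle>) (h\<langle>?y \<rhd> ?s4\<rangle>))"
    using a4 vars by (intro ap_lift_isTm[OF wk C h] id_trans_isTm)
  have t: "ctx_comp A a \<Gamma> \<turnstile> isTm ?t (Idt (C\<langle>?s4\<rangle>) (h\<langle>a\<langle>?s4\<rangle> \<rhd> ?s4\<rangle>) (h\<langle>?y \<rhd> ?s4\<rangle>))"
    using a4 vars ha hx hy by (intro ap_lift_isTm[OF wk C h] id_trans_isTm)
  note vars' = ctx_comp_diag_vars[OF a] and wk' = ctx_mor_wk_comp_diag[OF a]
  note a' = subst_isTm[OF a wk']
  have A: "\<Gamma> \<turnstile> isTy A"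
    using a tm_valid by blast
  note C' = subst_isTy[OF C wk']
    and ha' = subst_inst_isTm[OF wk' C h a'] and hz' = subst_inst_isTm[OF wk' C h vars'(1)]
  have h': "A\<langle>?s2\<rangle> # ctx_comp_diag A a \<Gamma> \<turnstile> isTm (h\<langle>lift ?s2\<rangle>) (wk (C\<langle>?s2\<rangle>))"
    using subst_isTm[OF h ctx_mor_lift[OF wk' A refl]] by (simp add: subst_calculus)
  let ?e = "ap (h\<langle>lift ?s2\<rangle>) (a\<langle>?s2\<rangle>) ?z (Var 0)"
  have e: "ctx_comp_diag A a \<Gamma> \<turnstile> isTm ?e (Idt (C\<langle>?s2\<rangle>) (h\<langle>a\<langle>?s2\<rangle> \<rhd> ?s2\<rangle>) (h\<langle>?z \<rhd> ?s2\<rangle>))"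
    using a' vars' by (intro ap_lift_isTm[OF wk' C h])
  have 1: "ctx_comp_diag A a \<Gamma> \<turnstile> eqTm
      (ap (h\<langle>lift ?s2\<rangle>) (a\<langle>?s2\<rangle>) ?z (id_trans ?z ?z (Refl ?z) (Var 0))) ?e
      (Idt (C\<langle>?s2\<rangle>) (h\<langle>lift ?s2\<rangle>\<langle>a\<langle>?s2\<rangle> \<rhd> Var\<rangle>) (h\<langle>lift ?s2\<rangle>\<langle>?z \<rhd> Var\<rangle>))"
    using C' h' a' vars' by (intro ap_cong[OF C'] eqTm_refl id_trans_Refl_left)
  have 2: "ctx_comp_diag A a \<Gamma> \<turnstile> eqTm
      (id_trans (h\<langle>?z \<rhd> ?s2\<rangle>) (h\<langle>?z \<rhd> ?s2\<rangle>) (ap (h\<langle>lift ?s2\<rangle>) ?z ?z (Refl ?z)) ?e)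
      (id_trans (h\<langle>?z \<rhd> ?s2\<rangle>) (h\<langle>?z \<rhd> ?s2\<rangle>) (Refl (h\<langle>?z \<rhd> ?s2\<rangle>)) ?e)
      (Idt (C\<langle>?s2\<rangle>) (h\<langle>a\<langle>?s2\<rangle> \<rhd> ?s2\<rangle>) (h\<langle>?z \<rhd> ?s2\<rangle>))"
    using ha' hz' e vars' by (intro id_trans_cong eqTm_refl ap_lift_Refl[OF wk' C h])
  have 3: "ctx_comp_diag A a \<Gamma> \<turnstile> eqTm
      (id_trans (h\<langle>?z \<rhd> ?s2\<rangle>) (h\<langle>?z \<rhd> ?s2\<rangle>) (Refl (h\<langle>?z \<rhd> ?s2\<rangle>)) ?e) ?e
      (Idt (C\<langle>?s2\<rangle>) (h\<langle>a\<langle>?s2\<rangle> \<rhd> ?s2\<rangle>) (h\<langle>?z \<rhd> ?s2\<rangle>))"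
    using ha' hz' e by (intro id_trans_Refl_left)
  have diag: "ctx_comp_diag A a \<Gamma> \<turnstile> eqTm (?s\<langle>diag_comp\<rangle>) (?t\<langle>diag_comp\<rangle>)
      ((Idt (C\<langle>?s4\<rangle>) (h\<langle>a\<langle>?s4\<rangle> \<rhd> ?s4\<rangle>) (h\<langle>?y \<rhd> ?s4\<rangle>))\<langle>diag_comp\<rangle>)"
    using 1 eqTm_sym[OF eqTm_trans[OF 2 3]]
    by (auto simp: id_trans_subst ap_subst subst_calculus intro: eqTm_trans)
  from comp_eq_ind[OF ha hy s t diag b c q p] show ?thesis
    by (simp add: id_trans_subst ap_subst subst_calculus)
qed

section \<open>Function extensionality\<close>

text \<open>Evaluation at a fixed \<open>a\<close>, as a map out of the \<Pi>-type. Once the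
  argument is fixed the codomain no longer depends on the function, and this makes
  \<open>happly\<close> an instance of the non-dependent \<open>ap\<close>.\<close>

lemma happly_hom:
  assumes B: "A # \<Gamma> \<turnstile> isTy B" and a: "\<Gamma> \<turnstile> isTm a A"
  shows "Pi A B # \<Gamma> \<turnstile> isTm (App (Var 0) (wk a)) (wk (B\<langle>a \<rhd> Var\<rangle>))"
proof -
  have A: "\<Gamma> \<turnstile> isTy A"
    using B ctx_valid_Cons by blast
  have P: "\<Gamma> \<turnstile> isTy (Pi A B)"
    using A B by (rule Pi_form)
  note wk = ctx_mor_wk[OF ctx_valid[OF P] P]
  have "A\<langle>\<lambda>i. Var (Suc i)\<rangle> # Pi A B # \<Gamma> \<turnstile> isTy (B\<langle>lift (\<lambda>i. Var (Suc i))\<rangle>)"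
    using subst_isTy[OF B ctx_mor_lift[OF wk A refl]] by (simp add: lift_eq)
  from App_elim[OF this _ subst_isTm[OF a wk]] var0[OF P] show ?thesis
    by (simp add: subst_calculus)
qed

text \<open>The generic argument \<open>Var 0\<close> already lives in \<open>A # \<Gamma>\<close>;
  so \<open>B\<close> is pulled back to a second copy of \<open>A\<close>, and evaluating there at
  the first copy restores \<open>B\<close>.\<close>

lemma happly_Refl:
  assumes B: "A # \<Gamma> \<turnstile> isTy B" and m: "\<Gamma> \<turnstile> isTm m (Pi A B)"
  shows "A # \<Gamma> \<turnstile> eqTm (happly (wk m) (wk m) (Refl (wk m)) (Var 0)) (Refl (App (wk m) (Var 0)))
    (Idt B (App (wk m) (Var 0)) (App (wk m) (Var 0)))"
proof -
  have A: "\<Gamma> \<turnstile> isTy A"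
    using B ctx_valid_Cons by blast
  note wk = ctx_mor_wk[OF ctx_valid[OF A] A]
  have B': "A\<langle>\<lambda>i. Var (Suc i)\<rangle> # A # \<Gamma> \<turnstile> isTy (B\<langle>lift (\<lambda>i. Var (Suc i))\<rangle>)"
    using subst_isTy[OF B ctx_mor_lift[OF wk A refl]] by (simp add: lift_eq)
  have m': "A # \<Gamma> \<turnstile> isTm (m\<langle>\<lambda>i. Var (Suc i)\<rangle>) (Pi (A\<langle>\<lambda>i. Var (Suc i)\<rangle>) (B\<langle>lift (\<lambda>i. Var (Suc i))\<rangle>))"
    using subst_isTm[OF m wk] by simp
  show ?thesis
    using ap_Refl[OF _ happly_hom[OF B' var0[OF A]] m'] B by (simp add: happly_eq_ap subst_calculus)
qed

lemma happly_cong: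
  assumes B: "A # \<Gamma> \<turnstile> isTy B" and m: "\<Gamma> \<turnstile> isTm m (Pi A B)" and n: "\<Gamma> \<turnstile> isTm n (Pi A B)"
    and p: "\<Gamma> \<turnstile> eqTm p q (Idt (Pi A B) m n)"
  shows "A # \<Gamma> \<turnstile> eqTm (happly (wk m) (wk n) (wk p) (Var 0)) (happly (wk m) (wk n) (wk q) (Var 0))
    (Idt B (App (wk m) (Var 0)) (App (wk n) (Var 0)))"
proof -
  have A: "\<Gamma> \<turnstile> isTy A"
    using B ctx_valid_Cons by blast
  note wk = ctx_mor_wk[OF ctx_valid[OF A] A]
  let ?P = "Pi (A\<langle>\<lambda>i. Var (Suc i)\<rangle>) (B\<langle>lift (\<lambda>i. Var (Suc i))\<rangle>)"
  have B': "A\<langle>\<lambda>i. Var (Suc i)\<rangle> # A # \<Gamma> \<turnstile> isTy (B\<langle>lift (\<lambda>i. Var (Suc i))\<rangle>)"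
    using subst_isTy[OF B ctx_mor_lift[OF wk A refl]] by (simp add: lift_eq)
  have m': "A # \<Gamma> \<turnstile> isTm (m\<langle>\<lambda>i. Var (Suc i)\<rangle>) ?P" "A # \<Gamma> \<turnstile> isTm (n\<langle>\<lambda>i. Var (Suc i)\<rangle>) ?P"
    and p': "A # \<Gamma> \<turnstile> eqTm (p\<langle>\<lambda>i. Var (Suc i)\<rangle>) (q\<langle>\<lambda>i. Var (Suc i)\<rangle>)
      (Idt ?P (m\<langle>\<lambda>i. Var (Suc i)\<rangle>) (n\<langle>\<lambda>i. Var (Suc i)\<rangle>))"
    using subst_isTm[OF m wk] subst_isTm[OF n wk] subst_eqTm[OF p wk] by simp_all
  from ap_cong[OF _ eqTm_refl[OF happly_hom[OF B' var0[OF A]]] m'[THEN eqTm_refl] p'] B show ?thesis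
    by (simp add: happly_eq_ap subst_calculus)
qed

text \<open>Induction on \<open>p\<close>: at reflexivity \<open>happly\<close> computes to
  pointwise reflexivity, and what is left is the rule \<open>Ext_refl\<close>. So \<open>Ext\<close>
  is inverse to \<open>happly\<close> on this side as well, \<open>Ext_app\<close> being the
  other.\<close>

lemma Ext_happly:
  assumes B: "A # \<Gamma> \<turnstile> isTy B" and m: "\<Gamma> \<turnstile> isTm m (Pi A B)" and n: "\<Gamma> \<turnstile> isTm n (Pi A B)"
    and p: "\<Gamma> \<turnstile> isTm p (Idt (Pi A B) m n)"
  shows "\<Gamma> \<turnstile> eqTm (Ext m n (happly (wk m) (wk n) (wk p) (Var 0))) p (Idt (Pi A B) m n)"
proof -
  have A: "\<Gamma> \<turnstile> isTy A"
    using B ctx_valid_Cons by blast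
  have P: "\<Gamma> \<turnstile> isTy (Pi A B)"
    using A B by (rule Pi_form)
  note vars = ctx_Id_vars[OF P] and s3 = ctx_mor_wk_Id[OF P]
  let ?s3 = "\<lambda>i. Var (Suc (Suc (Suc i)))"
  let ?x = "Var (Suc (Suc 0))" and ?y = "Var (Suc 0)"
  let ?s = "Ext ?x ?y (happly (wk ?x) (wk ?y) (wk (Var 0)) (Var 0))"
  have B3: "A\<langle>?s3\<rangle> # ctx_Id (Pi A B) \<Gamma> \<turnstile> isTy (B\<langle>lift ?s3\<rangle>)"
    using subst_isTy[OF B ctx_mor_lift[OF s3 A refl]] by (simp add: lift_eq)
  have vars':
    "ctx_Id (Pi A B) \<Gamma> \<turnstile> isTm ?x (Pi (A\<langle>?s3\<rangle>) (B\<langle>lift ?s3\<rangle>))"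
    "ctx_Id (Pi A B) \<Gamma> \<turnstile> isTm ?y (Pi (A\<langle>?s3\<rangle>) (B\<langle>lift ?s3\<rangle>))"
    "ctx_Id (Pi A B) \<Gamma> \<turnstile> isTm (Var 0) (Idt (Pi (A\<langle>?s3\<rangle>) (B\<langle>lift ?s3\<rangle>)) ?x ?y)"
    using vars by simp_all
  have s: "ctx_Id (Pi A B) \<Gamma> \<turnstile> isTm ?s (Idt (Pi (A\<langle>?s3\<rangle>) (B\<langle>lift ?s3\<rangle>)) ?x ?y)"
    using happly_cong[OF B3 vars'(1,2) eqTm_refl[OF vars'(3)]] eqTm_valid
    by (intro Ext_intro B3 vars') blast
  let ?s1 = "\<lambda>i. Var (Suc i)"
  have wk: "ctx_mor S (Pi A B # \<Gamma>) ?s1 \<Gamma>"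
    using ctx_mor_wk[OF ctx_valid[OF P] P] .
  have B1: "A\<langle>?s1\<rangle> # Pi A B # \<Gamma> \<turnstile> isTy (B\<langle>lift ?s1\<rangle>)"
    using subst_isTy[OF B ctx_mor_lift[OF wk A refl]] by (simp add: lift_eq)
  have x: "Pi A B # \<Gamma> \<turnstile> isTm (Var 0) (Pi (A\<langle>?s1\<rangle>) (B\<langle>lift ?s1\<rangle>))"
    using var0[OF P] by simp
  have "Pi A B # \<Gamma> \<turnstile> eqTm
      (Ext (Var 0) (Var 0) (happly (wk (Var 0)) (wk (Var 0)) (Refl (wk (Var 0))) (Var 0)))
      (Ext (Var 0) (Var 0) (Refl (App (wk (Var 0)) (Var 0))))
      (Idt (Pi (A\<langle>?s1\<rangle>) (B\<langle>lift ?s1\<rangle>)) (Var 0) (Var 0))"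
    using B1 x happly_Refl[OF B1 x] by (intro Ext_cong eqTm_refl)
  then have "Pi A B # \<Gamma> \<turnstile> eqTm
      (Ext (Var 0) (Var 0) (happly (wk (Var 0)) (wk (Var 0)) (Refl (wk (Var 0))) (Var 0)))
      (Refl (Var 0)) (Idt (Pi (A\<langle>?s1\<rangle>) (B\<langle>lift ?s1\<rangle>)) (Var 0) (Var 0))"
    using Ext_refl[OF B1 x] by (rule eqTm_trans)
  then have diag: "Pi A B # \<Gamma> \<turnstile> eqTm (?s\<langle>diag\<rangle>) ((Var 0)\<langle>diag\<rangle>)
      ((Idt (Pi (A\<langle>?s3\<rangle>) (B\<langle>lift ?s3\<rangle>)) ?x ?y)\<langle>diag\<rangle>)"
    by (simp add: happly_def subst_calculus)
  from Id_eq_ind[OF vars'(1,2) s vars'(3) diag m n p] show ?thesis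
    by (simp add: happly_def subst_calculus)
qed

lemma happly_inject:
  assumes B: "A # \<Gamma> \<turnstile> isTy B" and m: "\<Gamma> \<turnstile> isTm m (Pi A B)" and n: "\<Gamma> \<turnstile> isTm n (Pi A B)"
    and p: "\<Gamma> \<turnstile> isTm p (Idt (Pi A B) m n)" and q: "\<Gamma> \<turnstile> isTm q (Idt (Pi A B) m n)"
    and eq: "A # \<Gamma> \<turnstile> eqTm (happly (wk m) (wk n) (wk p) (Var 0)) (happly (wk m) (wk n) (wk q) (Var 0))
      (Idt B (App (wk m) (Var 0)) (App (wk n) (Var 0)))"
  shows "\<Gamma> \<turnstile> eqTm p q (Idt (Pi A B) m n)"
  using eqTm_trans[OF eqTm_sym[OF Ext_happly[OF B m n p]]
      eqTm_trans[OF Ext_cong[OF B eqTm_refl[OF m] eqTm_refl[OF n] eq] Ext_happly[OF B m n q]]] .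

end

section \<open>Surjective equivalences\<close>

lemma is_functor_comp:
  assumes "is_functor C D F Fa" "is_functor D E G Ga"
  shows "is_functor C E (\<lambda>a. G (F a)) (\<lambda>a b u. Ga (F a) (F b) (Fa a b u))"
  using assms unfolding is_functor_def by (intro conjI ballI) auto

text \<open>The functor laws of \<open>I\<close>, the inverses, the naturality of \<theta> and
  \<theta>I = id are equations between parallel arrows of \<open>C\<close>. Faithfulness reduces
  each to its image in \<open>D\<close>, where it is a unit law or holds by the choice of
  lifts.\<close>

lemma surjective_equivalence_if_fully_faithful:
  assumes P: "is_functor C D P Pa"
    and surj: "\<And>d. d \<in> Obj D \<Longrightarrow> \<exists>c \<in> Obj C. P c = d"
    and full: "\<And>a b v. \<lbrakk>a \<in> Obj C; b \<in> Obj C; v \<in> Hom D (P a) (P b)\<rbrakk> \<Longrightarrow> \<exists>u \<in> Hom C a b. Pa a b u = v"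
    and faithful: "\<And>a b u u'. \<lbrakk>a \<in> Obj C; b \<in> Obj C; u \<in> Hom C a b; u' \<in> Hom C a b;
      Pa a b u = Pa a b u'\<rbrakk> \<Longrightarrow> u = u'"
  shows "surjective_equivalence C D P Pa"
proof -
  have C: "category C" and D: "category D"
    using P by (simp_all add: is_functor_def)
  have P_Obj: "P a \<in> Obj D" if "a \<in> Obj C" for a
    using P that by (simp add: is_functor_def)
  have P_Hom: "Pa a b u \<in> Hom D (P a) (P b)" if "a \<in> Obj C" "b \<in> Obj C" "u \<in> Hom C a b" for a b u
    using P that by (simp add: is_functor_def)
  have P_Idn: "Pa a a (Idn C a) = Idn D (P a)" if "a \<in> Obj C" for a
    using P that by (simp add: is_functor_def)
  have P_Cmp: "Pa a c (Cmp C a b c v u) = Cmp D (P a) (P b) (P c) (Pa b c v) (Pa a b u)"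
    if "a \<in> Obj C" "b \<in> Obj C" "c \<in> Obj C" "u \<in> Hom C a b" "v \<in> Hom C b c" for a b c u v
    using P that by (simp add: is_functor_def)
  have C_Idn: "Idn C a \<in> Hom C a a" if "a \<in> Obj C" for a
    using C that by (simp add: category_def)
  have C_Cmp: "Cmp C a b c v u \<in> Hom C a c"
    if "a \<in> Obj C" "b \<in> Obj C" "c \<in> Obj C" "u \<in> Hom C a b" "v \<in> Hom C b c" for a b c u v
    using C that by (simp add: category_def)
  have D_Idn: "Idn D a \<in> Hom D a a" if "a \<in> Obj D" for a
    using D that by (simp add: category_def)
  have D_Cmp: "Cmp D a b c v u \<in> Hom D a c"
    if "a \<in> Obj D" "b \<in> Obj D" "c \<in> Obj D" "u \<in> Hom D a b" "v \<in> Hom D b c" for a b c u v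
    using D that by (simp add: category_def)
  have D_unit: "Cmp D a a b u (Idn D a) = u" "Cmp D a b b (Idn D b) u = u"
    if "a \<in> Obj D" "b \<in> Obj D" "u \<in> Hom D a b" for a b u
    using D that by (simp_all add: category_def)
  obtain I where I: "I d \<in> Obj C" "P (I d) = d" if "d \<in> Obj D" for d
    using surj by metis
  obtain L where L: "L a b v \<in> Hom C a b" "Pa a b (L a b v) = v"
    if "a \<in> Obj C" "b \<in> Obj C" "v \<in> Hom D (P a) (P b)" for a b v
    using full by metis
  define Ia where "Ia d e v = L (I d) (I e) v" for d e v
  \<comment> \<open>The objects \<open>a\<close> and \<open>I (P a)\<close> have the same image, so
    the identity of \<open>P a\<close> is an arrow between their images; lifting it makes P\<theta>
    = id true by construction.\<close>
  define \<theta> where "\<theta> a = L a (I (P a)) (Idn D (P a))" for a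
  have Ia: "Ia d e v \<in> Hom C (I d) (I e)" "Pa (I d) (I e) (Ia d e v) = v"
    if "d \<in> Obj D" "e \<in> Obj D" "v \<in> Hom D d e" for d e v
    using that I L by (simp_all add: Ia_def)
  have IP: "I (P a) \<in> Obj C" "P (I (P a)) = P a" if "a \<in> Obj C" for a
    using that I P_Obj by auto
  have \<theta>: "\<theta> a \<in> Hom C a (I (P a))" "Pa a (I (P a)) (\<theta> a) = Idn D (P a)" if "a \<in> Obj C" for a
    using that IP L D_Idn P_Obj by (simp_all add: \<theta>_def)
  have "is_functor D C I Ia"
    unfolding is_functor_def
  proof (intro conjI ballI)
    fix d assume d: "d \<in> Obj D"
    then show "Ia d d (Idn D d) = Idn C (I d)"
      by (intro faithful[of "I d" "I d"]) (simp_all add: I Ia D_Idn C_Idn P_Idn)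
  next
    fix d e f u v
    assume "d \<in> Obj D" "e \<in> Obj D" "f \<in> Obj D" "u \<in> Hom D d e" "v \<in> Hom D e f"
    then show "Ia d f (Cmp D d e f v u) = Cmp C (I d) (I e) (I f) (Ia e f v) (Ia d e u)"
      by (intro faithful[of "I d" "I f"]) (simp_all add: I Ia D_Cmp C_Cmp P_Cmp)
  qed (simp_all add: C D I Ia)
  moreover have "is_iso C a (I (P a)) (\<theta> a)" if a: "a \<in> Obj C" for a
  proof -
    \<comment> \<open>The inverse lifts the same identity in the opposite direction.\<close>
    let ?v = "L (I (P a)) a (Idn D (P a))"
    have v: "?v \<in> Hom C (I (P a)) a" "Pa (I (P a)) a ?v = Idn D (P a)"
      using a IP L D_Idn P_Obj by simp_all
    have "Cmp C a (I (P a)) a ?v (\<theta> a) = Idn C a"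
      by (intro faithful[of a a]) (simp_all add: a v \<theta> IP C_Cmp C_Idn P_Cmp P_Idn D_unit D_Idn P_Obj)
    moreover have "Cmp C (I (P a)) a (I (P a)) (\<theta> a) ?v = Idn C (I (P a))"
      by (intro faithful[of "I (P a)" "I (P a)"])
        (simp_all add: a v \<theta> IP C_Cmp C_Idn P_Cmp P_Idn D_unit D_Idn P_Obj)
    ultimately show ?thesis
      using \<theta>[OF a] v unfolding is_iso_def by blast
  qed
  moreover have "Cmp C a b (I (P b)) (\<theta> b) u = Cmp C a (I (P a)) (I (P b)) (Ia (P a) (P b) (Pa a b u)) (\<theta> a)"
    if "a \<in> Obj C" "b \<in> Obj C" "u \<in> Hom C a b" for a b u
    using that
    by (intro faithful[of a "I (P b)"]) (simp_all add: \<theta> IP Ia C_Cmp P_Cmp P_Obj P_Hom D_unit)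
  moreover have "\<theta> (I d) = Idn C (I d)" if "d \<in> Obj D" for d
    using that \<theta>[of "I d"] by (intro faithful[of "I d" "I d"]) (simp_all add: I C_Idn P_Idn)
  ultimately show ?thesis
    unfolding surjective_equivalence_def natural_iso_def
    using P I Ia \<theta> by (intro conjI exI[of _ I] exI[of _ Ia] exI[of _ \<theta>]) auto
qed

section \<open>Classes of types and terms modulo definitional equality\<close>

context dependent_type_theory
begin

lemma subst_cong:
  assumes "\<Delta> \<turnstile> eqTm t t' A" "ctx_mor_eq S \<Gamma> \<sigma> \<tau> \<Delta>"
  shows "\<Gamma> \<turnstile> eqTm (t\<langle>\<sigma>\<rangle>) (t'\<langle>\<tau>\<rangle>) (A\<langle>\<sigma>\<rangle>)"
  using assms substitution_eqTm[of \<Gamma> \<sigma> \<tau> \<Delta> t' A] subst_eqTm[of \<Delta> t t' A \<Gamma> \<sigma>] eqTm_valid eqTm_trans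
  unfolding ctx_mor_eq_def by metis

lemma ty_clsD: "A' \<in> ty_cls S \<Gamma> A \<Longrightarrow> \<Gamma> \<turnstile> eqTy A A'"
  by (simp add: ty_cls_def)

lemma tm_clsD: "a' \<in> tm_cls S \<Gamma> A a \<Longrightarrow> \<Gamma> \<turnstile> eqTm a a' A"
  by (simp add: tm_cls_def)

lemma ty_cls_eqI: "\<Gamma> \<turnstile> eqTy A A' \<Longrightarrow> ty_cls S \<Gamma> A' = ty_cls S \<Gamma> A"
  unfolding ty_cls_def using eqTy_sym eqTy_trans by blast

lemma tm_cls_eqI: "\<Gamma> \<turnstile> eqTm a a' A \<Longrightarrow> tm_cls S \<Gamma> A a' = tm_cls S \<Gamma> A a"
  unfolding tm_cls_def using eqTm_sym eqTm_trans by blast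

lemma tm_cls_eqD: "\<lbrakk>tm_cls S \<Gamma> A a = tm_cls S \<Gamma> A a'; \<Gamma> \<turnstile> isTm a' A\<rbrakk> \<Longrightarrow> \<Gamma> \<turnstile> eqTm a a' A"
  unfolding tm_cls_def using eqTm_refl by blast

lemma tm_cls_conv: "\<Gamma> \<turnstile> eqTy A A' \<Longrightarrow> tm_cls S \<Gamma> A' a = tm_cls S \<Gamma> A a"
  unfolding tm_cls_def using eqTy_sym conv_eq by blast

lemma tm_cls_ctx_conv: "\<Gamma> \<turnstile> eqTy A A' \<Longrightarrow> tm_cls S (A' # \<Gamma>) = tm_cls S (A # \<Gamma>)"
  unfolding tm_cls_def by (simp add: fun_eq_iff ctx_conv)

lemma tms_ctx_conv: "\<Gamma> \<turnstile> eqTy A A' \<Longrightarrow> tms S (A' # \<Gamma>) = tms S (A # \<Gamma>)"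
  unfolding tms_def by (simp add: fun_eq_iff ctx_conv tm_cls_ctx_conv)

lemma tms_conv: "\<Gamma> \<turnstile> eqTy A A' \<Longrightarrow> tms S \<Gamma> A' = tms S \<Gamma> A"
  unfolding tms_def using eqTy_sym conv by (auto simp: tm_cls_conv)

lemma ty_cls_self: "\<Gamma> \<turnstile> isTy A \<Longrightarrow> A \<in> ty_cls S \<Gamma> A"
  by (simp add: ty_cls_def eqTy_refl)

lemma tm_cls_self: "\<Gamma> \<turnstile> isTm a A \<Longrightarrow> a \<in> tm_cls S \<Gamma> A a"
  by (simp add: tm_cls_def eqTm_refl)

lemma wk_isTy: "\<lbrakk>\<Gamma> \<turnstile> isTy A; \<Gamma> \<turnstile> isTy B\<rbrakk> \<Longrightarrow> A # \<Gamma> \<turnstile> isTy (wk B)"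
  and wk_eqTy: "\<lbrakk>\<Gamma> \<turnstile> isTy A; \<Gamma> \<turnstile> eqTy B B'\<rbrakk> \<Longrightarrow> A # \<Gamma> \<turnstile> eqTy (wk B) (wk B')"
  by (auto simp: ren_eq_subst intro: subst_isTy subst_eqTy ctx_mor_wk ctx_valid)

end

section \<open>The 2-category of types in a context\<close>

text \<open>The operations of \<open>T\<close> and \<open>weakening\<close> are unions over all
  representatives. This rule reduces computing them to independence of the representatives, and the
  \<open>_cls\<close> lemmas below rest on it.\<close>

lemma UN_eqI: "\<lbrakk>a \<in> X; \<And>x. x \<in> X \<Longrightarrow> F x = c\<rbrakk> \<Longrightarrow> (\<Union>x \<in> X. F x) = c"
  by auto

context ml2
begin

section \<open>Representatives of 1-cells and 2-cells\<close>

definition arr :: "'c ctx \<Rightarrow> 'c exp \<Rightarrow> 'c exp \<Rightarrow> 'c exp \<Rightarrow> bool" where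
  "arr \<Gamma> A B f \<longleftrightarrow> \<Gamma> \<turnstile> isTy A \<and> \<Gamma> \<turnstile> isTy B \<and> A # \<Gamma> \<turnstile> isTm f (wk B)"

definition cell :: "'c ctx \<Rightarrow> 'c exp \<Rightarrow> 'c exp \<Rightarrow> 'c exp \<Rightarrow> 'c exp \<Rightarrow> 'c exp \<Rightarrow> bool" where
  "cell \<Gamma> A B f g p \<longleftrightarrow> arr \<Gamma> A B f \<and> arr \<Gamma> A B g \<and> A # \<Gamma> \<turnstile> isTm p (Idt (wk B) f g)"

abbreviation arr_cls :: "'c ctx \<Rightarrow> 'c exp \<Rightarrow> 'c exp \<Rightarrow> 'c exp \<Rightarrow> 'c exp set" where
  "arr_cls \<Gamma> A B f \<equiv> tm_cls S (A # \<Gamma>) (wk B) f"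

abbreviation cell_cls :: "'c ctx \<Rightarrow> 'c exp \<Rightarrow> 'c exp \<Rightarrow> 'c exp \<Rightarrow> 'c exp \<Rightarrow> 'c exp \<Rightarrow> 'c exp set" where
  "cell_cls \<Gamma> A B f g p \<equiv> tm_cls S (A # \<Gamma>) (Idt (wk B) f g) p"

lemma arrD: "arr \<Gamma> A B f \<Longrightarrow> \<Gamma> \<turnstile> isTy A" "arr \<Gamma> A B f \<Longrightarrow> \<Gamma> \<turnstile> isTy B"
  "arr \<Gamma> A B f \<Longrightarrow> A # \<Gamma> \<turnstile> isTm f (wk B)"
  by (simp_all add: arr_def)

lemma cellD: "cell \<Gamma> A B f g p \<Longrightarrow> arr \<Gamma> A B f" "cell \<Gamma> A B f g p \<Longrightarrow> arr \<Gamma> A B g"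
  "cell \<Gamma> A B f g p \<Longrightarrow> A # \<Gamma> \<turnstile> isTm p (Idt (wk B) f g)"
  by (simp_all add: cell_def)

lemma arr_id: "\<Gamma> \<turnstile> isTy A \<Longrightarrow> arr \<Gamma> A A (Var 0)"
  using var0 by (simp add: arr_def ren_eq_subst)

lemma ctx_mor_cmp_sub:
  assumes "arr \<Gamma> A B f"
  shows "ctx_mor S (A # \<Gamma>) (cmp_sub f) (B # \<Gamma>)"
  using assms ctx_valid unfolding cmp_sub_def arr_def
  by (intro ctx_mor_scons ctx_mor_wk) (auto simp: subst_calculus)

lemma ctx_mor_eq_cmp_sub:
  assumes "arr \<Gamma> A B f" "A # \<Gamma> \<turnstile> eqTm f f' (wk B)"
  shows "ctx_mor_eq S (A # \<Gamma>) (cmp_sub f) (cmp_sub f') (B # \<Gamma>)"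
  using assms ctx_valid unfolding cmp_sub_def arr_def
  by (intro ctx_mor_eq_scons ctx_mor_eq_refl ctx_mor_wk) (auto simp: subst_calculus)

lemma arr_comp: "\<lbrakk>arr \<Gamma> A B f; arr \<Gamma> B C g\<rbrakk> \<Longrightarrow> arr \<Gamma> A C (g\<langle>cmp_sub f\<rangle>)"
  using subst_isTm[of "B # \<Gamma>" g "wk C", OF _ ctx_mor_cmp_sub]
  by (auto simp: arr_def subst_calculus)

lemma cell_refl: "arr \<Gamma> A B f \<Longrightarrow> cell \<Gamma> A B f f (Refl f)"
  by (simp add: cell_def arr_def Refl_intro)

lemma cell_trans: "\<lbrakk>cell \<Gamma> A B f g p; cell \<Gamma> A B g h q\<rbrakk> \<Longrightarrow> cell \<Gamma> A B f h (id_trans g h q p)"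
  by (auto simp: cell_def arr_def intro: id_trans_isTm)

text \<open>Serves twice: as the action of weakening on 1-cells, and in left whiskering, where
  \<open>ap\<close> is formed in context \<open>A # \<Gamma>\<close> and \<open>h\<close> must first
  be weakened to it.\<close>

lemma wk_arr:
  assumes h: "arr \<Gamma> B C h" and A: "\<Gamma> \<turnstile> isTy A"
  shows "arr (A # \<Gamma>) (wk B) (wk C) (ren h (up Suc))"
  using h wk_isTy A subst_isTm[OF _ ctx_mor_lift[OF ctx_mor_wk[OF ctx_valid[OF A] A] _ refl], of B h "wk C"]
  by (simp add: arr_def subst_calculus)

lemma cell_whl:
  assumes h: "arr \<Gamma> B C h" and p: "cell \<Gamma> A B f g p"
  shows "cell \<Gamma> A C (h\<langle>cmp_sub f\<rangle>) (h\<langle>cmp_sub g\<rangle>) (ap (ren h (up Suc)) f g p)"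
proof -
  have "A # \<Gamma> \<turnstile> isTm (ap (ren h (up Suc)) f g p)
    (Idt (wk C) ((ren h (up Suc))\<langle>f \<rhd> Var\<rangle>) ((ren h (up Suc))\<langle>g \<rhd> Var\<rangle>))"
    using wk_arr[OF h, of A] p by (intro ap_isTm) (auto simp: cell_def arr_def)
  then show ?thesis
    using arr_comp[OF _ h] p by (simp add: cell_def subst_calculus)
qed

lemma cell_whr:
  assumes f: "arr \<Gamma> A B f" and q: "cell \<Gamma> B C g h q"
  shows "cell \<Gamma> A C (g\<langle>cmp_sub f\<rangle>) (h\<langle>cmp_sub f\<rangle>) (q\<langle>cmp_sub f\<rangle>)"
  using q arr_comp[OF f] subst_isTm[OF cellD(3)[OF q] ctx_mor_cmp_sub[OF f]]
  by (simp add: cell_def subst_calculus)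

lemma wk_cell:
  assumes p: "cell \<Gamma> B C f g p" and A: "\<Gamma> \<turnstile> isTy A"
  shows "cell (A # \<Gamma>) (wk B) (wk C) (ren f (up Suc)) (ren g (up Suc)) (ren p (up Suc))"
  unfolding cell_def
  using subst_isTm[OF cellD(3)[OF p] ctx_mor_lift[OF ctx_mor_wk[OF ctx_valid[OF A] A] arrD(1)[OF cellD(1)[OF p]] refl]]
  by (intro conjI wk_arr[OF cellD(1)[OF p] A] wk_arr[OF cellD(2)[OF p] A]) (simp add: subst_calculus)

lemma Obj_T: "Obj2 (T S \<Gamma>) = ty_cls S \<Gamma> ` {A. \<Gamma> \<turnstile> isTy A}"
  by (auto simp: T_def tys_def)

lemma HomC_T: "HomC (T S \<Gamma>) = T_hom S \<Gamma>"
  by (simp add: T_def)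

section \<open>The operations of the 2-category computed on representatives\<close>

context
  fixes \<Gamma> A B
  assumes A: "\<Gamma> \<turnstile> isTy A" and B: "\<Gamma> \<turnstile> isTy B"
begin

lemma Arr_cls: "Obj (T_hom S \<Gamma> (ty_cls S \<Gamma> A) (ty_cls S \<Gamma> B)) = arr_cls \<Gamma> A B ` {f. arr \<Gamma> A B f}"
proof -
  have "Obj (T_hom S \<Gamma> (ty_cls S \<Gamma> A) (ty_cls S \<Gamma> B)) = tms S (A # \<Gamma>) (wk B)"
    unfolding T_hom_def cat.simps
  proof (rule UN_eqI[OF ty_cls_self[OF A]], rule UN_eqI[OF ty_cls_self[OF B]])
    fix A' B' assume "A' \<in> ty_cls S \<Gamma> A" "B' \<in> ty_cls S \<Gamma> B"
    then show "tms S (A' # \<Gamma>) (wk B') = tms S (A # \<Gamma>) (wk B)"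
      using A by (auto simp: ty_cls_def tms_ctx_conv intro!: tms_conv wk_eqTy)
  qed
  then show ?thesis
    using A B by (auto simp: arr_def tms_def)
qed

lemma Cell_cls:
  assumes f: "arr \<Gamma> A B f" and g: "arr \<Gamma> A B g"
  shows "Hom (T_hom S \<Gamma> (ty_cls S \<Gamma> A) (ty_cls S \<Gamma> B)) (arr_cls \<Gamma> A B f) (arr_cls \<Gamma> A B g)
    = cell_cls \<Gamma> A B f g ` {p. cell \<Gamma> A B f g p}"
proof -
  have "Hom (T_hom S \<Gamma> (ty_cls S \<Gamma> A) (ty_cls S \<Gamma> B)) (arr_cls \<Gamma> A B f) (arr_cls \<Gamma> A B g)
      = tms S (A # \<Gamma>) (Idt (wk B) f g)"
    unfolding T_hom_def cat.simps
  proof (rule UN_eqI[OF ty_cls_self[OF A]], rule UN_eqI[OF ty_cls_self[OF B]],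
      rule UN_eqI[OF tm_cls_self[OF arrD(3)[OF f]]], rule UN_eqI[OF tm_cls_self[OF arrD(3)[OF g]]])
    fix A' B' f' g'
    assume "A' \<in> ty_cls S \<Gamma> A" "B' \<in> ty_cls S \<Gamma> B" "f' \<in> arr_cls \<Gamma> A B f" "g' \<in> arr_cls \<Gamma> A B g"
    then show "tms S (A' # \<Gamma>) (Idt (wk B') f' g') = tms S (A # \<Gamma>) (Idt (wk B) f g)"
      using A by (auto simp: ty_cls_def tm_cls_def tms_ctx_conv intro!: tms_conv Idt_cong wk_eqTy)
  qed
  then show ?thesis
    using f g by (auto simp: cell_def tms_def)
qed

lemma Idn_cls:
  assumes f: "arr \<Gamma> A B f"
  shows "Idn (T_hom S \<Gamma> (ty_cls S \<Gamma> A) (ty_cls S \<Gamma> B)) (arr_cls \<Gamma> A B f) = cell_cls \<Gamma> A B f f (Refl f)"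
  unfolding T_hom_def cat.simps
proof (rule UN_eqI[OF ty_cls_self[OF A]], rule UN_eqI[OF ty_cls_self[OF B]],
    rule UN_eqI[OF tm_cls_self[OF arrD(3)[OF f]]])
  fix A' B' f'
  assume A': "A' \<in> ty_cls S \<Gamma> A" and B': "B' \<in> ty_cls S \<Gamma> B" and f': "f' \<in> arr_cls \<Gamma> A B f"
  \<comment> \<open>A class depends on representatives in three places, which are changed one at a
    time: the type here, then the term, and finally the context by \<open>tm_cls_ctx_conv\<close>.
    The operations below follow the same pattern.\<close>
  have "cell_cls \<Gamma> A B' f' f' (Refl f') = cell_cls \<Gamma> A B f f (Refl f')"
    using A B' f' by (auto dest!: ty_clsD tm_clsD intro!: tm_cls_conv Idt_cong wk_eqTy)
  also have "\<dots> = cell_cls \<Gamma> A B f f (Refl f)"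
    using f' by (intro tm_cls_eqI Refl_cong) (simp add: tm_cls_def)
  finally show "cell_cls \<Gamma> A' B' f' f' (Refl f') = cell_cls \<Gamma> A B f f (Refl f)"
    using A' by (simp add: ty_cls_def tm_cls_ctx_conv)
qed

lemma Cmp_cls:
  assumes p: "cell \<Gamma> A B f g p" and q: "cell \<Gamma> A B g h q"
  shows "Cmp (T_hom S \<Gamma> (ty_cls S \<Gamma> A) (ty_cls S \<Gamma> B)) (arr_cls \<Gamma> A B f) (arr_cls \<Gamma> A B g)
    (arr_cls \<Gamma> A B h) (cell_cls \<Gamma> A B g h q) (cell_cls \<Gamma> A B f g p)
    = cell_cls \<Gamma> A B f h (id_trans g h q p)"
  unfolding T_hom_def cat.simps
proof (rule UN_eqI[OF ty_cls_self[OF A]], rule UN_eqI[OF ty_cls_self[OF B]],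
    rule UN_eqI[OF tm_cls_self[OF arrD(3)[OF cellD(1)[OF p]]]],
    rule UN_eqI[OF tm_cls_self[OF arrD(3)[OF cellD(1)[OF q]]]],
    rule UN_eqI[OF tm_cls_self[OF arrD(3)[OF cellD(2)[OF q]]]],
    rule UN_eqI[OF tm_cls_self[OF cellD(3)[OF q]]], rule UN_eqI[OF tm_cls_self[OF cellD(3)[OF p]]])
  fix A' B' f' g' h' q' p'
  assume A': "A' \<in> ty_cls S \<Gamma> A" and B': "B' \<in> ty_cls S \<Gamma> B" and f': "f' \<in> arr_cls \<Gamma> A B f"
    and g': "g' \<in> arr_cls \<Gamma> A B g" and h': "h' \<in> arr_cls \<Gamma> A B h"
    and q': "q' \<in> cell_cls \<Gamma> A B g h q" and p': "p' \<in> cell_cls \<Gamma> A B f g p"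
  have "cell_cls \<Gamma> A B' f' h' (id_trans g' h' q' p') = cell_cls \<Gamma> A B f h (id_trans g' h' q' p')"
    using A B' f' h' by (auto dest!: ty_clsD tm_clsD intro!: tm_cls_conv Idt_cong wk_eqTy)
  also have "\<dots> = cell_cls \<Gamma> A B f h (id_trans g h q p)"
    using g' h' q' p' p
    by (intro tm_cls_eqI id_trans_cong) (simp_all add: tm_cls_def cell_def arr_def)
  finally show "cell_cls \<Gamma> A' B' f' h' (id_trans g' h' q' p') = cell_cls \<Gamma> A B f h (id_trans g h q p)"
    using A' by (simp add: ty_cls_def tm_cls_ctx_conv)
qed

end

lemma Id1_cls:
  assumes A: "\<Gamma> \<turnstile> isTy A"
  shows "Id1 (T S \<Gamma>) (ty_cls S \<Gamma> A) = arr_cls \<Gamma> A A (Var 0)"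
  unfolding T_def two_cat.simps
proof (rule UN_eqI[OF ty_cls_self[OF A]])
  fix A' assume "A' \<in> ty_cls S \<Gamma> A"
  then show "arr_cls \<Gamma> A' A' (Var 0) = arr_cls \<Gamma> A A (Var 0)"
    using A by (auto simp: ty_cls_def tm_cls_ctx_conv intro!: tm_cls_conv wk_eqTy)
qed

lemma Cmp1_cls:
  assumes f: "arr \<Gamma> A B f" and g: "arr \<Gamma> B C g"
  shows "Cmp1 (T S \<Gamma>) (ty_cls S \<Gamma> A) (ty_cls S \<Gamma> B) (ty_cls S \<Gamma> C) (arr_cls \<Gamma> B C g) (arr_cls \<Gamma> A B f)
    = arr_cls \<Gamma> A C (g\<langle>cmp_sub f\<rangle>)"
  unfolding T_def two_cat.simps
proof (rule UN_eqI[OF ty_cls_self[OF arrD(1)[OF f]]], rule UN_eqI[OF ty_cls_self[OF arrD(2)[OF g]]],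
    rule UN_eqI[OF tm_cls_self[OF arrD(3)[OF g]]], rule UN_eqI[OF tm_cls_self[OF arrD(3)[OF f]]])
  fix A' C' g' f'
  assume A': "A' \<in> ty_cls S \<Gamma> A" and C': "C' \<in> ty_cls S \<Gamma> C"
    and g': "g' \<in> arr_cls \<Gamma> B C g" and f': "f' \<in> arr_cls \<Gamma> A B f"
  have "arr_cls \<Gamma> A C' (g'\<langle>cmp_sub f'\<rangle>) = arr_cls \<Gamma> A C (g'\<langle>cmp_sub f'\<rangle>)"
    using arrD[OF f] C' by (auto simp: ty_cls_def intro!: tm_cls_conv wk_eqTy)
  also have "\<dots> = arr_cls \<Gamma> A C (g\<langle>cmp_sub f\<rangle>)"
    using subst_cong[OF _ ctx_mor_eq_cmp_sub[OF f], of g g' "wk C" f'] g' f'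
    by (intro tm_cls_eqI) (simp add: tm_cls_def subst_calculus)
  finally show "arr_cls \<Gamma> A' C' (g'\<langle>cmp_sub f'\<rangle>) = arr_cls \<Gamma> A C (g\<langle>cmp_sub f\<rangle>)"
    using A' by (simp add: ty_cls_def tm_cls_ctx_conv)
qed

lemma wk_arr_cong:
  assumes h: "arr \<Gamma> B C h" and A: "\<Gamma> \<turnstile> isTy A" and eq: "B # \<Gamma> \<turnstile> eqTm h h' (wk C)"
  shows "wk B # A # \<Gamma> \<turnstile> eqTm (ren h (up Suc)) (ren h' (up Suc)) (wk (wk C))"
  using subst_eqTm[OF eq ctx_mor_lift[OF ctx_mor_wk[OF ctx_valid[OF A] A] arrD(1)[OF h] refl]]
  by (simp add: subst_calculus)

lemma WhL_cls:
  assumes h: "arr \<Gamma> B C h" and p: "cell \<Gamma> A B f g p"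
  shows "WhL (T S \<Gamma>) (ty_cls S \<Gamma> A) (ty_cls S \<Gamma> B) (ty_cls S \<Gamma> C) (arr_cls \<Gamma> B C h)
    (arr_cls \<Gamma> A B f) (arr_cls \<Gamma> A B g) (cell_cls \<Gamma> A B f g p)
    = cell_cls \<Gamma> A C (h\<langle>cmp_sub f\<rangle>) (h\<langle>cmp_sub g\<rangle>) (ap (ren h (up Suc)) f g p)"
  unfolding T_def two_cat.simps
proof (rule UN_eqI[OF ty_cls_self[OF arrD(1)[OF cellD(1)[OF p]]]],
    rule UN_eqI[OF ty_cls_self[OF arrD(2)[OF h]]], rule UN_eqI[OF tm_cls_self[OF arrD(3)[OF h]]],
    rule UN_eqI[OF tm_cls_self[OF arrD(3)[OF cellD(1)[OF p]]]],
    rule UN_eqI[OF tm_cls_self[OF arrD(3)[OF cellD(2)[OF p]]]],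
    rule UN_eqI[OF tm_cls_self[OF cellD(3)[OF p]]])
  fix A' C' h' f' g' p'
  assume A': "A' \<in> ty_cls S \<Gamma> A" and C': "C' \<in> ty_cls S \<Gamma> C" and h': "h' \<in> arr_cls \<Gamma> B C h"
    and f': "f' \<in> arr_cls \<Gamma> A B f" and g': "g' \<in> arr_cls \<Gamma> A B g" and p': "p' \<in> cell_cls \<Gamma> A B f g p"
  note A = arrD(1)[OF cellD(1)[OF p]] and C = arrD(2)[OF h]
  \<comment> \<open>The type of the whiskered 2-cell mentions both composites, so it varies with the
    representatives of the 1-cells too.\<close>
  have hf: "A # \<Gamma> \<turnstile> eqTm (h\<langle>cmp_sub f\<rangle>) (h'\<langle>cmp_sub f'\<rangle>) (wk C)"
    and hg: "A # \<Gamma> \<turnstile> eqTm (h\<langle>cmp_sub g\<rangle>) (h'\<langle>cmp_sub g'\<rangle>) (wk C)"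
    using subst_cong[OF _ ctx_mor_eq_cmp_sub[OF cellD(1)[OF p]], of h h' "wk C" f']
      subst_cong[OF _ ctx_mor_eq_cmp_sub[OF cellD(2)[OF p]], of h h' "wk C" g'] h' f' g'
    by (simp_all add: tm_cls_def subst_calculus)
  let ?r = "ren h (up Suc)" and ?r' = "ren h' (up Suc)"
  have "cell_cls \<Gamma> A C' (h'\<langle>cmp_sub f'\<rangle>) (h'\<langle>cmp_sub g'\<rangle>) (ap ?r' f' g' p')
    = cell_cls \<Gamma> A C (h\<langle>cmp_sub f\<rangle>) (h\<langle>cmp_sub g\<rangle>) (ap ?r' f' g' p')"
    using A C' hf hg by (auto simp: ty_cls_def intro!: tm_cls_conv Idt_cong wk_eqTy)
  also have "A # \<Gamma> \<turnstile> eqTm (ap ?r f g p) (ap ?r' f' g' p') (Idt (wk C) (?r\<langle>f \<rhd> Var\<rangle>) (?r\<langle>g \<rhd> Var\<rangle>))"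
    using wk_isTy[OF A C] wk_arr_cong[OF h A] h' f' g' p'
    by (intro ap_cong) (simp_all add: tm_cls_def)
  then have "cell_cls \<Gamma> A C (h\<langle>cmp_sub f\<rangle>) (h\<langle>cmp_sub g\<rangle>) (ap ?r' f' g' p')
    = cell_cls \<Gamma> A C (h\<langle>cmp_sub f\<rangle>) (h\<langle>cmp_sub g\<rangle>) (ap ?r f g p)"
    by (intro tm_cls_eqI) (simp add: subst_calculus)
  finally show "cell_cls \<Gamma> A' C' (h'\<langle>cmp_sub f'\<rangle>) (h'\<langle>cmp_sub g'\<rangle>) (ap ?r' f' g' p')
    = cell_cls \<Gamma> A C (h\<langle>cmp_sub f\<rangle>) (h\<langle>cmp_sub g\<rangle>) (ap ?r f g p)"
    using A' by (simp add: ty_cls_def tm_cls_ctx_conv)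
qed

lemma WhR_cls:
  assumes f: "arr \<Gamma> A B f" and q: "cell \<Gamma> B C g h q"
  shows "WhR (T S \<Gamma>) (ty_cls S \<Gamma> A) (ty_cls S \<Gamma> B) (ty_cls S \<Gamma> C) (arr_cls \<Gamma> B C g)
    (arr_cls \<Gamma> B C h) (cell_cls \<Gamma> B C g h q) (arr_cls \<Gamma> A B f)
    = cell_cls \<Gamma> A C (g\<langle>cmp_sub f\<rangle>) (h\<langle>cmp_sub f\<rangle>) (q\<langle>cmp_sub f\<rangle>)"
  unfolding T_def two_cat.simps
proof (rule UN_eqI[OF ty_cls_self[OF arrD(1)[OF f]]],
    rule UN_eqI[OF ty_cls_self[OF arrD(2)[OF cellD(1)[OF q]]]],
    rule UN_eqI[OF tm_cls_self[OF arrD(3)[OF cellD(1)[OF q]]]],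
    rule UN_eqI[OF tm_cls_self[OF arrD(3)[OF cellD(2)[OF q]]]],
    rule UN_eqI[OF tm_cls_self[OF cellD(3)[OF q]]], rule UN_eqI[OF tm_cls_self[OF arrD(3)[OF f]]])
  fix A' C' g' h' q' f'
  assume A': "A' \<in> ty_cls S \<Gamma> A" and C': "C' \<in> ty_cls S \<Gamma> C" and g': "g' \<in> arr_cls \<Gamma> B C g"
    and h': "h' \<in> arr_cls \<Gamma> B C h" and q': "q' \<in> cell_cls \<Gamma> B C g h q" and f': "f' \<in> arr_cls \<Gamma> A B f"
  have "A # \<Gamma> \<turnstile> eqTm f f' (wk B)"
    using f' by (simp add: tm_cls_def)
  note cong = subst_cong[OF _ ctx_mor_eq_cmp_sub[OF f this]]
  have "cell_cls \<Gamma> A C' (g'\<langle>cmp_sub f'\<rangle>) (h'\<langle>cmp_sub f'\<rangle>) (q'\<langle>cmp_sub f'\<rangle>)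
    = cell_cls \<Gamma> A C (g\<langle>cmp_sub f\<rangle>) (h\<langle>cmp_sub f\<rangle>) (q'\<langle>cmp_sub f'\<rangle>)"
    using arrD(1)[OF f] C' cong[of g g' "wk C"] cong[of h h' "wk C"] g' h'
    by (intro tm_cls_conv Idt_cong wk_eqTy) (simp_all add: ty_cls_def tm_cls_def subst_calculus)
  also have "\<dots> = cell_cls \<Gamma> A C (g\<langle>cmp_sub f\<rangle>) (h\<langle>cmp_sub f\<rangle>) (q\<langle>cmp_sub f\<rangle>)"
    using cong[of q q' "Idt (wk C) g h"] q'
    by (intro tm_cls_eqI) (simp add: tm_cls_def subst_calculus)
  finally show "cell_cls \<Gamma> A' C' (g'\<langle>cmp_sub f'\<rangle>) (h'\<langle>cmp_sub f'\<rangle>) (q'\<langle>cmp_sub f'\<rangle>)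
    = cell_cls \<Gamma> A C (g\<langle>cmp_sub f\<rangle>) (h\<langle>cmp_sub f\<rangle>) (q\<langle>cmp_sub f\<rangle>)"
    using A' by (simp add: ty_cls_def tm_cls_ctx_conv)
qed

lemma cmp_sub_Var0 [simp]: "t\<langle>cmp_sub (Var 0)\<rangle> = t"
  by (simp add: subst_calculus)

lemma cmp_sub_0 [simp]: "cmp_sub f 0 = f"
  by (simp add: cmp_sub_def)

text \<open>Composition of 1-cells is substitution, so its associativity is an identity of raw
  terms.\<close>

lemma cmp_sub_assoc: "t\<langle>cmp_sub g\<rangle>\<langle>cmp_sub f\<rangle> = t\<langle>cmp_sub (g\<langle>cmp_sub f\<rangle>)\<rangle>"
  by (simp add: subst_calculus)

section \<open>The laws of identity proofs as equations between 2-cells\<close>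

lemma id_trans_Refl_left_cls:
  "cell \<Gamma> A B f g p \<Longrightarrow> cell_cls \<Gamma> A B f g (id_trans g g (Refl g) p) = cell_cls \<Gamma> A B f g p"
  by (auto simp: cell_def arr_def intro!: tm_cls_eqI[symmetric] id_trans_Refl_left)

lemma id_trans_Refl_right_cls:
  "cell \<Gamma> A B f g p \<Longrightarrow> cell_cls \<Gamma> A B f g (id_trans f g p (Refl f)) = cell_cls \<Gamma> A B f g p"
  by (auto simp: cell_def arr_def intro!: tm_cls_eqI[symmetric] id_trans_Refl_right)

lemma id_trans_assoc_cls:
  "\<lbrakk>cell \<Gamma> A B f g p; cell \<Gamma> A B g h q; cell \<Gamma> A B h k r\<rbrakk> \<Longrightarrow>
    cell_cls \<Gamma> A B f k (id_trans g k (id_trans h k r q) p)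
      = cell_cls \<Gamma> A B f k (id_trans h k r (id_trans g h q p))"
  by (auto simp: cell_def arr_def intro!: tm_cls_eqI[symmetric] id_trans_assoc)

text \<open>A 1-cell out of \<open>A\<close> is an element over \<open>A # \<Gamma>\<close>. The
  laws of \<open>ap\<close> are therefore applied in that context, to the weakened \<open>h\<close>,
  here and in the lemmas that follow.\<close>

lemma ap_Refl_cls:
  assumes h: "arr \<Gamma> B C h" and f: "arr \<Gamma> A B f"
  shows "cell_cls \<Gamma> A C (h\<langle>cmp_sub f\<rangle>) (h\<langle>cmp_sub f\<rangle>) (ap (ren h (up Suc)) f f (Refl f))
    = cell_cls \<Gamma> A C (h\<langle>cmp_sub f\<rangle>) (h\<langle>cmp_sub f\<rangle>) (Refl (h\<langle>cmp_sub f\<rangle>))"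
  using ap_Refl[OF arrD(2) arrD(3), OF wk_arr wk_arr arrD(3), OF h _ h _ f] arrD(1)[OF f]
  by (intro tm_cls_eqI[symmetric]) (simp add: subst_calculus)

lemma ap_id_trans_cls:
  assumes h: "arr \<Gamma> B C h" and p: "cell \<Gamma> A B f g p" and q: "cell \<Gamma> A B g k q"
  shows "cell_cls \<Gamma> A C (h\<langle>cmp_sub f\<rangle>) (h\<langle>cmp_sub k\<rangle>) (ap (ren h (up Suc)) f k (id_trans g k q p))
    = cell_cls \<Gamma> A C (h\<langle>cmp_sub f\<rangle>) (h\<langle>cmp_sub k\<rangle>) (id_trans (h\<langle>cmp_sub g\<rangle>) (h\<langle>cmp_sub k\<rangle>)
        (ap (ren h (up Suc)) g k q) (ap (ren h (up Suc)) f g p))"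
proof -
  have A: "\<Gamma> \<turnstile> isTy A"
    using p by (simp add: cell_def arr_def)
  note r = wk_arr[OF h A]
  show ?thesis
    using ap_id_trans[OF arrD(2,3)[OF r], of f g k p q] p q
    by (intro tm_cls_eqI[symmetric]) (simp add: subst_calculus cell_def arr_def)
qed

lemma ap_Var_cls:
  assumes p: "cell \<Gamma> A B f g p"
  shows "cell_cls \<Gamma> A B f g (ap (Var 0) f g p) = cell_cls \<Gamma> A B f g p"
  using p ap_Var by (auto simp: cell_def arr_def intro!: tm_cls_eqI[symmetric])

lemma ap_comp_cls:
  assumes h: "arr \<Gamma> B C h" and k: "arr \<Gamma> C D k" and p: "cell \<Gamma> A B f g p"
  shows "cell_cls \<Gamma> A D (k\<langle>cmp_sub h\<rangle>\<langle>cmp_sub f\<rangle>) (k\<langle>cmp_sub h\<rangle>\<langle>cmp_sub g\<rangle>)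
      (ap (ren (k\<langle>cmp_sub h\<rangle>) (up Suc)) f g p)
    = cell_cls \<Gamma> A D (k\<langle>cmp_sub h\<rangle>\<langle>cmp_sub f\<rangle>) (k\<langle>cmp_sub h\<rangle>\<langle>cmp_sub g\<rangle>)
      (ap (ren k (up Suc)) (h\<langle>cmp_sub f\<rangle>) (h\<langle>cmp_sub g\<rangle>) (ap (ren h (up Suc)) f g p))"
proof -
  have A: "\<Gamma> \<turnstile> isTy A"
    using p by (simp add: cell_def arr_def)
  note h' = wk_arr[OF h A] and k' = wk_arr[OF k A]
  show ?thesis
    using ap_comp[OF arrD(2)[OF h'] arrD(2)[OF k'] arrD(3)[OF h'] arrD(3)[OF k'], of f g p] p
    by (intro tm_cls_eqI[symmetric]) (simp add: subst_calculus cell_def arr_def)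
qed

lemma ap_natural_cls:
  assumes q: "cell \<Gamma> B C g h q" and p: "cell \<Gamma> A B f k p"
  shows "cell_cls \<Gamma> A C (g\<langle>cmp_sub f\<rangle>) (h\<langle>cmp_sub k\<rangle>)
      (id_trans (g\<langle>cmp_sub k\<rangle>) (h\<langle>cmp_sub k\<rangle>) (q\<langle>cmp_sub k\<rangle>) (ap (ren g (up Suc)) f k p))
    = cell_cls \<Gamma> A C (g\<langle>cmp_sub f\<rangle>) (h\<langle>cmp_sub k\<rangle>)
      (id_trans (h\<langle>cmp_sub f\<rangle>) (h\<langle>cmp_sub k\<rangle>) (ap (ren h (up Suc)) f k p) (q\<langle>cmp_sub f\<rangle>))"
proof -
  have A: "\<Gamma> \<turnstile> isTy A"
    using p by (simp add: cell_def arr_def)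
  note q' = wk_cell[OF q A]
  note g' = cellD(1)[OF q'] and h' = cellD(2)[OF q']
  show ?thesis
    using ap_natural[OF arrD(2)[OF g'] arrD(3)[OF g'] arrD(3)[OF h'] cellD(3)[OF q'], of f k p] p
    by (intro tm_cls_eqI[symmetric]) (simp add: subst_calculus cell_def arr_def)
qed

section \<open>The axioms of a 2-category\<close>

lemma category_T_hom:
  assumes A: "\<Gamma> \<turnstile> isTy A" and B: "\<Gamma> \<turnstile> isTy B"
  shows "category (T_hom S \<Gamma> (ty_cls S \<Gamma> A) (ty_cls S \<Gamma> B))"
  unfolding category_def Arr_cls[OF A B]
  by (auto simp: Cell_cls[OF A B] Idn_cls[OF A B] Cmp_cls[OF A B] cell_refl cell_trans
      id_trans_Refl_left_cls id_trans_Refl_right_cls id_trans_assoc_cls)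

lemma category_T_arr:
  "category \<lparr>Obj = Obj2 (T S \<Gamma>), Hom = Arr (T S \<Gamma>), Idn = Id1 (T S \<Gamma>), Cmp = Cmp1 (T S \<Gamma>)\<rparr>"
  unfolding category_def cat.simps Obj_T HomC_T
  by (auto simp: Arr_cls Id1_cls Cmp1_cls arr_id arr_comp cmp_sub_assoc)

lemma WhL_functor:
  assumes A: "\<Gamma> \<turnstile> isTy A" and h: "arr \<Gamma> B C h"
  shows "is_functor (T_hom S \<Gamma> (ty_cls S \<Gamma> A) (ty_cls S \<Gamma> B)) (T_hom S \<Gamma> (ty_cls S \<Gamma> A) (ty_cls S \<Gamma> C))
    (Cmp1 (T S \<Gamma>) (ty_cls S \<Gamma> A) (ty_cls S \<Gamma> B) (ty_cls S \<Gamma> C) (arr_cls \<Gamma> B C h))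
    (WhL (T S \<Gamma>) (ty_cls S \<Gamma> A) (ty_cls S \<Gamma> B) (ty_cls S \<Gamma> C) (arr_cls \<Gamma> B C h))"
proof -
  note B = arrD(1)[OF h] and C = arrD(2)[OF h]
  show ?thesis
    unfolding is_functor_def Arr_cls[OF A B] Arr_cls[OF A C]
    by (auto simp: category_T_hom A B C Cell_cls Idn_cls Cmp_cls Cmp1_cls[OF _ h] WhL_cls[OF h] cell_refl cell_trans
        arr_comp[OF _ h] cell_whl[OF h] ap_Refl_cls[OF h] ap_id_trans_cls[OF h])
qed

text \<open>Whiskering on the right is substitution, which commutes with \<open>Refl\<close> and
  \<open>id_trans\<close> as raw terms. Whiskering on the left is \<open>ap\<close> and instead
  takes its functoriality from identity induction.\<close>

lemma WhR_functor:
  assumes C: "\<Gamma> \<turnstile> isTy C" and f: "arr \<Gamma> A B f"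
  shows "is_functor (T_hom S \<Gamma> (ty_cls S \<Gamma> B) (ty_cls S \<Gamma> C)) (T_hom S \<Gamma> (ty_cls S \<Gamma> A) (ty_cls S \<Gamma> C))
    (\<lambda>G. Cmp1 (T S \<Gamma>) (ty_cls S \<Gamma> A) (ty_cls S \<Gamma> B) (ty_cls S \<Gamma> C) G (arr_cls \<Gamma> A B f))
    (\<lambda>G H \<beta>. WhR (T S \<Gamma>) (ty_cls S \<Gamma> A) (ty_cls S \<Gamma> B) (ty_cls S \<Gamma> C) G H \<beta> (arr_cls \<Gamma> A B f))"
proof -
  note A = arrD(1)[OF f] and B = arrD(2)[OF f]
  show ?thesis
    unfolding is_functor_def Arr_cls[OF B C] Arr_cls[OF A C]
    by (auto simp: category_T_hom A B C Cell_cls Idn_cls Cmp_cls Cmp1_cls[OF f] WhR_cls[OF f] cell_refl cell_trans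
        arr_comp[OF f] cell_whr[OF f] id_trans_subst)
qed

text \<open>The same asymmetry: on the left an identity 1-cell acts by \<open>ap (Var 0)\<close>,
  trivial by \<open>ap_Var\<close>, and on the right by substituting a variable for itself.\<close>

lemma whisker_Id1:
  assumes p: "cell \<Gamma> A B f g p"
  shows "WhL (T S \<Gamma>) (ty_cls S \<Gamma> A) (ty_cls S \<Gamma> B) (ty_cls S \<Gamma> B) (Id1 (T S \<Gamma>) (ty_cls S \<Gamma> B))
      (arr_cls \<Gamma> A B f) (arr_cls \<Gamma> A B g) (cell_cls \<Gamma> A B f g p) = cell_cls \<Gamma> A B f g p"
    and "WhR (T S \<Gamma>) (ty_cls S \<Gamma> A) (ty_cls S \<Gamma> A) (ty_cls S \<Gamma> B) (arr_cls \<Gamma> A B f) (arr_cls \<Gamma> A B g)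
      (cell_cls \<Gamma> A B f g p) (Id1 (T S \<Gamma>) (ty_cls S \<Gamma> A)) = cell_cls \<Gamma> A B f g p"
proof -
  note A = arrD(1)[OF cellD(1)[OF p]] and B = arrD(2)[OF cellD(1)[OF p]]
  show "WhL (T S \<Gamma>) (ty_cls S \<Gamma> A) (ty_cls S \<Gamma> B) (ty_cls S \<Gamma> B) (Id1 (T S \<Gamma>) (ty_cls S \<Gamma> B))
      (arr_cls \<Gamma> A B f) (arr_cls \<Gamma> A B g) (cell_cls \<Gamma> A B f g p) = cell_cls \<Gamma> A B f g p"
    using WhL_cls[OF arr_id[OF B] p] by (simp add: Id1_cls[OF B] ap_Var_cls[OF p] cmp_sub_def)
  show "WhR (T S \<Gamma>) (ty_cls S \<Gamma> A) (ty_cls S \<Gamma> A) (ty_cls S \<Gamma> B) (arr_cls \<Gamma> A B f) (arr_cls \<Gamma> A B g)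
      (cell_cls \<Gamma> A B f g p) (Id1 (T S \<Gamma>) (ty_cls S \<Gamma> A)) = cell_cls \<Gamma> A B f g p"
    using WhR_cls[OF arr_id[OF A] p] by (simp add: Id1_cls[OF A])
qed

lemma two_category_T: "two_category (T S \<Gamma>)"
proof -
  let ?K = "T S \<Gamma>"
  \<comment> \<open>The classes are replaced by representatives, on which the \<open>_cls\<close>
    lemmas compute both sides. The other laws are treated alike.\<close>
  have WhL_Cmp1: "WhL ?K x y w (Cmp1 ?K y z w k h) f f' \<alpha>
      = WhL ?K x z w k (Cmp1 ?K x y z h f) (Cmp1 ?K x y z h f') (WhL ?K x y z h f f' \<alpha>)"
    if "x \<in> Obj2 ?K" "y \<in> Obj2 ?K" "z \<in> Obj2 ?K" "w \<in> Obj2 ?K" "f \<in> Arr ?K x y" "f' \<in> Arr ?K x y"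
      "\<alpha> \<in> Cell ?K x y f f'" "h \<in> Arr ?K y z" "k \<in> Arr ?K z w" for x y z w f f' \<alpha> h k
  proof -
    from that obtain A B C D where obj: "x = ty_cls S \<Gamma> A" "y = ty_cls S \<Gamma> B" "z = ty_cls S \<Gamma> C" "w = ty_cls S \<Gamma> D"
      and ty: "\<Gamma> \<turnstile> isTy A" "\<Gamma> \<turnstile> isTy B" "\<Gamma> \<turnstile> isTy C" "\<Gamma> \<turnstile> isTy D"
      by (auto simp: Obj_T)
    with that obtain f\<^sub>0 f\<^sub>1 p h\<^sub>0 k\<^sub>0 where arrs: "f = arr_cls \<Gamma> A B f\<^sub>0" "f' = arr_cls \<Gamma> A B f\<^sub>1"
        "\<alpha> = cell_cls \<Gamma> A B f\<^sub>0 f\<^sub>1 p" "h = arr_cls \<Gamma> B C h\<^sub>0" "k = arr_cls \<Gamma> C D k\<^sub>0"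
      and p: "cell \<Gamma> A B f\<^sub>0 f\<^sub>1 p" and h: "arr \<Gamma> B C h\<^sub>0" and k: "arr \<Gamma> C D k\<^sub>0"
      by (auto simp: HomC_T Arr_cls Cell_cls)
    note f = cellD(1,2)[OF p]
    show ?thesis
      using ap_comp_cls[OF h k p]
      by (simp add: obj arrs Cmp1_cls[OF _ h] Cmp1_cls[OF _ k] f h k p WhL_cls[OF h p]
          WhL_cls[OF k cell_whl[OF h p]] WhL_cls[OF arr_comp[OF h k] p] cmp_sub_assoc)
  qed
  have WhR_Cmp1: "WhR ?K x z w g g' \<beta> (Cmp1 ?K x y z f e)
      = WhR ?K x y w (Cmp1 ?K y z w g f) (Cmp1 ?K y z w g' f) (WhR ?K y z w g g' \<beta> f) e"
    if "x \<in> Obj2 ?K" "y \<in> Obj2 ?K" "z \<in> Obj2 ?K" "w \<in> Obj2 ?K" "g \<in> Arr ?K z w" "g' \<in> Arr ?K z w"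
      "\<beta> \<in> Cell ?K z w g g'" "e \<in> Arr ?K x y" "f \<in> Arr ?K y z" for x y z w g g' \<beta> e f
  proof -
    from that obtain A B C D where obj: "x = ty_cls S \<Gamma> A" "y = ty_cls S \<Gamma> B" "z = ty_cls S \<Gamma> C" "w = ty_cls S \<Gamma> D"
      and ty: "\<Gamma> \<turnstile> isTy A" "\<Gamma> \<turnstile> isTy B" "\<Gamma> \<turnstile> isTy C" "\<Gamma> \<turnstile> isTy D"
      by (auto simp: Obj_T)
    with that obtain g\<^sub>0 g\<^sub>1 q e\<^sub>0 f\<^sub>0 where arrs: "g = arr_cls \<Gamma> C D g\<^sub>0" "g' = arr_cls \<Gamma> C D g\<^sub>1"
        "\<beta> = cell_cls \<Gamma> C D g\<^sub>0 g\<^sub>1 q" "e = arr_cls \<Gamma> A B e\<^sub>0" "f = arr_cls \<Gamma> B C f\<^sub>0"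
      and q: "cell \<Gamma> C D g\<^sub>0 g\<^sub>1 q" and e: "arr \<Gamma> A B e\<^sub>0" and f: "arr \<Gamma> B C f\<^sub>0"
      by (auto simp: HomC_T Arr_cls Cell_cls)
    note g = cellD(1,2)[OF q]
    show ?thesis
      by (simp add: obj arrs Cmp1_cls[OF e f] Cmp1_cls[OF f] g q WhR_cls[OF f q]
          WhR_cls[OF e cell_whr[OF f q]] WhR_cls[OF arr_comp[OF e f] q] cmp_sub_assoc)
  qed
  have WhL_WhR: "WhL ?K x z w h (Cmp1 ?K x y z f e) (Cmp1 ?K x y z f' e) (WhR ?K x y z f f' \<alpha> e)
      = WhR ?K x y w (Cmp1 ?K y z w h f) (Cmp1 ?K y z w h f') (WhL ?K y z w h f f' \<alpha>) e"
    if "x \<in> Obj2 ?K" "y \<in> Obj2 ?K" "z \<in> Obj2 ?K" "w \<in> Obj2 ?K" "f \<in> Arr ?K y z" "f' \<in> Arr ?K y z"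
      "\<alpha> \<in> Cell ?K y z f f'" "e \<in> Arr ?K x y" "h \<in> Arr ?K z w" for x y z w f f' \<alpha> e h
  proof -
    from that obtain A B C D where obj: "x = ty_cls S \<Gamma> A" "y = ty_cls S \<Gamma> B" "z = ty_cls S \<Gamma> C" "w = ty_cls S \<Gamma> D"
      and ty: "\<Gamma> \<turnstile> isTy A" "\<Gamma> \<turnstile> isTy B" "\<Gamma> \<turnstile> isTy C" "\<Gamma> \<turnstile> isTy D"
      by (auto simp: Obj_T)
    with that obtain f\<^sub>0 f\<^sub>1 p e\<^sub>0 h\<^sub>0 where arrs: "f = arr_cls \<Gamma> B C f\<^sub>0" "f' = arr_cls \<Gamma> B C f\<^sub>1"
        "\<alpha> = cell_cls \<Gamma> B C f\<^sub>0 f\<^sub>1 p" "e = arr_cls \<Gamma> A B e\<^sub>0" "h = arr_cls \<Gamma> C D h\<^sub>0"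
      and p: "cell \<Gamma> B C f\<^sub>0 f\<^sub>1 p" and e: "arr \<Gamma> A B e\<^sub>0" and h: "arr \<Gamma> C D h\<^sub>0"
      by (auto simp: HomC_T Arr_cls Cell_cls)
    note f = cellD(1,2)[OF p]
    \<comment> \<open>Substituting for the last variable passes through \<open>ap\<close> and leaves
      \<open>h\<^sub>0\<close> unchanged: weakened by \<open>up Suc\<close>, it skips exactly the
      variable that is replaced.\<close>
    have eq: "(ap (ren h\<^sub>0 (up Suc)) f\<^sub>0 f\<^sub>1 p)\<langle>cmp_sub e\<^sub>0\<rangle>
      = ap (ren h\<^sub>0 (up Suc)) (f\<^sub>0\<langle>cmp_sub e\<^sub>0\<rangle>) (f\<^sub>1\<langle>cmp_sub e\<^sub>0\<rangle>) (p\<langle>cmp_sub e\<^sub>0\<rangle>)"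
      by (simp add: ap_subst subst_calculus)
    show ?thesis
      by (simp add: obj arrs Cmp1_cls[OF e] Cmp1_cls[OF _ h] f p WhR_cls[OF e p] WhL_cls[OF h p]
          WhR_cls[OF e cell_whl[OF h p]] WhL_cls[OF h cell_whr[OF e p]] cmp_sub_assoc eq)
  qed
  have interchange: "VCmp ?K x z (Cmp1 ?K x y z g f) (Cmp1 ?K x y z g f') (Cmp1 ?K x y z g' f')
      (WhR ?K x y z g g' \<beta> f') (WhL ?K x y z g f f' \<alpha>)
    = VCmp ?K x z (Cmp1 ?K x y z g f) (Cmp1 ?K x y z g' f) (Cmp1 ?K x y z g' f')
      (WhL ?K x y z g' f f' \<alpha>) (WhR ?K x y z g g' \<beta> f)"
    if "x \<in> Obj2 ?K" "y \<in> Obj2 ?K" "z \<in> Obj2 ?K" "f \<in> Arr ?K x y" "f' \<in> Arr ?K x y" "g \<in> Arr ?K y z"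
      "g' \<in> Arr ?K y z" "\<alpha> \<in> Cell ?K x y f f'" "\<beta> \<in> Cell ?K y z g g'" for x y z f f' g g' \<alpha> \<beta>
  proof -
    from that obtain A B C where obj: "x = ty_cls S \<Gamma> A" "y = ty_cls S \<Gamma> B" "z = ty_cls S \<Gamma> C"
      and ty: "\<Gamma> \<turnstile> isTy A" "\<Gamma> \<turnstile> isTy B" "\<Gamma> \<turnstile> isTy C"
      by (auto simp: Obj_T)
    with that obtain f\<^sub>0 f\<^sub>1 p g\<^sub>0 g\<^sub>1 q where arrs: "f = arr_cls \<Gamma> A B f\<^sub>0" "f' = arr_cls \<Gamma> A B f\<^sub>1"
        "\<alpha> = cell_cls \<Gamma> A B f\<^sub>0 f\<^sub>1 p" "g = arr_cls \<Gamma> B C g\<^sub>0" "g' = arr_cls \<Gamma> B C g\<^sub>1"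
        "\<beta> = cell_cls \<Gamma> B C g\<^sub>0 g\<^sub>1 q"
      and p: "cell \<Gamma> A B f\<^sub>0 f\<^sub>1 p" and q: "cell \<Gamma> B C g\<^sub>0 g\<^sub>1 q"
      by (auto simp: HomC_T Arr_cls Cell_cls)
    note f = cellD(1,2)[OF p] and g = cellD(1,2)[OF q]
    show ?thesis
      by (simp add: obj arrs Cmp1_cls[OF f(1)] Cmp1_cls[OF f(2)] f g p q WhR_cls[OF f(1) q] WhR_cls[OF f(2) q]
          WhL_cls[OF g(1) p] WhL_cls[OF g(2) p] HomC_T
          Cmp_cls[OF ty(1,3) cell_whl[OF g(1) p] cell_whr[OF f(2) q]]
          Cmp_cls[OF ty(1,3) cell_whr[OF f(1) q] cell_whl[OF g(2) p]] ap_natural_cls[OF q p])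
  qed
  have category: "category (HomC ?K x y)" if "x \<in> Obj2 ?K" "y \<in> Obj2 ?K" for x y
    using that by (auto simp: HomC_T Obj_T category_T_hom)
  have WhL_functor: "is_functor (HomC ?K x y) (HomC ?K x z) (Cmp1 ?K x y z h) (WhL ?K x y z h)"
    if "x \<in> Obj2 ?K" "y \<in> Obj2 ?K" "z \<in> Obj2 ?K" "h \<in> Arr ?K y z" for x y z h
    using that by (auto simp: HomC_T Obj_T Arr_cls WhL_functor)
  have WhR_functor: "is_functor (HomC ?K y z) (HomC ?K x z) (\<lambda>g. Cmp1 ?K x y z g f)
      (\<lambda>g g' \<beta>. WhR ?K x y z g g' \<beta> f)"
    if "x \<in> Obj2 ?K" "y \<in> Obj2 ?K" "z \<in> Obj2 ?K" "f \<in> Arr ?K x y" for x y z f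
    using that by (auto simp: HomC_T Obj_T Arr_cls WhR_functor)
  have whisker_Id1: "WhL ?K x y y (Id1 ?K y) f f' \<alpha> = \<alpha>" "WhR ?K x x y f f' \<alpha> (Id1 ?K x) = \<alpha>"
    if "x \<in> Obj2 ?K" "y \<in> Obj2 ?K" "f \<in> Arr ?K x y" "f' \<in> Arr ?K x y" "\<alpha> \<in> Cell ?K x y f f'" for x y f f' \<alpha>
    using that by (auto simp: HomC_T Obj_T Arr_cls Cell_cls whisker_Id1)
  show ?thesis
    unfolding two_category_def
    by (intro conjI ballI category_T_arr;
      (rule category WhL_functor WhR_functor whisker_Id1 WhL_Cmp1 WhR_Cmp1 WhL_WhR interchange; assumption))
qed

section \<open>Weakening and its biadjoint\<close>

text \<open>The exchange that relates the two sides of the biadjunction: it moves the variable of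
  type \<open>A\<close> into last position, where it can be abstracted, and with the roles of
  \<open>A\<close> and \<open>B\<close> reversed it moves it back.\<close>

lemma ctx_mor_swap:
  assumes A: "\<Gamma> \<turnstile> isTy A" and B: "\<Gamma> \<turnstile> isTy B"
  shows "ctx_mor S (wk A # B # \<Gamma>) (Var (Suc 0) \<rhd> Var 0 \<rhd> (\<lambda>i. Var (Suc (Suc i)))) (wk B # A # \<Gamma>)"
proof -
  have A': "B # \<Gamma> \<turnstile> isTy (A\<langle>\<lambda>i. Var (Suc i)\<rangle>)"
    using wk_isTy[OF B A] by (simp add: ren_eq_subst)
  have B': "A # \<Gamma> \<turnstile> isTy (B\<langle>\<lambda>i. Var (Suc i)\<rangle>)"
    using wk_isTy[OF A B] by (simp add: ren_eq_subst)
  show ?thesis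
    unfolding ren_eq_subst
    using ctx_mor_wk2[OF B A'] A B' var0[OF A']
      subst_isTm[OF var0[OF B] ctx_mor_wk[OF ctx_valid[OF A'] A']]
    by (intro ctx_mor_scons) (simp_all add: subst_calculus)
qed

section \<open>The weakening 2-functor\<close>

context
  fixes \<Gamma> A
  assumes A: "\<Gamma> \<turnstile> isTy A"
begin

lemma F0_cls: "\<Gamma> \<turnstile> isTy B \<Longrightarrow> F0 (weakening S \<Gamma> A) (ty_cls S \<Gamma> B) = ty_cls S (A # \<Gamma>) (wk B)"
  unfolding weakening_def two_map.simps
  by (rule UN_eqI[OF ty_cls_self]) (auto simp: A dest: ty_clsD intro!: ty_cls_eqI wk_eqTy)

lemma F1_cls:
  assumes f: "arr \<Gamma> B C f"
  shows "F1 (weakening S \<Gamma> A) (ty_cls S \<Gamma> B) (ty_cls S \<Gamma> C) (arr_cls \<Gamma> B C f)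
    = arr_cls (A # \<Gamma>) (wk B) (wk C) (ren f (up Suc))"
  unfolding weakening_def two_map.simps
proof (rule UN_eqI[OF ty_cls_self[OF arrD(1)[OF f]]], rule UN_eqI[OF ty_cls_self[OF arrD(2)[OF f]]],
    rule UN_eqI[OF tm_cls_self[OF arrD(3)[OF f]]])
  fix B' C' f'
  assume B': "B' \<in> ty_cls S \<Gamma> B" and C': "C' \<in> ty_cls S \<Gamma> C" and f': "f' \<in> arr_cls \<Gamma> B C f"
  have "arr_cls (A # \<Gamma>) (wk B) (wk C') (ren f' (up Suc)) = arr_cls (A # \<Gamma>) (wk B) (wk C) (ren f' (up Suc))"
    using A C' arrD[OF f] by (auto dest!: ty_clsD intro!: tm_cls_conv wk_eqTy wk_isTy)
  also have "\<dots> = arr_cls (A # \<Gamma>) (wk B) (wk C) (ren f (up Suc))"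
    using wk_arr_cong[OF f A] f' by (intro tm_cls_eqI) (auto dest: tm_clsD)
  finally show "arr_cls (A # \<Gamma>) (wk B') (wk C') (ren f' (up Suc)) = arr_cls (A # \<Gamma>) (wk B) (wk C) (ren f (up Suc))"
    using tm_cls_ctx_conv[OF wk_eqTy[OF A ty_clsD[OF B']]] by simp
qed

lemma F2_cls:
  assumes p: "cell \<Gamma> B C f g p"
  shows "F2 (weakening S \<Gamma> A) (ty_cls S \<Gamma> B) (ty_cls S \<Gamma> C) (arr_cls \<Gamma> B C f) (arr_cls \<Gamma> B C g)
      (cell_cls \<Gamma> B C f g p)
    = cell_cls (A # \<Gamma>) (wk B) (wk C) (ren f (up Suc)) (ren g (up Suc)) (ren p (up Suc))"
  unfolding weakening_def two_map.simps
proof (rule UN_eqI[OF ty_cls_self[OF arrD(1)[OF cellD(1)[OF p]]]],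
    rule UN_eqI[OF ty_cls_self[OF arrD(2)[OF cellD(1)[OF p]]]],
    rule UN_eqI[OF tm_cls_self[OF arrD(3)[OF cellD(1)[OF p]]]],
    rule UN_eqI[OF tm_cls_self[OF arrD(3)[OF cellD(2)[OF p]]]],
    rule UN_eqI[OF tm_cls_self[OF cellD(3)[OF p]]])
  fix B' C' f' g' p'
  assume B': "B' \<in> ty_cls S \<Gamma> B" and C': "C' \<in> ty_cls S \<Gamma> C" and f': "f' \<in> arr_cls \<Gamma> B C f"
    and g': "g' \<in> arr_cls \<Gamma> B C g" and p': "p' \<in> cell_cls \<Gamma> B C f g p"
  note f = cellD(1)[OF p] and g = cellD(2)[OF p]
  have "cell_cls (A # \<Gamma>) (wk B) (wk C') (ren f' (up Suc)) (ren g' (up Suc)) (ren p' (up Suc))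
    = cell_cls (A # \<Gamma>) (wk B) (wk C) (ren f (up Suc)) (ren g (up Suc)) (ren p' (up Suc))"
    using A C' arrD[OF f] wk_arr_cong[OF f A] wk_arr_cong[OF g A] f' g'
    by (auto dest!: ty_clsD tm_clsD intro!: tm_cls_conv Idt_cong wk_eqTy wk_isTy)
  also have "\<dots> = cell_cls (A # \<Gamma>) (wk B) (wk C) (ren f (up Suc)) (ren g (up Suc)) (ren p (up Suc))"
    using subst_eqTm[OF tm_clsD[OF p'] ctx_mor_lift[OF ctx_mor_wk[OF ctx_valid[OF A] A] arrD(1)[OF f] refl]]
    by (intro tm_cls_eqI) (simp add: subst_calculus)
  finally show "cell_cls (A # \<Gamma>) (wk B') (wk C') (ren f' (up Suc)) (ren g' (up Suc)) (ren p' (up Suc))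
      = cell_cls (A # \<Gamma>) (wk B) (wk C) (ren f (up Suc)) (ren g (up Suc)) (ren p (up Suc))"
    using tm_cls_ctx_conv[OF wk_eqTy[OF A ty_clsD[OF B']]] by simp
qed

text \<open>Weakening acts on raw terms by substitution, so it commutes on the nose with composition
  of 1-cells and, by the next two lemmas, with composition and whiskering of 2-cells. This makes
  \<open>weakening\<close> a strict 2-functor.\<close>

lemma ren_cmp_sub: "ren (g\<langle>cmp_sub f\<rangle>) (up Suc) = (ren g (up Suc))\<langle>cmp_sub (ren f (up Suc))\<rangle>"
  by (simp add: subst_calculus)

lemma ren_id_trans:
  "ren (id_trans g h q p) \<rho> = id_trans (ren g \<rho>) (ren h \<rho>) (ren q \<rho>) (ren p \<rho>)"
  by (simp add: ren_eq_subst id_trans_subst)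

lemma ren_ap:
  "ren (ap (ren h (up Suc)) f g p) (up Suc)
    = ap (ren (ren h (up Suc)) (up Suc)) (ren f (up Suc)) (ren g (up Suc)) (ren p (up Suc))"
  by (simp add: ap_subst subst_calculus)

lemma weakening_hom_functor:
  assumes B: "\<Gamma> \<turnstile> isTy B" and C: "\<Gamma> \<turnstile> isTy C"
  shows "is_functor (T_hom S \<Gamma> (ty_cls S \<Gamma> B) (ty_cls S \<Gamma> C))
    (T_hom S (A # \<Gamma>) (ty_cls S (A # \<Gamma>) (wk B)) (ty_cls S (A # \<Gamma>) (wk C)))
    (F1 (weakening S \<Gamma> A) (ty_cls S \<Gamma> B) (ty_cls S \<Gamma> C))
    (F2 (weakening S \<Gamma> A) (ty_cls S \<Gamma> B) (ty_cls S \<Gamma> C))"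
proof -
  note B' = wk_isTy[OF A B] and C' = wk_isTy[OF A C]
  show ?thesis
    unfolding is_functor_def Arr_cls[OF B C] Arr_cls[OF B' C']
    by (auto simp: category_T_hom B C B' C' Cell_cls Idn_cls Cmp_cls F1_cls F2_cls cell_refl cell_trans
        wk_arr wk_cell A ren_id_trans)
qed

lemma weakening_functor:
  "is_functor \<lparr>Obj = Obj2 (T S \<Gamma>), Hom = Arr (T S \<Gamma>), Idn = Id1 (T S \<Gamma>), Cmp = Cmp1 (T S \<Gamma>)\<rparr>
    \<lparr>Obj = Obj2 (T S (A # \<Gamma>)), Hom = Arr (T S (A # \<Gamma>)), Idn = Id1 (T S (A # \<Gamma>)), Cmp = Cmp1 (T S (A # \<Gamma>))\<rparr>
    (F0 (weakening S \<Gamma> A)) (F1 (weakening S \<Gamma> A))"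
  unfolding is_functor_def cat.simps
  by (auto simp: category_T_arr[unfolded Obj_T HomC_T] Obj_T HomC_T Arr_cls F0_cls F1_cls wk_isTy A wk_arr Id1_cls arr_id
      Cmp1_cls arr_comp ren_cmp_sub)

lemma two_functor_weakening: "two_functor (T S \<Gamma>) (T S (A # \<Gamma>)) (weakening S \<Gamma> A)"
proof -
  let ?K = "T S \<Gamma>" and ?L = "T S (A # \<Gamma>)" and ?U = "weakening S \<Gamma> A"
  have hom: "is_functor (HomC ?K x y) (HomC ?L (F0 ?U x) (F0 ?U y)) (F1 ?U x y) (F2 ?U x y)"
    if "x \<in> Obj2 ?K" "y \<in> Obj2 ?K" for x y
    using that by (auto simp: HomC_T Obj_T F0_cls weakening_hom_functor)
  have WhL: "F2 ?U x z (Cmp1 ?K x y z h f) (Cmp1 ?K x y z h f') (WhL ?K x y z h f f' \<alpha>)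
      = WhL ?L (F0 ?U x) (F0 ?U y) (F0 ?U z) (F1 ?U y z h) (F1 ?U x y f) (F1 ?U x y f') (F2 ?U x y f f' \<alpha>)"
    if "x \<in> Obj2 ?K" "y \<in> Obj2 ?K" "z \<in> Obj2 ?K" "f \<in> Arr ?K x y" "f' \<in> Arr ?K x y" "\<alpha> \<in> Cell ?K x y f f'"
      "h \<in> Arr ?K y z" for x y z f f' \<alpha> h
  proof -
    from that obtain B C D where obj: "x = ty_cls S \<Gamma> B" "y = ty_cls S \<Gamma> C" "z = ty_cls S \<Gamma> D"
      and ty: "\<Gamma> \<turnstile> isTy B" "\<Gamma> \<turnstile> isTy C" "\<Gamma> \<turnstile> isTy D"
      by (auto simp: Obj_T)
    with that obtain f\<^sub>0 f\<^sub>1 p h\<^sub>0 where arrs: "f = arr_cls \<Gamma> B C f\<^sub>0" "f' = arr_cls \<Gamma> B C f\<^sub>1"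
        "\<alpha> = cell_cls \<Gamma> B C f\<^sub>0 f\<^sub>1 p" "h = arr_cls \<Gamma> C D h\<^sub>0"
      and p: "cell \<Gamma> B C f\<^sub>0 f\<^sub>1 p" and h: "arr \<Gamma> C D h\<^sub>0"
      by (auto simp: HomC_T Arr_cls Cell_cls)
    note f = cellD(1,2)[OF p]
    show ?thesis
      by (simp add: obj arrs ty f p h Cmp1_cls[OF _ h] WhL_cls[OF h p] F2_cls[OF cell_whl[OF h p]] F0_cls F1_cls
          F2_cls[OF p] WhL_cls[OF wk_arr[OF h A] wk_cell[OF p A]] ren_cmp_sub ren_ap)
  qed
  have WhR: "F2 ?U x z (Cmp1 ?K x y z g f) (Cmp1 ?K x y z g' f) (WhR ?K x y z g g' \<beta> f)
      = WhR ?L (F0 ?U x) (F0 ?U y) (F0 ?U z) (F1 ?U y z g) (F1 ?U y z g') (F2 ?U y z g g' \<beta>) (F1 ?U x y f)"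
    if "x \<in> Obj2 ?K" "y \<in> Obj2 ?K" "z \<in> Obj2 ?K" "g \<in> Arr ?K y z" "g' \<in> Arr ?K y z" "\<beta> \<in> Cell ?K y z g g'"
      "f \<in> Arr ?K x y" for x y z g g' \<beta> f
  proof -
    from that obtain B C D where obj: "x = ty_cls S \<Gamma> B" "y = ty_cls S \<Gamma> C" "z = ty_cls S \<Gamma> D"
      and ty: "\<Gamma> \<turnstile> isTy B" "\<Gamma> \<turnstile> isTy C" "\<Gamma> \<turnstile> isTy D"
      by (auto simp: Obj_T)
    with that obtain g\<^sub>0 g\<^sub>1 q f\<^sub>0 where arrs: "g = arr_cls \<Gamma> C D g\<^sub>0" "g' = arr_cls \<Gamma> C D g\<^sub>1"
        "\<beta> = cell_cls \<Gamma> C D g\<^sub>0 g\<^sub>1 q" "f = arr_cls \<Gamma> B C f\<^sub>0"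
      and q: "cell \<Gamma> C D g\<^sub>0 g\<^sub>1 q" and f: "arr \<Gamma> B C f\<^sub>0"
      by (auto simp: HomC_T Arr_cls Cell_cls)
    note g = cellD(1,2)[OF q]
    show ?thesis
      by (simp add: obj arrs ty f q g Cmp1_cls[OF f] WhR_cls[OF f q] F2_cls[OF cell_whr[OF f q]] F0_cls F1_cls
          F2_cls[OF q] WhR_cls[OF wk_arr[OF f A] wk_cell[OF q A]] ren_cmp_sub)
  qed
  show ?thesis
    unfolding two_functor_def
    by (intro conjI ballI two_category_T weakening_functor; (rule hom WhL WhR; assumption))
qed

section \<open>The counit and its universal property\<close>

context
  fixes B
  assumes B: "A # \<Gamma> \<turnstile> isTy B"
begin

text \<open>In context \<Gamma>, x : A, m : \<Pi>(A, B) the function is variable 0 and its argument,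
  the last variable of \<open>A # \<Gamma>\<close>, is variable 1.\<close>

abbreviation ev :: "'c exp" where
  "ev \<equiv> App (Var 0) (Var (Suc 0))"

lemma Pi_isTy: "\<Gamma> \<turnstile> isTy (Pi A B)"
  using A B by (rule Pi_form)

lemma wk_Pi: "wk (Pi A B) = Pi (wk A) (ren B (up Suc))"
  by simp

lemma codomain_isTy:
  assumes Y: "\<Gamma> \<turnstile> isTy Y"
  shows "wk A # Y # \<Gamma> \<turnstile> isTy (ren B (up Suc))"
  using subst_isTy[OF B ctx_mor_lift[OF ctx_mor_wk[OF ctx_valid[OF Y] Y] A refl]]
  by (simp add: subst_calculus)

lemma arr_ev: "arr (A # \<Gamma>) (wk (Pi A B)) B ev"
proof -
  \<comment> \<open>The counit is evaluation at the generic argument \<open>Var 0\<close> of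
    \<open>A # \<Gamma>\<close>. Substituting it into the pulled back \<open>B\<close> recovers
    \<open>B\<close>.\<close>
  have "wk (Pi A B) # A # \<Gamma> \<turnstile> isTm (App (Var 0) (wk (Var 0))) (wk ((ren B (up Suc))\<langle>Var 0 \<rhd> Var\<rangle>))"
    unfolding wk_Pi using var0[OF A] codomain_isTy[OF A] by (intro happly_hom) (simp_all add: ren_eq_subst)
  then show ?thesis
    using B wk_isTy[OF A Pi_isTy] by (simp add: arr_def subst_calculus)
qed

context
  fixes Y
  assumes Y: "\<Gamma> \<turnstile> isTy Y"
begin

lemma arr_Pi: "arr \<Gamma> Y (Pi A B) h \<longleftrightarrow> Y # \<Gamma> \<turnstile> isTm h (Pi (wk A) (ren B (up Suc)))"
  using Y Pi_isTy by (simp add: arr_def)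

lemma cell_Pi: "cell \<Gamma> Y (Pi A B) h k p \<longleftrightarrow> arr \<Gamma> Y (Pi A B) h \<and> arr \<Gamma> Y (Pi A B) k \<and>
    Y # \<Gamma> \<turnstile> isTm p (Idt (Pi (wk A) (ren B (up Suc))) h k)"
  by (simp add: cell_def)

lemma ev_surj:
  assumes f: "arr (A # \<Gamma>) (wk Y) B f"
  shows "\<exists>h. arr \<Gamma> Y (Pi A B) h \<and> wk Y # A # \<Gamma> \<turnstile> eqTm (ev\<langle>cmp_sub (ren h (up Suc))\<rangle>) f (wk B)"
proof -
  \<comment> \<open>This is \<open>f\<close> with its two last variables exchanged, so that the one
    of type \<open>A\<close> can be abstracted.\<close>
  let ?f = "f\<langle>Var (Suc 0) \<rhd> Var 0 \<rhd> (\<lambda>i. Var (Suc (Suc i)))\<rangle>"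
  have f': "wk A # Y # \<Gamma> \<turnstile> isTm ?f (ren B (up Suc))"
    using subst_isTm[OF arrD(3)[OF f] ctx_mor_swap[OF A Y]] by (simp add: subst_calculus)
  have lam: "arr \<Gamma> Y (Pi A B) (Lam ?f)"
    using Lam_intro[OF f'] by (simp add: arr_Pi)
  have A': "Y # \<Gamma> \<turnstile> isTy (wk A)"
    using wk_isTy[OF Y A] .
  \<comment> \<open>In the composite, \<open>Lam ?f\<close> is weakened to the context where it is
    evaluated, so \<beta> is applied to the weakened \<open>?f\<close>. At the generic argument this
    becomes \<open>?f\<close> again.\<close>
  have "wk (wk A) # wk A # Y # \<Gamma> \<turnstile> isTm (?f\<langle>lift (\<lambda>i. Var (Suc i))\<rangle>)
    ((ren B (up Suc))\<langle>lift (\<lambda>i. Var (Suc i))\<rangle>)"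
    using subst_isTm[OF f' ctx_mor_lift[OF ctx_mor_wk[OF ctx_valid[OF A'] A'] A' refl]]
    by (simp add: subst_calculus)
  from Pi_comp[OF this, of "Var 0"] var0[OF A']
  have "wk A # Y # \<Gamma> \<turnstile> eqTm (App (Lam (?f\<langle>lift (\<lambda>i. Var (Suc i))\<rangle>)) (Var 0)) ?f (ren B (up Suc))"
    by (simp add: subst_calculus)
  \<comment> \<open>Exchanging twice is the identity, so back in \<open>wk Y # A # \<Gamma>\<close>
    the right-hand side is \<open>f\<close>.\<close>
  from subst_eqTm[OF this ctx_mor_swap[OF Y A]] lam show ?thesis
    by (intro exI[of _ "Lam ?f"]) (simp add: subst_calculus)
qed

text \<open>Whiskering with \<open>ev\<close> is, up to exchange, \<open>happly\<close> at the
  generic argument of type \<open>A\<close>. The exchanged \<open>q\<close> is thus a family of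
  pointwise identity proofs; \<open>Ext\<close> assembles it into a 2-cell, which
  \<open>Ext_app\<close> sends back to \<open>q\<close>.\<close>

lemma ev_full:
  assumes h: "arr \<Gamma> Y (Pi A B) h" and k: "arr \<Gamma> Y (Pi A B) k"
    and q: "cell (A # \<Gamma>) (wk Y) B (ev\<langle>cmp_sub (ren h (up Suc))\<rangle>) (ev\<langle>cmp_sub (ren k (up Suc))\<rangle>) q"
  shows "\<exists>p. cell \<Gamma> Y (Pi A B) h k p \<and> wk Y # A # \<Gamma> \<turnstile>
    eqTm (ap (ren ev (up Suc)) (ren h (up Suc)) (ren k (up Suc)) (ren p (up Suc))) q
      (Idt (wk B) (ev\<langle>cmp_sub (ren h (up Suc))\<rangle>) (ev\<langle>cmp_sub (ren k (up Suc))\<rangle>))"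
proof -
  let ?q = "q\<langle>Var (Suc 0) \<rhd> Var 0 \<rhd> (\<lambda>i. Var (Suc (Suc i)))\<rangle>"
  have q': "wk A # Y # \<Gamma> \<turnstile> isTm ?q (Idt (ren B (up Suc)) (App (wk h) (Var 0)) (App (wk k) (Var 0)))"
    using subst_isTm[OF cellD(3)[OF q] ctx_mor_swap[OF A Y]] by (simp add: subst_calculus)
  note B' = codomain_isTy[OF Y] and h' = h[unfolded arr_Pi] and k' = k[unfolded arr_Pi]
  have "cell \<Gamma> Y (Pi A B) h k (Ext h k ?q)"
    unfolding cell_Pi using h k Ext_intro[OF B' h' k' q'] by simp
  then show ?thesis
    using subst_eqTm[OF Ext_app[OF B' h' k' q'] ctx_mor_swap[OF Y A]]
    by (intro exI[of _ "Ext h k ?q"]) (simp add: happly_eq_ap ap_subst subst_calculus)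
qed

text \<open>After exchange the whiskered 2-cells are instances of \<open>happly\<close> at the
  generic argument, and the claim becomes \<open>happly_inject\<close>.\<close>

lemma ev_faithful:
  assumes p: "cell \<Gamma> Y (Pi A B) h k p" and q: "cell \<Gamma> Y (Pi A B) h k q"
    and eq: "wk Y # A # \<Gamma> \<turnstile>
      eqTm (ap (ren ev (up Suc)) (ren h (up Suc)) (ren k (up Suc)) (ren p (up Suc)))
        (ap (ren ev (up Suc)) (ren h (up Suc)) (ren k (up Suc)) (ren q (up Suc)))
        (Idt (wk B) (ev\<langle>cmp_sub (ren h (up Suc))\<rangle>) (ev\<langle>cmp_sub (ren k (up Suc))\<rangle>))"
  shows "Y # \<Gamma> \<turnstile> eqTm p q (Idt (wk (Pi A B)) h k)"
  unfolding wk_Pi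
  using subst_eqTm[OF eq ctx_mor_swap[OF A Y]] p q
  by (intro happly_inject[OF codomain_isTy[OF Y]])
    (simp_all add: happly_eq_ap ap_subst subst_calculus cell_Pi arr_Pi)

end

lemma retract_bicoreflection_Pi:
  "retract_bicoreflection (T S \<Gamma>) (T S (A # \<Gamma>)) (weakening S \<Gamma> A) (ty_cls S (A # \<Gamma>) B)
    (ty_cls S \<Gamma> (Pi A B)) (arr_cls (A # \<Gamma>) (wk (Pi A B)) B ev)"
proof -
  let ?K = "T S \<Gamma>" and ?L = "T S (A # \<Gamma>)" and ?U = "weakening S \<Gamma> A"
  let ?x = "ty_cls S (A # \<Gamma>) B" and ?G = "ty_cls S \<Gamma> (Pi A B)" and ?\<epsilon> = "arr_cls (A # \<Gamma>) (wk (Pi A B)) B ev"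
  note Pi = Pi_isTy and wkPi = wk_isTy[OF A Pi_isTy]
  have "surjective_equivalence (HomC ?K y ?G) (HomC ?L (F0 ?U y) ?x)
      (\<lambda>h. Cmp1 ?L (F0 ?U y) (F0 ?U ?G) ?x ?\<epsilon> (F1 ?U y ?G h))
      (\<lambda>h h' \<alpha>. WhL ?L (F0 ?U y) (F0 ?U ?G) ?x ?\<epsilon> (F1 ?U y ?G h) (F1 ?U y ?G h') (F2 ?U y ?G h h' \<alpha>))"
    if y: "y \<in> Obj2 ?K" for y
  proof -
    from y obtain Y where y: "y = ty_cls S \<Gamma> Y" and Y: "\<Gamma> \<turnstile> isTy Y"
      by (auto simp: Obj_T)
    note wkY = wk_isTy[OF A Y]
    let ?P = "\<lambda>h. Cmp1 ?L (F0 ?U y) (F0 ?U ?G) ?x ?\<epsilon> (F1 ?U y ?G h)"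
    let ?Pa = "\<lambda>h h' \<alpha>. WhL ?L (F0 ?U y) (F0 ?U ?G) ?x ?\<epsilon> (F1 ?U y ?G h) (F1 ?U y ?G h') (F2 ?U y ?G h h' \<alpha>)"
    have P: "?P (arr_cls \<Gamma> Y (Pi A B) h) = arr_cls (A # \<Gamma>) (wk Y) B (ev\<langle>cmp_sub (ren h (up Suc))\<rangle>)"
      if "arr \<Gamma> Y (Pi A B) h" for h
      using that by (simp only: y F0_cls[OF Y] F0_cls[OF Pi] F1_cls Cmp1_cls[OF wk_arr[OF that A] arr_ev])
    have Pa: "?Pa (arr_cls \<Gamma> Y (Pi A B) h) (arr_cls \<Gamma> Y (Pi A B) k) (cell_cls \<Gamma> Y (Pi A B) h k p)
        = cell_cls (A # \<Gamma>) (wk Y) B (ev\<langle>cmp_sub (ren h (up Suc))\<rangle>) (ev\<langle>cmp_sub (ren k (up Suc))\<rangle>)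
          (ap (ren ev (up Suc)) (ren h (up Suc)) (ren k (up Suc)) (ren p (up Suc)))"
      if p: "cell \<Gamma> Y (Pi A B) h k p" for h k p
      using cellD(1,2)[OF p]
      by (simp only: y F0_cls[OF Y] F0_cls[OF Pi] F1_cls F2_cls[OF p] WhL_cls[OF arr_ev wk_cell[OF p A]])
    have arrs: "arr (A # \<Gamma>) (wk Y) B (ev\<langle>cmp_sub (ren h (up Suc))\<rangle>)" if "arr \<Gamma> Y (Pi A B) h" for h
      using arr_comp[OF wk_arr[OF that A] arr_ev] .
    have objK: "Obj (HomC ?K y ?G) = arr_cls \<Gamma> Y (Pi A B) ` {h. arr \<Gamma> Y (Pi A B) h}"
      by (simp only: HomC_T y Arr_cls[OF Y Pi])
    have objL: "Obj (HomC ?L (F0 ?U y) ?x) = arr_cls (A # \<Gamma>) (wk Y) B ` {f. arr (A # \<Gamma>) (wk Y) B f}"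
      by (simp only: HomC_T y F0_cls[OF Y] Arr_cls[OF wkY B])
    show ?thesis
    proof (rule surjective_equivalence_if_fully_faithful)
      show "is_functor (HomC ?K y ?G) (HomC ?L (F0 ?U y) ?x) ?P ?Pa"
        unfolding HomC_T y F0_cls[OF Y] F0_cls[OF Pi]
        by (rule is_functor_comp[OF weakening_hom_functor[OF Y Pi] WhL_functor[OF wkY arr_ev]])
    next
      fix d assume "d \<in> Obj (HomC ?L (F0 ?U y) ?x)"
      then obtain f where d: "d = arr_cls (A # \<Gamma>) (wk Y) B f" and f: "arr (A # \<Gamma>) (wk Y) B f"
        unfolding objL by blast
      obtain h where h: "arr \<Gamma> Y (Pi A B) h"
        "wk Y # A # \<Gamma> \<turnstile> eqTm (ev\<langle>cmp_sub (ren h (up Suc))\<rangle>) f (wk B)"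
        using ev_surj[OF Y f] by blast
      then have "?P (arr_cls \<Gamma> Y (Pi A B) h) = d"
        unfolding P[OF h(1)] d using tm_cls_eqI by metis
      with h show "\<exists>c \<in> Obj (HomC ?K y ?G). ?P c = d"
        unfolding objK by blast
    next
      fix a b v assume "a \<in> Obj (HomC ?K y ?G)" "b \<in> Obj (HomC ?K y ?G)"
        and v: "v \<in> Hom (HomC ?L (F0 ?U y) ?x) (?P a) (?P b)"
      then obtain h k where a: "a = arr_cls \<Gamma> Y (Pi A B) h" and b: "b = arr_cls \<Gamma> Y (Pi A B) k"
        and h: "arr \<Gamma> Y (Pi A B) h" and k: "arr \<Gamma> Y (Pi A B) k"
        unfolding objK by blast
      from v[unfolded a b P[OF h] P[OF k], unfolded HomC_T y F0_cls[OF Y] Cell_cls[OF wkY B arrs[OF h] arrs[OF k]]]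
      obtain q where v: "v = cell_cls (A # \<Gamma>) (wk Y) B (ev\<langle>cmp_sub (ren h (up Suc))\<rangle>)
          (ev\<langle>cmp_sub (ren k (up Suc))\<rangle>) q"
        and q: "cell (A # \<Gamma>) (wk Y) B (ev\<langle>cmp_sub (ren h (up Suc))\<rangle>) (ev\<langle>cmp_sub (ren k (up Suc))\<rangle>) q"
        by blast
      obtain p where p: "cell \<Gamma> Y (Pi A B) h k p" and eq: "wk Y # A # \<Gamma> \<turnstile>
        eqTm (ap (ren ev (up Suc)) (ren h (up Suc)) (ren k (up Suc)) (ren p (up Suc))) q
          (Idt (wk B) (ev\<langle>cmp_sub (ren h (up Suc))\<rangle>) (ev\<langle>cmp_sub (ren k (up Suc))\<rangle>))"
        using ev_full[OF Y h k q] by blast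
      have "cell_cls \<Gamma> Y (Pi A B) h k p \<in> Hom (HomC ?K y ?G) a b"
        unfolding HomC_T y a b Cell_cls[OF Y Pi h k] using p by blast
      moreover have "?Pa a b (cell_cls \<Gamma> Y (Pi A B) h k p) = v"
        unfolding a b Pa[OF p] v using tm_cls_eqI[OF eq] by (rule sym)
      ultimately show "\<exists>u \<in> Hom (HomC ?K y ?G) a b. ?Pa a b u = v"
        by blast
    next
      fix a b u u' assume "a \<in> Obj (HomC ?K y ?G)" "b \<in> Obj (HomC ?K y ?G)"
        and u: "u \<in> Hom (HomC ?K y ?G) a b" "u' \<in> Hom (HomC ?K y ?G) a b" and eq: "?Pa a b u = ?Pa a b u'"
      then obtain h k where a: "a = arr_cls \<Gamma> Y (Pi A B) h" and b: "b = arr_cls \<Gamma> Y (Pi A B) k"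
        and h: "arr \<Gamma> Y (Pi A B) h" and k: "arr \<Gamma> Y (Pi A B) k"
        unfolding objK by blast
      from u[unfolded HomC_T y a b Cell_cls[OF Y Pi h k]]
      obtain p q where u: "u = cell_cls \<Gamma> Y (Pi A B) h k p" "u' = cell_cls \<Gamma> Y (Pi A B) h k q"
        and p: "cell \<Gamma> Y (Pi A B) h k p" and q: "cell \<Gamma> Y (Pi A B) h k q"
        by blast
      have "Y # \<Gamma> \<turnstile> eqTm p q (Idt (wk (Pi A B)) h k)"
        \<comment> \<open>Equality of classes yields a definitional equation as soon as one
          representative is known to be well typed; \<open>cell_whl\<close> provides this.\<close>
        using tm_cls_eqD[OF eq[unfolded a b u Pa[OF p] Pa[OF q]]]
          cellD(3)[OF cell_whl[OF arr_ev wk_cell[OF q A]]] by (intro ev_faithful[OF Y p q]) blast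
      then show "u = u'"
        unfolding u by (rule tm_cls_eqI[symmetric])
    qed
  qed
  moreover have "?G \<in> Obj2 ?K"
    using Pi by (simp add: Obj_T)
  moreover have "?\<epsilon> \<in> Arr ?L (F0 ?U ?G) ?x"
    unfolding HomC_T F0_cls[OF Pi] Arr_cls[OF wkPi B] using arr_ev by blast
  ultimately show ?thesis
    unfolding retract_bicoreflection_def by blast
qed

end

text \<open>\<open>retract_bicoreflection_Pi\<close> speaks of a representative \<open>B\<close>.
  The biadjoint arises by choosing a bicoreflection once for each class of types.\<close>

lemma right_retract_biadjoint_weakening:
  "\<exists>Pi_A \<epsilon>. right_retract_biadjoint (T S \<Gamma>) (T S (A # \<Gamma>)) (weakening S \<Gamma> A) Pi_A \<epsilon>"
proof -
  have "\<exists>g e. retract_bicoreflection (T S \<Gamma>) (T S (A # \<Gamma>)) (weakening S \<Gamma> A) x g e"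
    if x: "x \<in> Obj2 (T S (A # \<Gamma>))" for x
    using x retract_bicoreflection_Pi unfolding Obj_T by blast
  then obtain G \<epsilon> where "retract_bicoreflection (T S \<Gamma>) (T S (A # \<Gamma>)) (weakening S \<Gamma> A) x (G x) (\<epsilon> x)"
    if "x \<in> Obj2 (T S (A # \<Gamma>))" for x
    by metis
  then show ?thesis
    using two_functor_weakening unfolding right_retract_biadjoint_def by blast
qed

end

end

theorem proposition4p5p1:
  fixes S :: "'c type_theory" and \<Gamma> :: "'c ctx" and A :: "'c exp"
  assumes "ml2 S"
    and "wf_ctx S \<Gamma>"
    and "S \<Gamma> (isTy A)"
  shows "\<exists>Pi_A \<epsilon>. right_retract_biadjoint (T S \<Gamma>) (T S (A # \<Gamma>)) (weakening S \<Gamma> A) Pi_A \<epsilon>"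
  using ml2.right_retract_biadjoint_weakening[OF assms(1,3)] .

end
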